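(* Let $\psi:\mathbb{R}\to\mathbb{C}$ be the characteristic exponent of a Lévy process on $\mathbb{R}$ with Lévy triplet $(b,Q,\nu)$. Suppose there exists $\beta\ge0$ such that $\int_{|y|\ge1}|y|^\beta\,\nu(dy)<\infty$. If $\{\xi\in\mathbb{R}\mid\psi(\xi)=0\}=\{0\}$ and $f\in L^\infty_{-\beta}(\mathbb{R})$ is a weak solution of $\psi(D)f=0$, then $f(x)=c_1x+c_0$ (Lebesgue a.e.) for some constants $c_1,c_0$.
   Context: The characteristic exponent is given by the Lévy–Khintchine formula $\psi(\xi)=-ib\xi+\tfrac12Q\xi^2+\int_{0<|y|<1}(1-e^{iy\xi}+iy\xi)\,\nu(dy)+\int_{|y|\ge1}(1-e^{iy\xi})\,\nu(dy)$ with $b\in\mathbb{R}$, $Q\ge0$, $\nu$ a measure on $\mathbb{R}\setminus\{0\}$ with $\int\min\{1,y^2\}\nu(dy)<\infty$. $\Lambda(x)=(1+x^2)^{1/2}$ and $L^\infty_{-\beta}(\mathbb{R})=\{f\in L^\infty_{\mathrm{loc}}\mid \operatorname{ess\,sup}\Lambda^{-\beta}|f|<\infty\}$. A weak solution of $\psi(D)f=0$ means $\int f\,\widetilde\psi(D)\phi\,dx=0$ for all $\phi\in C_c^\infty(\mathbb{R})$, where $\widetilde\psi(\xi)=\psi(-\xi)$ and $\widetilde\psi(D)\phi=\mathcal{F}^{-1}(\widetilde\psi\,\widehat\phi)$. *)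

theory Defs
  imports "HOL-Analysis.Analysis"
begin

definition levy_triplet :: "real \<Rightarrow> real \<Rightarrow> real measure \<Rightarrow> bool" where
  "levy_triplet b Q nu \<longleftrightarrow>
     Q \<ge> 0 \<and> sets nu = sets borel \<and> emeasure nu {0} = 0 \<and>
     (\<integral>\<^sup>+ y. ennreal (min 1 (y\<^sup>2)) \<partial>nu) < \<infinity>"

text \<open>Characteristic exponent given by the Levy-Khintchine formula.\<close>
definition levy_exponent :: "real \<Rightarrow> real \<Rightarrow> real measure \<Rightarrow> real \<Rightarrow> complex" where
  "levy_exponent b Q nu \<xi> =
     - \<i> * complex_of_real (b * \<xi>) + complex_of_real (Q * \<xi>\<^sup>2 / 2)
     + (LINT y:{y. 0 < \<bar>y\<bar> \<and> \<bar>y\<bar> < 1}|nu.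
          1 - cis (y * \<xi>) + \<i> * complex_of_real (y * \<xi>))
     + (LINT y:{y. 1 \<le> \<bar>y\<bar>}|nu. 1 - cis (y * \<xi>))"

definition test_function :: "(real \<Rightarrow> complex) \<Rightarrow> bool" where
  "test_function \<phi> \<longleftrightarrow>
     (\<exists>D :: nat \<Rightarrow> real \<Rightarrow> complex. D 0 = \<phi> \<and>
        (\<forall>n x. (D n has_vector_derivative D (Suc n) x) (at x))) \<and>
     (\<exists>R. \<forall>x. R < \<bar>x\<bar> \<longrightarrow> \<phi> x = 0)"

definition fourier :: "(real \<Rightarrow> complex) \<Rightarrow> real \<Rightarrow> complex" where
  "fourier \<phi> \<xi> = (LINT x|lborel. cis (- (x * \<xi>)) * \<phi> x)"

definition inv_fourier :: "(real \<Rightarrow> complex) \<Rightarrow> real \<Rightarrow> complex" where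
  "inv_fourier g x = complex_of_real (1 / (2 * pi)) * (LINT \<xi>|lborel. cis (x * \<xi>) * g \<xi>)"

definition symbol_op :: "(real \<Rightarrow> complex) \<Rightarrow> (real \<Rightarrow> complex) \<Rightarrow> real \<Rightarrow> complex" where
  "symbol_op p \<phi> = inv_fourier (\<lambda>\<xi>. p \<xi> * fourier \<phi> \<xi>)"

definition Linf_weighted :: "real \<Rightarrow> (real \<Rightarrow> complex) set" where
  "Linf_weighted \<beta> = {f. f \<in> borel_measurable lebesgue \<and>
     (\<exists>C. AE x in lebesgue. (1 + x\<^sup>2) powr (- \<beta> / 2) * norm (f x) \<le> C)}"

definition weak_solution :: "(real \<Rightarrow> complex) \<Rightarrow> (real \<Rightarrow> complex) \<Rightarrow> bool" where
  "weak_solution \<psi> f \<longleftrightarrow>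
     (\<forall>\<phi>. test_function \<phi> \<longrightarrow>
        (let g = symbol_op (\<lambda>\<xi>. \<psi> (- \<xi>)) \<phi> in
          integrable lebesgue (\<lambda>x. f x * g x) \<and> (LINT x|lebesgue. f x * g x) = 0))"

end

theory Submission
  imports Defs "HOL-Probability.Probability"
begin

text \<open>Test the equation against \<open>\<psi>\<close>-images of test functions: these are functions \<open>g\<close> in
  the weighted space \<open>L\<^sup>1((1 + \<bar>x\<bar>)\<^sup>\<beta>)\<close>, orthogonal to all translates of \<open>f\<close>, with Fourier transform
  nonzero at any prescribed frequency other than 0. A local Wiener argument then removes
  every frequency of \<open>f\<close> away from 0. The weight is submultiplicative of polynomial growth, so
  rescaling it makes only the unweighted \<open>L\<^sup>1\<close> norm matter in the Neumann argument, although
  \<open>\<psi>\<close> has limited smoothness. Hence \<open>f\<close> has spectrum \<open>{0}\<close>, and its polynomial growth makes it a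
  polynomial. Finally, a polynomial of degree at least 2 in the kernel would force both
  \<open>\<psi>'(0) = 0\<close> and \<open>\<psi>''(0) = Q + \<integral> y\<^sup>2 \<nu>(dy) = 0\<close>, hence \<open>\<psi> = 0\<close>.\<close>

section \<open>Smooth functions and cutoffs\<close>

text \<open>No distributional Fourier transform of \<open>f\<close> is formed. The pairing of its
  spectrum with a frequency cutoff \<theta> is encoded by the function
  \<open>corr f (fourier \<theta>)\<close>, and claims about the spectrum become claims that such
  functions vanish. Two kernel classes are needed because \<open>levy_op \<phi>\<close> decays only
  as far as the moment of order \<beta> allows, while transforms of test functions decay rapidly. In
  the local argument the window is fixed before \<theta> is chosen, and the constant comparing the
  rescaled weight with the original one enters only the starting bound of an iteration, where it is
  halved away. At the origin the proof splits at \<beta> = 2: below it the second moment of \<nu>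
  may be infinite, but growth already excludes quadratic polynomials; from 2 on growth permits them,
  but the second moment is available. Since \<open>f\<close> is merely measurable, it is recovered
  from its integrals over intervals.\<close>

primrec Ck :: "nat \<Rightarrow> (real \<Rightarrow> complex) \<Rightarrow> bool" where
  "Ck 0 f \<longleftrightarrow> continuous_on UNIV f"
| "Ck (Suc k) f \<longleftrightarrow> (\<exists>f'. (\<forall>x. (f has_vector_derivative f' x) (at x)) \<and> Ck k f')"

lemma Ck_SucI: "(\<And>x. (f has_vector_derivative f' x) (at x)) \<Longrightarrow> Ck k f' \<Longrightarrow> Ck (Suc k) f"
  by auto

lemma Ck_Suc_imp: "Ck (Suc k) f \<Longrightarrow> Ck k f"
proof (induction k arbitrary: f)
  case 0
  then show ?case
    by (force intro!: continuous_at_imp_continuous_on dest: has_vector_derivative_continuous)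
next
  case (Suc k)
  then obtain f' where "\<forall>x. (f has_vector_derivative f' x) (at x)" "Ck (Suc k) f'"
    by auto
  with Suc.IH[of f'] show ?case by auto
qed

lemma Ck_const: "Ck k (\<lambda>_. c)"
proof (induction k arbitrary: c)
  case (Suc k)
  show ?case by (rule Ck_SucI[OF _ Suc.IH[of 0]]) (auto intro!: derivative_eq_intros)
qed auto

lemma Ck_add: "Ck k f \<Longrightarrow> Ck k g \<Longrightarrow> Ck k (\<lambda>x. f x + g x)"
proof (induction k arbitrary: f g)
  case (Suc k)
  then obtain f' g' where "\<forall>x. (f has_vector_derivative f' x) (at x)" "Ck k f'"
    "\<forall>x. (g has_vector_derivative g' x) (at x)" "Ck k g'"
    by auto
  with Suc.IH[of f' g'] show ?case
    by (intro Ck_SucI[of _ "\<lambda>x. f' x + g' x"]) (auto intro!: derivative_intros)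
qed (auto intro: continuous_intros)

text \<open>Recursion on the order of smoothness pays off here: the product rule and the induction
  hypothesis suffice, whereas derivative sequences as in \<open>test_function\<close> would call for
  the Leibniz formula.\<close>

lemma Ck_mult: "Ck k f \<Longrightarrow> Ck k g \<Longrightarrow> Ck k (\<lambda>x. f x * g x)"
proof (induction k arbitrary: f g)
  case (Suc k)
  then obtain f' g' where fg: "\<forall>x. (f has_vector_derivative f' x) (at x)" "Ck k f'"
    "\<forall>x. (g has_vector_derivative g' x) (at x)" "Ck k g'"
    by auto
  have "Ck k (\<lambda>x. f x * g' x + f' x * g x)"
    using fg Suc Ck_Suc_imp by (intro Ck_add) blast+
  then show ?case
    using fg by (intro Ck_SucI[of _ "\<lambda>x. f x * g' x + f' x * g x"])
      (auto intro!: has_vector_derivative_mult)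
qed (auto intro: continuous_intros)

lemma Ck_affine: "Ck k f \<Longrightarrow> Ck k (\<lambda>x. f (c * x + d))"
proof (induction k arbitrary: f)
  case 0
  then show ?case
    by (auto intro!: continuous_on_compose2[of UNIV f] continuous_intros)
next
  case (Suc k)
  then obtain f' where f': "\<And>x. (f has_vector_derivative f' x) (at x)" "Ck k f'"
    by auto
  have "((\<lambda>x. f (c * x + d)) has_vector_derivative complex_of_real c * f' (c * x + d)) (at x)" for x
  proof -
    have "((\<lambda>x. c * x + d) has_vector_derivative c) (at x)"
      by (auto intro!: derivative_eq_intros)
    from vector_diff_chain_at[OF this f'(1)] show ?thesis
      by (simp add: o_def scaleR_conv_of_real)
  qed
  moreover have "Ck k (\<lambda>x. complex_of_real c * f' (c * x + d))"
    by (intro Ck_mult Ck_const Suc.IH f')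
  ultimately show ?case by (rule Ck_SucI)
qed

definition smooth :: "(real \<Rightarrow> complex) \<Rightarrow> bool" where
  "smooth f \<longleftrightarrow> (\<forall>k. Ck k f)"

definition vd :: "(real \<Rightarrow> complex) \<Rightarrow> real \<Rightarrow> complex" where
  "vd f x = vector_derivative f (at x)"

text \<open>\<open>Ck (Suc k)\<close> supplies a derivative that could a priori depend on
  \<open>k\<close>; uniqueness of derivatives identifies all of them with
  \<open>vd f\<close>.\<close>

lemma smooth_imp:
  assumes "smooth f"
  shows "(f has_vector_derivative vd f x) (at x)" and "smooth (vd f)"
proof -
  have *: "(\<forall>x. (f has_vector_derivative vd f x) (at x)) \<and> Ck k (vd f)" for k
  proof -
    obtain f' where f': "\<forall>x. (f has_vector_derivative f' x) (at x)" "Ck k f'"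
      using assms[unfolded smooth_def, rule_format, of "Suc k"] by auto
    moreover have "vd f = f'"
      using f' by (auto simp: vd_def vector_derivative_at)
    ultimately show ?thesis by simp
  qed
  show "(f has_vector_derivative vd f x) (at x)" "smooth (vd f)"
    using * by (auto simp: smooth_def)
qed

lemma smoothI:
  assumes "\<And>x. (f has_vector_derivative f' x) (at x)" "smooth f'"
  shows "smooth f"
proof -
  have "Ck (Suc k) f" for k using Ck_SucI[OF assms(1)] assms(2) by (auto simp: smooth_def)
  then show ?thesis unfolding smooth_def using Ck_Suc_imp by blast
qed

lemma vdI: "(\<And>x. (f has_vector_derivative f' x) (at x)) \<Longrightarrow> vd f = f'"
  by (auto simp: vd_def vector_derivative_at)

lemma smooth_continuous: "smooth f \<Longrightarrow> continuous_on UNIV f"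
  unfolding smooth_def by (metis Ck.simps(1))

text \<open>The bridge to \<open>test_function\<close>: the iterates of \<open>vd\<close> serve as
  the sequence \<open>D\<close>.\<close>

lemma smooth_iff_derivatives:
  "smooth f \<longleftrightarrow> (\<exists>D :: nat \<Rightarrow> real \<Rightarrow> complex. D 0 = f \<and>
     (\<forall>n x. (D n has_vector_derivative D (Suc n) x) (at x)))"
proof
  assume f: "smooth f"
  have "smooth ((vd ^^ n) f)" for n
    by (induction n) (auto simp: f smooth_imp)
  then show "\<exists>D. D 0 = f \<and> (\<forall>n x. (D n has_vector_derivative D (Suc n) x) (at x))"
    by (intro exI[of _ "\<lambda>n. (vd ^^ n) f"]) (auto simp: smooth_imp)
next
  assume "\<exists>D. D 0 = f \<and> (\<forall>n x. (D n has_vector_derivative D (Suc n) x) (at x))"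
  then obtain D where D: "D 0 = f" "\<And>n x. (D n has_vector_derivative D (Suc n) x) (at x)"
    by blast
  have "Ck k (D n)" for k n
  proof (induction k arbitrary: n)
    case 0
    show ?case
      using D(2) by (auto intro!: has_vector_derivative_continuous continuous_at_imp_continuous_on)
  next
    case (Suc k)
    show ?case by (rule Ck_SucI[OF D(2) Suc.IH])
  qed
  then show "smooth f" using D(1) by (auto simp: smooth_def)
qed

lemma smooth_const: "smooth (\<lambda>_. c)"
  and smooth_add: "smooth f \<Longrightarrow> smooth g \<Longrightarrow> smooth (\<lambda>x. f x + g x)"
  and smooth_mult: "smooth f \<Longrightarrow> smooth g \<Longrightarrow> smooth (\<lambda>x. f x * g x)"
  and smooth_affine: "smooth f \<Longrightarrow> smooth (\<lambda>x. f (c' * x + d))"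
  by (auto simp: smooth_def Ck_const Ck_add Ck_mult Ck_affine)

lemma smooth_diff: "smooth f \<Longrightarrow> smooth g \<Longrightarrow> smooth (\<lambda>x. f x - g x)"
  using smooth_add[of f "\<lambda>x. (-1) * g x"] smooth_mult[OF smooth_const, of g "-1"] by simp

lemma smooth_of_real: "smooth complex_of_real"
  by (rule smoothI[OF _ smooth_const[of 1]])
     (auto intro!: derivative_eq_intros has_vector_derivative_of_real)

lemma smooth_power: "smooth f \<Longrightarrow> smooth (\<lambda>x. f x ^ n)"
  by (induction n) (auto intro: smooth_const smooth_mult)

lemma has_vector_derivative_cis:
  "((\<lambda>x. cis (a * x)) has_vector_derivative (\<i> * of_real a * cis (a * x))) (at x)"
proof -
  have "((\<lambda>x. exp (\<i> * of_real a * of_real x)) has_vector_derivative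
      (\<i> * of_real a * exp (\<i> * of_real a * of_real x))) (at x)"
    by (rule has_vector_derivative_real_field) (auto intro!: derivative_eq_intros)
  then show ?thesis by (simp add: cis_conv_exp mult.assoc)
qed

lemma smooth_cis: "smooth (\<lambda>x. cis (a * x))"
proof -
  have "Ck k (\<lambda>x. cis (a * x))" for k
  proof (induction k)
    case 0
    show ?case by (auto intro!: continuous_intros)
  next
    case (Suc k)
    show ?case
      by (rule Ck_SucI[OF has_vector_derivative_cis]) (intro Ck_mult Ck_const Suc)
  qed
  then show ?thesis by (simp add: smooth_def)
qed

section \<open>Cutoffs built from the flat function \<open>exp (- 1 / x)\<close>\<close>

definition flat :: "nat \<Rightarrow> real \<Rightarrow> real" where
  "flat n x = (if x \<le> 0 then 0 else (1 / x) ^ n * exp (- 1 / x))"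

text \<open>This is the difference quotient of \<open>flat n\<close> at the origin. On the right,
  substituting \<open>inverse x\<close> turns it into a power divided by an exponential at
  infinity.\<close>

lemma flat_over_x: "((\<lambda>x. flat n x / x) \<longlongrightarrow> 0) (at 0)"
proof -
  have r: "((\<lambda>x. flat n x / x) \<longlongrightarrow> 0) (at_right 0)"
  proof -
    have "((\<lambda>x. x ^ Suc n / exp x) \<longlongrightarrow> (0::real)) at_top"
      by (rule tendsto_power_div_exp_0)
    then have "((\<lambda>x. inverse x ^ Suc n / exp (inverse x)) \<longlongrightarrow> (0::real)) (at_right 0)"
      by (rule filterlim_compose[OF _ filterlim_inverse_at_top_right])
    then show ?thesis
      by (rule Lim_transform_eventually)
        (auto simp: eventually_at_filter flat_def exp_minus field_simps)
  qed
  have l: "((\<lambda>x. flat n x / x) \<longlongrightarrow> 0) (at_left 0)"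
    by (rule Lim_transform_eventually[OF tendsto_const])
      (auto simp: eventually_at_filter flat_def)
  show ?thesis using l r by (simp add: filterlim_at_split)
qed

text \<open>The powers of \<open>1 / x\<close> in \<open>flat\<close> close the family under
  differentiation up to linear combinations, so smoothness can be proved by induction for all
  \<open>n\<close> at once.\<close>

lemma has_derivative_flat:
  "(flat n has_real_derivative (flat (n + 2) x - n * flat (n + 1) x)) (at x)"
proof -
  consider "x < 0" | "x = 0" | "x > 0" by linarith
  then show ?thesis
  proof cases
    case 1
    have "((\<lambda>_. 0) has_real_derivative 0) (at x)" by simp
    then have "(flat n has_real_derivative 0) (at x)"
      by (rule has_field_derivative_transform_within_open[where S = "{..<0}"])
        (use 1 in \<open>auto simp: flat_def\<close>)
    then show ?thesis using 1 by (simp add: flat_def)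
  next
    case 2
    have "(flat n has_real_derivative 0) (at 0)"
      using flat_over_x[of n] by (simp add: has_field_derivative_iff flat_def)
    then show ?thesis using 2 by (simp add: flat_def)
  next
    case 3
    have d: "((\<lambda>x. 1 / x) has_real_derivative - ((1 / x) ^ 2)) (at x)"
      using 3 by (auto intro!: derivative_eq_intros simp: power2_eq_square)
    have e: "((\<lambda>x. exp (- (1 / x))) has_real_derivative exp (- (1 / x)) * - (- ((1 / x) ^ 2))) (at x)"
      by (rule DERIV_fun_exp[OF DERIV_minus[OF d]])
    have p: "((\<lambda>x. (1 / x) ^ n) has_real_derivative n * (1 / x) ^ (n - 1) * - ((1 / x) ^ 2)) (at x)"
      using DERIV_power[OF d, of n] by (simp add: mult_ac)
    \<comment> \<open>Settles the truncated exponent \<open>n - 1\<close>: at \<open>n = 0\<close>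
      both sides carry the factor 0.\<close>
    have y: "real n * y ^ (n - 1) * - (y\<^sup>2) = - (n * y ^ (n + 1))" for y :: real
      by (cases n) (auto simp: power2_eq_square)
    have "((\<lambda>x. (1 / x) ^ n * exp (- 1 / x)) has_real_derivative
        (flat (n + 2) x - n * flat (n + 1) x)) (at x)"
      using DERIV_mult[OF p e] 3 unfolding y
      by (simp add: flat_def power_add algebra_simps power2_eq_square)
    then show ?thesis
      by (rule has_field_derivative_transform_within_open[where S = "{0<..}"])
        (use 3 in \<open>auto simp: flat_def\<close>)
  qed
qed

lemma smooth_flat: "smooth (\<lambda>x. of_real (flat n x))"
proof -
  have "Ck k (\<lambda>x. of_real (flat n x))" for k
  proof (induction k arbitrary: n)
    case 0
    show ?case
      using DERIV_continuous[OF has_derivative_flat]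
      by (auto intro!: continuous_at_imp_continuous_on continuous_intros)
  next
    case (Suc k)
    have "Ck k (\<lambda>x. of_real (flat (n + 2) x) + (- of_nat n) * of_real (flat (n + 1) x))"
      by (intro Ck_add Ck_mult Ck_const Suc)
    moreover have "((\<lambda>x. complex_of_real (flat n x)) has_vector_derivative
       (of_real (flat (n + 2) x) + (- of_nat n) * of_real (flat (n + 1) x))) (at x)" for x
      using has_vector_derivative_of_real[OF has_derivative_flat[of n x]]
      by simp
    ultimately show ?case by (intro Ck_SucI) auto
  qed
  then show ?thesis by (simp add: smooth_def)
qed

definition bump :: "real \<Rightarrow> real" where
  "bump x = flat 0 x * flat 0 (1 - x)"

lemma bump_nonneg: "bump x \<ge> 0"
  and bump_pos: "0 < x \<Longrightarrow> x < 1 \<Longrightarrow> bump x > 0"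
  and bump_eq_0: "x \<le> 0 \<or> x \<ge> 1 \<Longrightarrow> bump x = 0"
  by (auto simp: bump_def flat_def)

lemma smooth_bump: "smooth (\<lambda>x. of_real (bump x))"
  using smooth_mult[OF smooth_flat[of 0] smooth_affine[OF smooth_flat[of 0], of "-1" 1]]
  by (simp add: bump_def)

lemma continuous_bump: "continuous_on S bump"
proof -
  have "continuous_on UNIV (\<lambda>x. Re (of_real (bump x)))"
    by (intro continuous_intros smooth_continuous[OF smooth_bump])
  then show ?thesis using continuous_on_subset by auto
qed

lemma bump_integral_pos: "integral {0..1} bump > 0"
proof -
  have "integral {0..1} bump \<noteq> 0"
  proof
    assume "integral {0..1} bump = 0"
    then have "\<forall>x\<in>{0..1}. bump x = 0"
      using integral_eq_0_iff[OF continuous_bump, of 0 1] bump_nonneg by auto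
    then show False using bump_pos[of "1/2"] by auto
  qed
  then show ?thesis
    using integral_nonneg[OF integrable_continuous_real[OF continuous_bump, of 0 1]] bump_nonneg
    by fastforce
qed

text \<open>A smooth transition from 0 to 1 across the unit interval. For negative \<open>x\<close>
  the interval of integration is empty, so the formula gives 0 without a case distinction.\<close>

definition step :: "real \<Rightarrow> real" where
  "step x = integral {0..x} bump / integral {0..1} bump"

lemma step_0: "x \<le> 0 \<Longrightarrow> step x = 0"
  by (cases "x = 0") (auto simp: step_def)

lemma step_1: "x \<ge> 1 \<Longrightarrow> step x = 1"
proof -
  assume x: "x \<ge> 1"
  have "integral {0..1} bump + integral {1..x} bump = integral {0..x} bump"
    using x by (intro Henstock_Kurzweil_Integration.integral_combine integrable_continuous_real continuous_bump) auto
  moreover have "integral {1..x} bump = 0"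
    using integral_cong[of "{1..x}" bump "\<lambda>_. 0"] bump_eq_0 by simp
  ultimately show ?thesis using bump_integral_pos by (simp add: step_def)
qed

lemma step_deriv: "(step has_real_derivative bump x / integral {0..1} bump) (at x)"
proof (cases "x < 0")
  case True
  have "((\<lambda>_. 0) has_real_derivative 0) (at x)" by simp
  then have "(step has_real_derivative 0) (at x)"
    by (rule has_field_derivative_transform_within_open[where S = "{..<0}"])
      (use True in \<open>auto simp: step_0\<close>)
  then show ?thesis using True by (simp add: bump_eq_0)
next
  case False
  \<comment> \<open>Integrating from -1 makes \<open>x = 0\<close> an interior point, so the
    derivative within an interval is a two-sided one.\<close>
  have *: "((\<lambda>u. integral {-1..u} bump) has_real_derivative bump x) (at x)"
  proof -
    have "((\<lambda>u. integral {-1..u} bump) has_real_derivative bump x) (at x within {-1..x+1})"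
      by (rule integral_has_real_derivative[OF continuous_bump]) (use False in auto)
    then show ?thesis
      using at_within_interior[of x "{-1..x+1}"] False by auto
  qed
  have "integral {-1..u} bump = integral {0..u} bump" if "u > -1" for u
  proof (cases "u \<ge> 0")
    case True
    have "integral {-1..0} bump + integral {0..u} bump = integral {-1..u} bump"
      using True by (intro Henstock_Kurzweil_Integration.integral_combine integrable_continuous_real continuous_bump) auto
    moreover have "integral {-1..0} bump = 0"
      using integral_cong[of "{-1..0}" bump "\<lambda>_. 0"] bump_eq_0 by simp
    ultimately show ?thesis by simp
  next
    case False
    then have "integral {-1..u} bump = 0"
      using integral_cong[of "{-1..u}" bump "\<lambda>_. 0"] bump_eq_0 by simp
    then show ?thesis using False by simp
  qed
  then have "((\<lambda>u. integral {0..u} bump) has_real_derivative bump x) (at x)"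
    by (intro has_field_derivative_transform_within_open[OF *, of "{-1<..}"]) (use False in auto)
  then have "((\<lambda>u. integral {0..u} bump / integral {0..1} bump) has_real_derivative bump x / integral {0..1} bump) (at x)"
    by (rule DERIV_cdivide)
  then show ?thesis unfolding step_def[abs_def] .
qed

lemma smooth_step: "smooth (\<lambda>x. of_real (step x))"
proof (rule smoothI)
  show "((\<lambda>x. complex_of_real (step x)) has_vector_derivative
      of_real (inverse (integral {0..1} bump)) * of_real (bump x)) (at x)" for x
    using has_vector_derivative_of_real[OF step_deriv[of x]]
    by (simp add: divide_inverse mult.commute del: of_real_inverse)
  show "smooth (\<lambda>x. of_real (inverse (integral {0..1} bump)) * of_real (bump x))"
    by (intro smooth_mult smooth_const smooth_bump)
qed

text \<open>A plateau of height 1 on \<open>{-1..1}\<close> with support in \<open>{-2..2}\<close>;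
  because of the plateau, cutoffs at different scales agree near the origin.\<close>

definition cutoff :: "real \<Rightarrow> complex" where
  "cutoff x = of_real (step (x + 2)) * of_real (step (2 - x))"

lemma smooth_cutoff: "smooth cutoff"
  using smooth_mult[OF smooth_affine[OF smooth_step, of 1 2] smooth_affine[OF smooth_step, of "-1" 2]]
  by (simp add: cutoff_def[abs_def])

lemma cutoff_1: "\<bar>x\<bar> \<le> 1 \<Longrightarrow> cutoff x = 1"
  by (auto simp: cutoff_def step_1)

lemma cutoff_0: "\<bar>x\<bar> \<ge> 2 \<Longrightarrow> cutoff x = 0"
  using step_0 by (auto simp: cutoff_def abs_if split: if_splits)

section \<open>Test functions and integration by parts\<close>

lemma test_function_iff:
  "test_function \<phi> \<longleftrightarrow> smooth \<phi> \<and> (\<exists>R. \<forall>x. R < \<bar>x\<bar> \<longrightarrow> \<phi> x = 0)"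
  by (simp add: test_function_def smooth_iff_derivatives)

lemma test_function_mult: "test_function \<phi> \<Longrightarrow> smooth h \<Longrightarrow> test_function (\<lambda>x. h x * \<phi> x)"
  by (auto simp: test_function_iff smooth_mult)

lemma test_function_add: "test_function \<phi> \<Longrightarrow> test_function \<eta> \<Longrightarrow> test_function (\<lambda>x. \<phi> x + \<eta> x)"
  unfolding test_function_iff
proof (safe intro!: smooth_add)
  fix R R' assume "\<forall>x. R < \<bar>x\<bar> \<longrightarrow> \<phi> x = 0" "\<forall>x. R' < \<bar>x\<bar> \<longrightarrow> \<eta> x = 0"
  then show "\<exists>R. \<forall>x. R < \<bar>x\<bar> \<longrightarrow> \<phi> x + \<eta> x = 0"
    by (intro exI[of _ "max R R'"]) auto
qed

lemma test_function_diff: "test_function \<phi> \<Longrightarrow> test_function \<eta> \<Longrightarrow> test_function (\<lambda>x. \<phi> x - \<eta> x)"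
  using test_function_add[of \<phi> "\<lambda>x. (-1) * \<eta> x"] test_function_mult[of \<eta> "\<lambda>_. -1"]
  by (simp add: smooth_const)

lemma test_function_affine:
  assumes "test_function \<phi>" "c \<noteq> 0" shows "test_function (\<lambda>x. \<phi> (c * x + d))"
proof -
  obtain R where R: "\<And>x. R < \<bar>x\<bar> \<Longrightarrow> \<phi> x = 0" using assms by (auto simp: test_function_iff)
  have "\<phi> (c * x + d) = 0" if "(R + \<bar>d\<bar>) / \<bar>c\<bar> < \<bar>x\<bar>" for x
  proof (rule R)
    have "R + \<bar>d\<bar> < \<bar>c * x\<bar>" using that assms(2) by (simp add: field_simps abs_mult)
    then show "R < \<bar>c * x + d\<bar>" by linarith
  qed
  then show ?thesis using assms by (auto simp: test_function_iff smooth_affine)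
qed

lemma test_function_cutoff: "test_function cutoff"
  unfolding test_function_iff using smooth_cutoff cutoff_0 by (intro conjI exI[of _ 2]) auto

lemma test_function_bump: "test_function (\<lambda>x. of_real (bump x))"
  unfolding test_function_iff using smooth_bump by (intro conjI exI[of _ 1]) (auto simp: abs_if bump_eq_0 split: if_splits)

lemma test_function_vd:
  assumes "test_function \<phi>" shows "test_function (vd \<phi>)"
    and "(\<phi> has_vector_derivative vd \<phi> x) (at x)"
proof -
  obtain R where R: "\<And>x. R < \<bar>x\<bar> \<Longrightarrow> \<phi> x = 0" and s: "smooth \<phi>"
    using assms by (auto simp: test_function_iff)
  have "vd \<phi> x = 0" if "R < \<bar>x\<bar>" for x
  proof -
    have "((\<lambda>_. 0) has_vector_derivative 0) (at x)" by simp
    then have "(\<phi> has_vector_derivative 0) (at x)"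
      by (rule has_vector_derivative_transform_within_open[where S = "{x. R < \<bar>x\<bar>}"])
        (use that R in \<open>auto intro!: open_Collect_less continuous_intros\<close>)
    then show ?thesis by (simp add: vd_def vector_derivative_at)
  qed
  then show "test_function (vd \<phi>)" using smooth_imp[OF s] by (auto simp: test_function_iff)
  show "(\<phi> has_vector_derivative vd \<phi> x) (at x)" using smooth_imp[OF s] by auto
qed

lemma test_function_bounded_support:
  assumes "test_function \<phi>"
  obtains R where "R > 0" "\<And>x. \<bar>x\<bar> \<ge> R \<Longrightarrow> \<phi> x = 0"
proof -
  obtain R where "\<And>x. R < \<bar>x\<bar> \<Longrightarrow> \<phi> x = 0" using assms by (auto simp: test_function_iff)
  then show ?thesis by (intro that[of "\<bar>R\<bar> + 1"]) auto
qed

lemma test_function_continuous: "test_function \<phi> \<Longrightarrow> continuous_on S \<phi>"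
  using smooth_continuous continuous_on_subset unfolding test_function_iff by blast

lemma test_function_measurable [measurable_dest]:
  "test_function \<phi> \<Longrightarrow> \<phi> \<in> borel_measurable borel"
  by (rule borel_measurable_continuous_onI[OF test_function_continuous])

lemma test_function_bounded:
  assumes "test_function \<phi>"
  obtains M where "M > 0" "\<And>x. norm (\<phi> x) \<le> M"
proof -
  obtain R where R: "R > 0" "\<And>x. \<bar>x\<bar> \<ge> R \<Longrightarrow> \<phi> x = 0"
    using test_function_bounded_support[OF assms] by blast
  have "compact (\<phi> ` {-R..R})"
    by (intro compact_continuous_image test_function_continuous assms compact_Icc)
  then obtain M where M: "M > 0" "\<forall>y\<in>\<phi> ` {-R..R}. norm y \<le> M"
    using compact_imp_bounded bounded_pos by blast
  have "norm (\<phi> x) \<le> M" for x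
  proof (cases "x \<in> {-R..R}")
    case True
    then show ?thesis using M(2) by blast
  next
    case False
    then show ?thesis using R(2)[of x] M(1) by auto
  qed
  then show ?thesis using M that by blast
qed

lemma test_function_integrable:
  assumes "test_function \<phi>" shows "integrable lborel \<phi>"
proof -
  obtain R where R: "R > 0" "\<And>x. \<bar>x\<bar> \<ge> R \<Longrightarrow> \<phi> x = 0"
    using test_function_bounded_support[OF assms] by blast
  have "integrable lborel (\<lambda>x. indicator {-R..R} x *\<^sub>R \<phi> x)"
    using borel_integrable_compact[OF compact_Icc test_function_continuous[OF assms]]
    by (simp add: set_integrable_def)
  moreover have "(\<lambda>x. indicator {-R..R} x *\<^sub>R \<phi> x) = \<phi>"
  proof
    show "indicator {-R..R} x *\<^sub>R \<phi> x = \<phi> x" for x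
      using R(2)[of x] by (cases "x \<in> {-R..R}") auto
  qed
  ultimately show ?thesis by simp
qed

lemma test_function_integral_vd:
  assumes "test_function \<phi>" shows "(LINT x|lborel. vd \<phi> x) = 0"
proof -
  obtain R where R: "R > 0" "\<And>x. \<bar>x\<bar> \<ge> R \<Longrightarrow> \<phi> x = 0"
    using test_function_bounded_support[OF assms] by blast
  obtain R' where R': "R' > 0" "\<And>x. \<bar>x\<bar> \<ge> R' \<Longrightarrow> vd \<phi> x = 0"
    using test_function_bounded_support[OF test_function_vd(1)[OF assms]] by blast
  define A where "A = max R R'"
  have "(LINT x|lborel. vd \<phi> x) = (LINT x|lborel. indicator {-A..A} x *\<^sub>R vd \<phi> x)"
  proof (rule Bochner_Integration.integral_cong)
    show "vd \<phi> x = indicator {-A..A} x *\<^sub>R vd \<phi> x" for x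
      using R'(2)[of x] by (cases "x \<in> {-A..A}") (auto simp: A_def)
  qed simp
  also have "\<dots> = \<phi> A - \<phi> (-A)"
  proof (rule integral_FTC_Icc)
    show "- A \<le> A" using R by (simp add: A_def)
    show "(\<phi> has_vector_derivative vd \<phi> x) (at x within {-A..A})" for x
      by (rule has_vector_derivative_at_within[OF test_function_vd(2)[OF assms]])
    show "continuous_on {-A..A} (vd \<phi>)"
      by (intro test_function_continuous test_function_vd assms)
  qed
  also have "\<dots> = 0" using R by (auto simp: A_def)
  finally show ?thesis .
qed

lemma test_function_vd_mult:
  assumes "test_function \<phi>" "smooth h"
  shows "vd (\<lambda>x. h x * \<phi> x) = (\<lambda>x. h x * vd \<phi> x + vd h x * \<phi> x)"
  by (rule vdI) (intro has_vector_derivative_mult smooth_imp(1)[OF assms(2)] test_function_vd(2)[OF assms(1)])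

lemma integration_by_parts_test:
  assumes "test_function \<phi>" "smooth h"
  shows "(LINT x|lborel. h x * vd \<phi> x) = - (LINT x|lborel. vd h x * \<phi> x)"
proof -
  have i: "integrable lborel (\<lambda>x. h x * vd \<phi> x)" "integrable lborel (\<lambda>x. vd h x * \<phi> x)"
    using assms by (auto intro!: test_function_integrable test_function_mult test_function_vd smooth_imp)
  have "0 = (LINT x|lborel. h x * vd \<phi> x + vd h x * \<phi> x)"
    using test_function_integral_vd[OF test_function_mult[OF assms]]
    by (simp add: test_function_vd_mult[OF assms])
  also have "\<dots> = (LINT x|lborel. h x * vd \<phi> x) + (LINT x|lborel. vd h x * \<phi> x)"
    using i by simp
  finally show ?thesis by (metis eq_neg_iff_add_eq_0)
qed

section \<open>Polynomial weights and correlations\<close>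

text \<open>Equivalent to the weight \<open>(1 + x^2) powr (\<beta> / 2)\<close> behind
  \<open>Linf_weighted\<close>, but submultiplicative with constant 1
  (\<open>weight_add\<close>).\<close>

definition weight :: "real \<Rightarrow> real \<Rightarrow> real" where
  "weight \<beta> x = (1 + \<bar>x\<bar>) powr \<beta>"

lemma weight_pos [simp]: "weight \<beta> x > 0" "weight \<beta> x \<ge> 0" "weight \<beta> x \<noteq> 0"
  by (auto simp: weight_def)

lemma weight_measurable [measurable]: "weight \<beta> \<in> borel_measurable borel"
  unfolding weight_def by measurable

lemma weight_ge_1: "\<beta> \<ge> 0 \<Longrightarrow> weight \<beta> x \<ge> 1"
  unfolding weight_def by (rule ge_one_powr_ge_zero) auto

lemma weight_minus [simp]: "weight \<beta> (- x) = weight \<beta> x"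
  by (simp add: weight_def)

lemma weight_0 [simp]: "weight \<beta> 0 = 1" "weight 0 x = 1"
  by (auto simp: weight_def)

lemma weight_mono: "\<beta> \<ge> 0 \<Longrightarrow> \<bar>x\<bar> \<le> \<bar>y\<bar> \<Longrightarrow> weight \<beta> x \<le> weight \<beta> y"
  unfolding weight_def by (intro powr_mono2) auto

lemma weight_add: "\<beta> \<ge> 0 \<Longrightarrow> weight \<beta> (x + y) \<le> weight \<beta> x * weight \<beta> y"
proof -
  assume b: "\<beta> \<ge> 0"
  have "0 \<le> \<bar>x\<bar> * \<bar>y\<bar>" by simp
  then have "1 + \<bar>x + y\<bar> \<le> (1 + \<bar>x\<bar>) * (1 + \<bar>y\<bar>)"
    unfolding ring_distribs by linarith
  then have "weight \<beta> (x + y) \<le> ((1 + \<bar>x\<bar>) * (1 + \<bar>y\<bar>)) powr \<beta>"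
    unfolding weight_def using b by (intro powr_mono2) auto
  also have "\<dots> = weight \<beta> x * weight \<beta> y" by (simp add: weight_def powr_mult)
  finally show ?thesis .
qed

text \<open>Rescaling costs only a power of \<open>c\<close>. This makes the rescaled weights of
  \<open>local_vanish\<close> equivalent to the original one and controls the kernels in
  \<open>mollified_high\<close>.\<close>

lemma weight_scale: "\<beta> \<ge> 0 \<Longrightarrow> c \<ge> 1 \<Longrightarrow> weight \<beta> (c * x) \<le> c powr \<beta> * weight \<beta> x"
proof -
  assume b: "\<beta> \<ge> 0" "c \<ge> 1"
  have "1 + \<bar>c * x\<bar> \<le> c * (1 + \<bar>x\<bar>)" using b by (simp add: abs_mult ring_distribs)
  then have "weight \<beta> (c * x) \<le> (c * (1 + \<bar>x\<bar>)) powr \<beta>"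
    unfolding weight_def using b by (intro powr_mono2) auto
  also have "\<dots> = c powr \<beta> * weight \<beta> x" using b by (simp add: weight_def powr_mult)
  finally show ?thesis .
qed

text \<open>The explicit factor 1 matches the pattern \<open>E * weight \<beta> x\<close> in
  \<open>integrable_levy_op\<close>, where monomials are inserted to compute moments.\<close>

lemma weight_power_bound:
  assumes "real n \<le> \<beta>" shows "norm (complex_of_real x ^ n) \<le> 1 * weight \<beta> x"
proof -
  have "norm (complex_of_real x ^ n) \<le> (1 + \<bar>x\<bar>) ^ n" by (simp add: norm_power power_mono)
  also have "\<dots> = (1 + \<bar>x\<bar>) powr real n" by (simp add: powr_realpow)
  also have "\<dots> \<le> weight \<beta> x" unfolding weight_def using assms by (intro powr_mono) auto
  finally show ?thesis by simp
qed

section \<open>Kernel classes and correlations\<close>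

lemma integrable_inverse_square: "integrable lborel (\<lambda>x::real. 1 / (1 + \<bar>x\<bar>) ^ 2)"
proof (rule Bochner_Integration.integrable_bound)
  show "integrable lborel (\<lambda>x::real. inverse (1 + x\<^sup>2))"
    using integrable_inverse_1_plus_square by (simp add: set_integrable_def)
  show "AE x::real in lborel. norm (1 / (1 + \<bar>x\<bar>) ^ 2) \<le> norm (inverse (1 + x\<^sup>2))"
  proof (rule AE_I2)
    fix x :: real
    have "1 + x\<^sup>2 \<le> (1 + \<bar>x\<bar>)\<^sup>2" by (simp add: power2_eq_square ring_distribs)
    moreover have "1 + x\<^sup>2 > 0" by (simp add: add_pos_nonneg)
    ultimately have "1 / (1 + \<bar>x\<bar>)\<^sup>2 \<le> 1 / (1 + x\<^sup>2)" by (intro divide_left_mono) auto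
    then show "norm (1 / (1 + \<bar>x\<bar>) ^ 2) \<le> norm (inverse (1 + x\<^sup>2))"
      using \<open>1 + x\<^sup>2 > 0\<close> by (simp add: inverse_eq_divide)
  qed
qed simp

text \<open>Only decay is recorded, not decay of derivatives: by
  \<open>fourier_has_derivative\<close> the derivative of a transformed test function is again such
  a transform.\<close>

definition rapid :: "(real \<Rightarrow> complex) \<Rightarrow> bool" where
  "rapid k \<longleftrightarrow> k \<in> borel_measurable borel \<and> (\<forall>N::nat. \<exists>C. \<forall>x. norm (k x) * (1 + \<bar>x\<bar>) ^ N \<le> C)"

definition weighted_L1 :: "real \<Rightarrow> (real \<Rightarrow> complex) \<Rightarrow> bool" where
  "weighted_L1 \<beta> k \<longleftrightarrow> k \<in> borel_measurable borel \<and> integrable lborel (\<lambda>x. weight \<beta> x * norm (k x))"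

text \<open>The bound holds at every point rather than almost everywhere, so that translates and
  iterated integrals can be estimated without exceptional sets.\<close>

definition poly_bounded :: "real \<Rightarrow> (real \<Rightarrow> complex) \<Rightarrow> bool" where
  "poly_bounded \<beta> f \<longleftrightarrow> f \<in> borel_measurable borel \<and> (\<exists>C. \<forall>x. norm (f x) \<le> C * weight \<beta> x)"

lemma rapid_measurable [measurable_dest]: "rapid k \<Longrightarrow> k \<in> borel_measurable borel"
  and weighted_L1_measurable [measurable_dest]: "weighted_L1 \<beta> k \<Longrightarrow> k \<in> borel_measurable borel"
  and poly_bounded_measurable [measurable_dest]: "poly_bounded \<beta> f \<Longrightarrow> f \<in> borel_measurable borel"
  by (auto simp: rapid_def weighted_L1_def poly_bounded_def)

text \<open>The two spare powers leave the integrable majorant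
  \<open>1 / (1 + \<bar>x\<bar>) ^ 2\<close>.\<close>

lemma integrable_weight_decay:
  assumes "\<beta> + 2 \<le> real N"
  shows "integrable lborel (\<lambda>x. weight \<beta> x / (1 + \<bar>x\<bar>) ^ N)"
proof (rule Bochner_Integration.integrable_bound[OF integrable_inverse_square])
  have "weight \<beta> x / (1 + \<bar>x\<bar>) ^ N \<le> 1 / (1 + \<bar>x\<bar>) ^ 2" for x
  proof -
    have N: "N \<ge> 2 \<or> \<beta> < 0" using assms by linarith
    have "weight \<beta> x * (1 + \<bar>x\<bar>) ^ 2 = (1 + \<bar>x\<bar>) powr (\<beta> + 2)"
      by (simp add: weight_def powr_add)
    also have "\<dots> \<le> (1 + \<bar>x\<bar>) powr N" using assms by (intro powr_mono) auto
    also have "\<dots> = (1 + \<bar>x\<bar>) ^ N" by (simp add: powr_realpow)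
    finally show ?thesis by (simp add: field_simps)
  qed
  then show "AE x in lborel. norm (weight \<beta> x / (1 + \<bar>x\<bar>) ^ N) \<le> norm (1 / (1 + \<bar>x\<bar>) ^ 2)"
    by auto
qed measurable

lemma rapid_weighted_L1:
  assumes "rapid k" shows "weighted_L1 \<beta> k"
proof -
  have [measurable]: "k \<in> borel_measurable borel" using assms by measurable
  define N where "N = nat \<lceil>\<beta> + 2\<rceil>"
  obtain C where C: "\<And>x. norm (k x) * (1 + \<bar>x\<bar>) ^ N \<le> C"
    using assms unfolding rapid_def by blast
  have "integrable lborel (\<lambda>x. weight \<beta> x * norm (k x))"
  proof (rule Bochner_Integration.integrable_bound)
    show "integrable lborel (\<lambda>x. C * (weight \<beta> x / (1 + \<bar>x\<bar>) ^ N))"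
      unfolding N_def by (intro integrable_mult_right integrable_weight_decay) linarith
    have "norm (weight \<beta> x * norm (k x)) \<le> norm (C * (weight \<beta> x / (1 + \<bar>x\<bar>) ^ N))" for x
    proof -
      have "norm (k x) \<le> C / (1 + \<bar>x\<bar>) ^ N" using C[of x] by (simp add: pos_le_divide_eq)
      then have "weight \<beta> x * norm (k x) \<le> weight \<beta> x * (C / (1 + \<bar>x\<bar>) ^ N)"
        by (intro mult_left_mono) auto
      also have "\<dots> = C * (weight \<beta> x / (1 + \<bar>x\<bar>) ^ N)" by (simp add: mult_ac)
      also have "\<dots> \<le> norm \<dots>" unfolding real_norm_def by (rule abs_ge_self)
      finally show ?thesis by simp
    qed
    then show "AE x in lborel. norm (weight \<beta> x * norm (k x)) \<le> norm (C * (weight \<beta> x / (1 + \<bar>x\<bar>) ^ N))"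
      by blast
  qed simp
  then show ?thesis by (simp add: weighted_L1_def)
qed

lemma poly_bounded_bound:
  assumes "poly_bounded \<beta> f" obtains C where "C > 0" "\<And>x. norm (f x) \<le> C * weight \<beta> x"
proof -
  obtain C where C: "\<And>x. norm (f x) \<le> C * weight \<beta> x" using assms by (auto simp: poly_bounded_def)
  have "norm (f x) \<le> (\<bar>C\<bar> + 1) * weight \<beta> x" for x
    by (rule order_trans[OF C]) (auto intro!: mult_right_mono)
  then show ?thesis by (intro that[of "\<bar>C\<bar> + 1"]) auto
qed

text \<open>Correlation rather than convolution: \<open>corr f k a\<close> pairs the translate of
  \<open>f\<close> by \<open>a\<close> with \<open>k\<close>, so the weak equation for all
  translates reads \<open>corr f (levy_op \<phi>) = 0\<close>, free of reflections.\<close>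

definition corr :: "(real \<Rightarrow> complex) \<Rightarrow> (real \<Rightarrow> complex) \<Rightarrow> real \<Rightarrow> complex" where
  "corr f k a = (LINT x|lborel. f (a + x) * k x)"

lemma corr_measurable [measurable]:
  assumes [measurable]: "f \<in> borel_measurable borel" "k \<in> borel_measurable borel"
  shows "corr f k \<in> borel_measurable borel"
  unfolding corr_def by measurable

lemma corr_pointwise_bound:
  fixes f k :: "real \<Rightarrow> complex"
  assumes "\<beta> \<ge> 0" "C \<ge> 0" "\<And>x. norm (f x) \<le> C * weight \<beta> x"
  shows "norm (f (a + x) * k x) \<le> C * weight \<beta> a * (weight \<beta> x * norm (k x))"
proof -
  have "norm (f (a + x)) \<le> C * weight \<beta> (a + x)" by (rule assms)
  also have "\<dots> \<le> C * (weight \<beta> a * weight \<beta> x)" using assms by (intro mult_left_mono weight_add) auto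
  finally have "norm (f (a + x)) * norm (k x) \<le> C * (weight \<beta> a * weight \<beta> x) * norm (k x)"
    by (rule mult_right_mono) simp
  then show ?thesis by (simp only: norm_mult mult_ac)
qed

lemma corr_integrable:
  assumes "\<beta> \<ge> 0" "poly_bounded \<beta> f" "weighted_L1 \<beta> k"
  shows "integrable lborel (\<lambda>x. f (a + x) * k x)"
proof -
  obtain C where C: "C > 0" "\<And>x. norm (f x) \<le> C * weight \<beta> x" using poly_bounded_bound assms by blast
  have [measurable]: "f \<in> borel_measurable borel" "k \<in> borel_measurable borel" using assms by measurable
  show ?thesis
  proof (rule Bochner_Integration.integrable_bound)
    show "integrable lborel (\<lambda>x. C * weight \<beta> a * (weight \<beta> x * norm (k x)))"
      using assms by (auto simp: weighted_L1_def)
    show "AE x in lborel. norm (f (a + x) * k x) \<le> norm (C * weight \<beta> a * (weight \<beta> x * norm (k x)))"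
      using corr_pointwise_bound[OF assms(1), of C f a] C by (intro AE_I2) (simp add: abs_mult)
  qed measurable
qed

lemma corr_bound:
  assumes "\<beta> \<ge> 0" "C \<ge> 0" "\<And>x. norm (f x) \<le> C * weight \<beta> x"
    and "f \<in> borel_measurable borel" "weighted_L1 \<beta> k"
  shows "norm (corr f k a) \<le> C * weight \<beta> a * (LINT x|lborel. weight \<beta> x * norm (k x))"
proof -
  have "norm (corr f k a) \<le> (LINT x|lborel. C * weight \<beta> a * (weight \<beta> x * norm (k x)))"
    unfolding corr_def
  proof (rule Bochner_Integration.integral_norm_bound_integral)
    show "integrable lborel (\<lambda>x. f (a + x) * k x)"
      using assms by (intro corr_integrable[of \<beta>]) (auto simp: poly_bounded_def)
    show "integrable lborel (\<lambda>x. C * weight \<beta> a * (weight \<beta> x * norm (k x)))"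
      using assms by (auto simp: weighted_L1_def)
  qed (rule corr_pointwise_bound[OF assms(1-3)])
  then show ?thesis by simp
qed

lemma poly_bounded_corr:
  assumes "\<beta> \<ge> 0" "poly_bounded \<beta> f" "weighted_L1 \<beta> k" shows "poly_bounded \<beta> (corr f k)"
proof -
  obtain C where C: "C > 0" "\<And>x. norm (f x) \<le> C * weight \<beta> x" using poly_bounded_bound assms by blast
  have [measurable]: "f \<in> borel_measurable borel" "k \<in> borel_measurable borel" using assms by measurable
  have "norm (corr f k a) \<le> (C * (LINT x|lborel. weight \<beta> x * norm (k x))) * weight \<beta> a" for a
    using corr_bound[OF assms(1) _ C(2), of k a] C assms by (simp add: mult_ac)
  then show ?thesis unfolding poly_bounded_def by (intro conjI exI allI) measurable
qed

text \<open>The integral of a product majorant factorises. This supplies the integrability for most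
  exchanges of integrals below, both for pairs of Lebesgue measures and for \<open>nu\<close> with
  Lebesgue measure.\<close>

lemma integrable_pair_dominated:
  fixes h :: "'a \<times> 'b \<Rightarrow> complex" and f :: "'a \<Rightarrow> real" and g :: "'b \<Rightarrow> real"
  assumes "pair_sigma_finite M1 M2" and h: "h \<in> borel_measurable (M1 \<Otimes>\<^sub>M M2)"
    and f: "integrable M1 f" and g: "integrable M2 g"
    and bound: "\<And>x y. norm (h (x, y)) \<le> f x * g y"
  shows "integrable (M1 \<Otimes>\<^sub>M M2) h"
proof -
  interpret pair_sigma_finite M1 M2 by fact
  have [measurable]: "f \<in> borel_measurable M1" "g \<in> borel_measurable M2" using f g by auto
  have "integrable (M1 \<Otimes>\<^sub>M M2) (\<lambda>z. f (fst z) * g (snd z))"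
  proof (rule Fubini_integrable)
    show "integrable M1 (\<lambda>x. LINT y|M2. norm (f (fst (x, y)) * g (snd (x, y))))"
      using f by (simp add: abs_mult)
    show "AE x in M1. integrable M2 (\<lambda>y. f (fst (x, y)) * g (snd (x, y)))"
      using g by simp
  qed measurable
  then show ?thesis
  proof (rule Bochner_Integration.integrable_bound)
    show "AE z in M1 \<Otimes>\<^sub>M M2. norm (h z) \<le> norm (f (fst z) * g (snd z))"
      using bound by (intro AE_I2) (metis abs_ge_self order_trans prod.collapse real_norm_def)
  qed fact
qed

text \<open>Both sides are iterated integrals of \<open>f (a + x + y) * k y * l x\<close>, and
  submultiplicativity of the weight splits the majorant. The lemma later moves
  \<open>levy_op \<phi>\<close> past a frequency cutoff.\<close>

lemma corr_commute:
  assumes b: "\<beta> \<ge> 0" and f: "poly_bounded \<beta> f" and k: "weighted_L1 \<beta> k" and l: "weighted_L1 \<beta> l"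
  shows "corr (corr f k) l = corr (corr f l) k"
proof
  fix a
  obtain C where C: "C > 0" "\<And>x. norm (f x) \<le> C * weight \<beta> x" using poly_bounded_bound f by blast
  have [measurable]: "f \<in> borel_measurable borel" "k \<in> borel_measurable borel" "l \<in> borel_measurable borel"
    using f k l by measurable
  have "corr (corr f k) l a = (LINT x|lborel. LINT y|lborel. f (a + x + y) * k y * l x)"
    by (simp add: corr_def)
  also have "\<dots> = (LINT y|lborel. LINT x|lborel. f (a + x + y) * k y * l x)"
  proof (rule lborel_pair.Fubini_integral[symmetric], rule integrable_pair_dominated)
    show "pair_sigma_finite lborel lborel" ..
    show "integrable lborel (\<lambda>x. C * weight \<beta> a * (weight \<beta> x * norm (l x)))"
      "integrable lborel (\<lambda>x. weight \<beta> x * norm (k x))"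
      using k l by (auto simp: weighted_L1_def)
    show "norm (case (x, y) of (x, y) \<Rightarrow> f (a + x + y) * k y * l x)
      \<le> C * weight \<beta> a * (weight \<beta> x * norm (l x)) * (weight \<beta> y * norm (k y))" for x y
    proof -
      have "norm (f (a + x + y) * k y) \<le> C * weight \<beta> (a + x) * (weight \<beta> y * norm (k y))"
        using C by (intro corr_pointwise_bound b) auto
      also have "\<dots> \<le> C * (weight \<beta> a * weight \<beta> x) * (weight \<beta> y * norm (k y))"
        using C by (intro mult_right_mono mult_left_mono weight_add b) auto
      finally have "norm (f (a + x + y) * k y) * norm (l x) \<le> C * (weight \<beta> a * weight \<beta> x) * (weight \<beta> y * norm (k y)) * norm (l x)"
        by (rule mult_right_mono) simp
      then show ?thesis by (simp add: norm_mult mult_ac)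
    qed
  qed measurable
  also have "\<dots> = corr (corr f l) k a"
    by (simp add: corr_def mult_ac add_ac flip: integral_mult_left_zero)
  finally show "corr (corr f k) l a = corr (corr f l) k a" .
qed

text \<open>The second derivative is bounded only within distance \<open>\<bar>h\<bar>\<close> of
  \<open>x\<close>, so that \<open>M\<close> may decay in \<open>x\<close>;
  \<open>corr_fourier_has_derivative\<close> depends on this. The factor 1/2 of the sharp remainder
  is dropped.\<close>

lemma taylor2_bound:
  fixes f f' f'' :: "real \<Rightarrow> complex"
  assumes f: "\<And>s. (f has_vector_derivative f' s) (at s)"
    and f': "\<And>s. (f' has_vector_derivative f'' s) (at s)"
    and M: "\<And>s. \<bar>s - x\<bar> \<le> \<bar>h\<bar> \<Longrightarrow> norm (f'' s) \<le> M"
  shows "norm (f (x + h) - f x - h *\<^sub>R f' x) \<le> M * h\<^sup>2"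
proof -
  let ?S = "closed_segment x (x + h)"
  have S: "\<bar>s - x\<bar> \<le> \<bar>h\<bar>" if "s \<in> ?S" for s
    using that by (auto simp: closed_segment_eq_real_ivl split: if_splits)
  have M0: "M \<ge> 0" using norm_ge_zero[of "f'' x"] M[of x] by linarith
  have *: "norm (f' s - f' x) \<le> M * \<bar>h\<bar>" if s: "s \<in> ?S" for s
  proof -
    have "norm (f' s - f' x) \<le> M * norm (s - x)"
    proof (rule differentiable_bound[of ?S f' "\<lambda>s h. h *\<^sub>R f'' s"])
      show "(f' has_derivative (\<lambda>h. h *\<^sub>R f'' s)) (at s within ?S)" for s
        by (rule has_derivative_at_withinI) (use f'[of s] in \<open>simp add: has_vector_derivative_def\<close>)
      show "onorm (\<lambda>h. h *\<^sub>R f'' s) \<le> M" if "s \<in> ?S" for s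
        by (rule onorm_le) (use M[OF S[OF that]] in \<open>simp add: mult.commute[of M] mult_left_mono\<close>)
    qed (use s in auto)
    also have "\<dots> \<le> M * \<bar>h\<bar>" using M0 S[OF s] by (intro mult_left_mono) auto
    finally show ?thesis .
  qed
  have "norm (f (x + h) - f x - (x + h - x) *\<^sub>R f' x) \<le> norm (x + h - x) * (M * \<bar>h\<bar>)"
  proof (rule vector_differentiable_bound_linearization[where S = ?S and f = f and f' = f'
        and a = x and b = "x + h" and ?x0.0 = x and B = "M * \<bar>h\<bar>"])
    show "(f has_vector_derivative f' s) (at s within ?S)" for s
      using f by (rule has_vector_derivative_at_within)
  qed (use * in auto)
  then show ?thesis by (simp add: power2_eq_square mult_ac)
qed

text \<open>A uniform quadratic remainder stands in for theorems on differentiation under the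
  integral sign.\<close>

lemma has_vector_derivative_quadratic:
  fixes f :: "real \<Rightarrow> complex"
  assumes "\<And>h. \<bar>h\<bar> \<le> 1 \<Longrightarrow> norm (f (x + h) - f x - h *\<^sub>R d) \<le> M * h\<^sup>2"
  shows "(f has_vector_derivative d) (at x)"
  unfolding has_vector_derivative_def has_derivative_at
proof (intro conjI bounded_linear_scaleR_left)
  show "(\<lambda>h. norm (f (x + h) - f x - h *\<^sub>R d) / norm h) \<midarrow>0\<rightarrow> 0"
  proof (rule Lim_null_comparison)
    show "\<forall>\<^sub>F h in at 0. norm (norm (f (x + h) - f x - h *\<^sub>R d) / norm h) \<le> M * \<bar>h\<bar>"
      unfolding eventually_at
    proof (intro exI[of _ 1] conjI ballI impI)
      fix h :: real assume "h \<noteq> 0 \<and> dist h 0 < 1"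
      then have "norm (f (x + h) - f x - h *\<^sub>R d) \<le> M * \<bar>h\<bar> * \<bar>h\<bar>" "h \<noteq> 0"
        using assms[of h] by (auto simp: power2_eq_square)
      then show "norm (norm (f (x + h) - f x - h *\<^sub>R d) / norm h) \<le> M * \<bar>h\<bar>"
        by (simp add: pos_divide_le_eq)
    qed simp
    show "((\<lambda>h. M * \<bar>h\<bar>) \<longlongrightarrow> 0) (at 0)" by (auto intro!: tendsto_eq_intros)
  qed
qed

lemma test_function_taylor2:
  assumes "test_function \<phi>"
  obtains M where "M > 0" "\<And>x h. norm (\<phi> (x + h) - \<phi> x - h *\<^sub>R vd \<phi> x) \<le> M * h\<^sup>2"
proof -
  have v: "test_function (vd \<phi>)" by (rule test_function_vd[OF assms])
  obtain M where "M > 0" "\<And>x. norm (vd (vd \<phi>) x) \<le> M"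
    using test_function_bounded[OF test_function_vd(1)[OF v]] by blast
  then show ?thesis
    by (intro that[of M] taylor2_bound[of \<phi> "vd \<phi>" "vd (vd \<phi>)"])
       (auto intro: test_function_vd v assms)
qed

section \<open>Fourier transforms of test functions\<close>

lemma integrable_cis_mult:
  assumes "integrable M f" "g \<in> borel_measurable M"
  shows "integrable M (\<lambda>x. cis (g x) * f x)"
  by (rule Bochner_Integration.integrable_bound[OF assms(1)])
     (use assms in \<open>auto simp: norm_mult cis_conv_exp\<close>)

lemma fourier_measurable [measurable]:
  assumes [measurable]: "\<phi> \<in> borel_measurable borel" shows "fourier \<phi> \<in> borel_measurable borel"
  unfolding fourier_def cis_conv_exp by measurable

lemma fourier_norm_le:
  assumes "test_function \<phi>" shows "norm (fourier \<phi> x) \<le> (LINT y|lborel. norm (\<phi> y))"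
  unfolding fourier_def
  by (rule order_trans[OF integral_norm_bound]) (simp add: norm_mult)

lemma fourier_vd:
  assumes "test_function \<phi>"
  shows "fourier (vd \<phi>) x = \<i> * x * fourier \<phi> x"
proof -
  have "vd (\<lambda>y. cis (- (y * x))) = (\<lambda>y. - \<i> * x * cis (- (y * x)))"
    using has_vector_derivative_cis[of "- x"] by (intro vdI) (simp add: mult_ac)
  moreover have "smooth (\<lambda>y. cis (- (y * x)))" using smooth_cis[of "- x"] by (simp add: mult_ac)
  ultimately have "fourier (vd \<phi>) x = - (LINT y|lborel. - \<i> * x * cis (- (y * x)) * \<phi> y)"
    using integration_by_parts_test[OF assms, of "\<lambda>y. cis (- (y * x))"]
    by (simp add: fourier_def)
  also have "\<dots> = \<i> * x * fourier \<phi> x" by (simp add: fourier_def mult.assoc)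
  finally show ?thesis .
qed

text \<open>Each further factor \<open>1 + \<bar>x\<bar>\<close> is paid for by one derivative of
  \<phi> through \<open>fourier_vd\<close>, hence the induction over all test functions
  simultaneously.\<close>

lemma rapid_fourier:
  assumes "test_function \<phi>" shows "rapid (fourier \<phi>)"
proof -
  have "\<exists>C. \<forall>x. norm (fourier \<phi> x) * (1 + \<bar>x\<bar>) ^ N \<le> C" for N
    using assms
  proof (induction N arbitrary: \<phi>)
    case 0
    then show ?case using fourier_norm_le by auto
  next
    case (Suc N)
    obtain C where C: "\<And>x. norm (fourier \<phi> x) * (1 + \<bar>x\<bar>) ^ N \<le> C" using Suc by blast
    obtain C' where C': "\<And>x. norm (fourier (vd \<phi>) x) * (1 + \<bar>x\<bar>) ^ N \<le> C'"
      using Suc.IH[OF test_function_vd(1)[OF Suc.prems]] by blast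
    have "norm (fourier \<phi> x) * (1 + \<bar>x\<bar>) ^ Suc N \<le> C + C'" for x
      using add_mono[OF C[of x] C'[of x]]
      by (simp add: fourier_vd[OF Suc.prems] norm_mult algebra_simps)
    then show ?case by blast
  qed
  moreover have "fourier \<phi> \<in> borel_measurable borel" using assms by measurable
  ultimately show ?thesis unfolding rapid_def by blast
qed

lemma test_function_mult_id: "test_function \<phi> \<Longrightarrow> test_function (\<lambda>x. c * of_real x * \<phi> x)"
  by (intro test_function_mult smooth_mult smooth_const smooth_of_real)

lemma cis_taylor2: "norm (cis t - 1 - \<i> * t) \<le> t\<^sup>2"
proof -
  have "norm (iexp t - (\<Sum>k \<le> 1. (\<i> * t)^k / fact k)) \<le> \<bar>t\<bar>^2 / 2"
    using iexp_approx1[of t 1] by (simp add: numeral_2_eq_2)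
  also have "\<dots> \<le> t\<^sup>2" by simp
  finally show ?thesis by (simp add: cis_conv_exp algebra_simps)
qed

text \<open>By \<open>cis_taylor2\<close> the remainder of the integrand is at most
  \<open>h^2\<close> times \<open>y^2 * norm (\<phi> y)\<close>, which is integrable because \<phi>
  has compact support.\<close>

lemma fourier_has_derivative:
  assumes "test_function \<phi>"
  shows "(fourier \<phi> has_vector_derivative fourier (\<lambda>y. - \<i> * of_real y * \<phi> y) x) (at x)"
proof (rule has_vector_derivative_quadratic)
  fix h :: real
  have t: "test_function (\<lambda>y. - \<i> * of_real y * \<phi> y)" by (rule test_function_mult_id) fact
  have t2: "test_function (\<lambda>y. of_real y * (of_real y * \<phi> y))"
    using test_function_mult_id[OF test_function_mult_id[OF assms, of 1], of 1] by simp
  have i: "integrable lborel (\<lambda>y. cis (- (y * a)) * \<eta> y)" if "test_function \<eta>" for \<eta> a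
    by (rule integrable_cis_mult) (use that in \<open>auto intro: test_function_integrable\<close>)
  have "fourier \<phi> (x + h) - fourier \<phi> x - h *\<^sub>R fourier (\<lambda>y. - \<i> * of_real y * \<phi> y) x
     = (LINT y|lborel. cis (- (y * (x + h))) * \<phi> y - cis (- (y * x)) * \<phi> y
         - h *\<^sub>R (cis (- (y * x)) * (- \<i> * of_real y * \<phi> y)))"
    unfolding fourier_def
    by (subst Bochner_Integration.integral_diff | intro Bochner_Integration.integrable_diff i assms t integrable_scaleR_right integral_scaleR_right | simp)+
  also have "norm \<dots> \<le> (LINT y|lborel. h\<^sup>2 * norm (of_real y * (of_real y * \<phi> y)))"
  proof (rule Bochner_Integration.integral_norm_bound_integral)
    show "integrable lborel (\<lambda>y. cis (- (y * (x + h))) * \<phi> y - cis (- (y * x)) * \<phi> y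
         - h *\<^sub>R (cis (- (y * x)) * (- \<i> * of_real y * \<phi> y)))"
      by (intro Bochner_Integration.integrable_diff i assms t integrable_scaleR_right)
    show "integrable lborel (\<lambda>y. h\<^sup>2 * norm (of_real y * (of_real y * \<phi> y)))"
      using test_function_integrable[OF t2] by simp
    fix y
    have "cis (- (y * (x + h))) * \<phi> y - cis (- (y * x)) * \<phi> y
         - h *\<^sub>R (cis (- (y * x)) * (- \<i> * of_real y * \<phi> y))
        = cis (- (y * x)) * (cis (- (y * h)) - 1 - \<i> * of_real (- (y * h))) * \<phi> y"
    proof -
      have "cis (- (y * (x + h))) = cis (- (y * x)) * cis (- (y * h))"
        by (simp add: cis_mult algebra_simps)
      then show ?thesis by (simp add: scaleR_conv_of_real algebra_simps)
    qed
    also have "norm \<dots> = norm (cis (- (y * h)) - 1 - \<i> * of_real (- (y * h))) * norm (\<phi> y)"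
      by (simp add: norm_mult)
    also have "\<dots> \<le> (- (y * h))\<^sup>2 * norm (\<phi> y)"
      by (intro mult_right_mono cis_taylor2) simp
    finally show "norm (cis (- (y * (x + h))) * \<phi> y - cis (- (y * x)) * \<phi> y
         - h *\<^sub>R (cis (- (y * x)) * (- \<i> * of_real y * \<phi> y)))
       \<le> h\<^sup>2 * norm (of_real y * (of_real y * \<phi> y))"
      by (simp add: norm_mult power2_eq_square mult_ac)
  qed
  finally show "norm (fourier \<phi> (x + h) - fourier \<phi> x - h *\<^sub>R fourier (\<lambda>y. - \<i> * of_real y * \<phi> y) x)
      \<le> (LINT y|lborel. norm (of_real y * (of_real y * \<phi> y))) * h\<^sup>2"
    by (simp add: mult_ac)
qed

section \<open>Fourier inversion by Gaussian windows\<close>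

lemma gauss_fourier:
  "(LINT z|lborel. cis (t * z) * of_real (std_normal_density z)) = of_real (exp (- t\<^sup>2 / 2))"
proof -
  have "char std_normal_distribution t = (LINT z|lborel. std_normal_density z *\<^sub>R iexp (t * z))"
    unfolding char_def by (subst integral_density) (auto simp: normal_density_nonneg)
  then show "(LINT z|lborel. cis (t * z) * of_real (std_normal_density z)) = of_real (exp (- t\<^sup>2 / 2))"
    by (simp add: char_std_normal_distribution cis_conv_exp scaleR_conv_of_real mult.commute)
qed

lemma gauss_window:
  assumes s: "s > 0"
  shows "(LINT \<xi>|lborel. cis (t * \<xi>) * of_real (std_normal_density (s * \<xi>)))
     = of_real (exp (- (t / s)\<^sup>2 / 2) / s)"
proof -
  have "(LINT z|lborel. cis (t / s * z) * of_real (std_normal_density z))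
     = \<bar>s\<bar> *\<^sub>R (LINT \<xi>|lborel. cis (t / s * (0 + s * \<xi>)) * of_real (std_normal_density (0 + s * \<xi>)))"
    by (rule lborel_integral_real_affine) (use s in simp)
  also have "\<dots> = of_real s * (LINT \<xi>|lborel. cis (t * \<xi>) * of_real (std_normal_density (s * \<xi>)))"
    using s by (simp add: scaleR_conv_of_real)
  finally have "of_real s * (LINT \<xi>|lborel. cis (t * \<xi>) * of_real (std_normal_density (s * \<xi>)))
     = complex_of_real (exp (- (t / s)\<^sup>2 / 2))"
    unfolding gauss_fourier by simp
  then show ?thesis
    using s by (simp add: eq_divide_eq mult.commute)
qed

text \<open>Gaussian damping makes the double integral absolutely convergent, and Fubini turns it
  into an average of \<open>h\<close> over a Gaussian of width \<open>s\<close>. The factor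
  \<open>sqrt (2 * pi)\<close> appears because \<open>gauss_window\<close> returns a Gaussian
  without the normalisation of \<open>std_normal_density\<close>.\<close>

lemma fourier_inversion_gauss:
  assumes h: "integrable lborel h" and hb: "h \<in> borel_measurable borel" and s: "s > 0"
  shows "(LINT \<xi>|lborel. cis (x * \<xi>) * fourier h \<xi> * of_real (std_normal_density (s * \<xi>)))
     = of_real (sqrt (2 * pi)) * (LINT z|lborel. h (x + s * z) * of_real (std_normal_density z))"
proof -
  note [measurable] = hb
  have n: "integrable lborel (\<lambda>\<xi>. std_normal_density (s * \<xi>))"
    using lborel_integrable_real_affine[OF integrable_normal_density[of 1 0], of s 0] s by simp
  have "(LINT \<xi>|lborel. cis (x * \<xi>) * fourier h \<xi> * of_real (std_normal_density (s * \<xi>)))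
     = (LINT \<xi>|lborel. LINT y|lborel. cis ((x - y) * \<xi>) * of_real (std_normal_density (s * \<xi>)) * h y)"
  proof (rule Bochner_Integration.integral_cong[OF refl])
    fix \<xi>
    have "(LINT y|lborel. cis ((x - y) * \<xi>) * of_real (std_normal_density (s * \<xi>)) * h y)
      = (LINT y|lborel. (cis (x * \<xi>) * of_real (std_normal_density (s * \<xi>))) * (cis (- (y * \<xi>)) * h y))"
    proof (intro Bochner_Integration.integral_cong refl)
      fix y
      have "cis ((x - y) * \<xi>) = cis (x * \<xi>) * cis (- (y * \<xi>))"
        by (simp add: cis_mult algebra_simps)
      then show "cis ((x - y) * \<xi>) * of_real (std_normal_density (s * \<xi>)) * h y
        = (cis (x * \<xi>) * of_real (std_normal_density (s * \<xi>))) * (cis (- (y * \<xi>)) * h y)"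
        by simp
    qed
    also have "\<dots> = (cis (x * \<xi>) * of_real (std_normal_density (s * \<xi>))) * fourier h \<xi>"
      unfolding fourier_def by (rule integral_mult_right_zero)
    finally show "cis (x * \<xi>) * fourier h \<xi> * of_real (std_normal_density (s * \<xi>))
      = (LINT y|lborel. cis ((x - y) * \<xi>) * of_real (std_normal_density (s * \<xi>)) * h y)"
      by (simp add: mult_ac)
  qed
  also have "\<dots> = (LINT y|lborel. LINT \<xi>|lborel. cis ((x - y) * \<xi>) * of_real (std_normal_density (s * \<xi>)) * h y)"
  proof (rule lborel_pair.Fubini_integral[symmetric], rule integrable_pair_dominated)
    show "pair_sigma_finite lborel lborel" ..
    show "integrable lborel (\<lambda>\<xi>. std_normal_density (s * \<xi>))" "integrable lborel (\<lambda>y. norm (h y))"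
      using h n by auto
  qed (unfold cis_conv_exp, measurable, auto simp: norm_mult)
  also have "\<dots> = (LINT y|lborel. of_real (exp (- ((x - y) / s)\<^sup>2 / 2) / s) * h y)"
    by (simp add: gauss_window[OF s])
  also have "\<dots> = \<bar>s\<bar> *\<^sub>R (LINT z|lborel. of_real (exp (- ((x - (x + s * z)) / s)\<^sup>2 / 2) / s) * h (x + s * z))"
    by (rule lborel_integral_real_affine) (use s in simp)
  also have "\<dots> = (LINT z|lborel. of_real (sqrt (2 * pi)) * (h (x + s * z) * of_real (std_normal_density z)))"
    unfolding integral_scaleR_right[symmetric]
    by (intro Bochner_Integration.integral_cong refl)
       (use s in \<open>simp add: std_normal_density_def scaleR_conv_of_real\<close>)
  finally show ?thesis by simp
qed

text \<open>Let \<open>s\<close> tend to 0 in \<open>fourier_inversion_gauss\<close>: integrability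
  of \<open>fourier h\<close> dominates one side, boundedness of \<open>h\<close> the other, and
  continuity of \<open>h\<close> identifies the limit.\<close>

lemma fourier_inversion:
  assumes h: "integrable lborel h" and hc: "continuous_on UNIV h" and hM: "\<And>x. norm (h x) \<le> M"
    and fh: "integrable lborel (fourier h)"
  shows "inv_fourier (fourier h) x = h x"
proof -
  have [measurable]: "h \<in> borel_measurable borel" by (rule borel_measurable_continuous_onI[OF hc])
  define s where "s n = 1 / (1 + real n)" for n
  have s: "s n > 0" for n by (simp add: s_def add_pos_nonneg)
  have s0: "s \<longlonglongrightarrow> 0" unfolding s_def by real_asymp
  let ?n = std_normal_density
  have nc: "isCont ?n y" for y unfolding std_normal_density_def by (intro continuous_intros) auto
  have L: "(\<lambda>n. LINT \<xi>|lborel. cis (x * \<xi>) * fourier h \<xi> * of_real (?n (s n * \<xi>)))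
     \<longlonglongrightarrow> (LINT \<xi>|lborel. cis (x * \<xi>) * fourier h \<xi> * of_real (?n 0))"
  proof (rule integral_dominated_convergence)
    show "integrable lborel (\<lambda>\<xi>. norm (fourier h \<xi>) * ?n 0)" using fh by simp
    show "AE \<xi> in lborel. (\<lambda>n. cis (x * \<xi>) * fourier h \<xi> * of_real (?n (s n * \<xi>)))
       \<longlonglongrightarrow> cis (x * \<xi>) * fourier h \<xi> * of_real (?n 0)"
    proof (intro AE_I2 tendsto_intros)
      fix \<xi>
      have "(\<lambda>n. s n * \<xi>) \<longlonglongrightarrow> 0" using tendsto_mult_left_zero[OF s0] by simp
      then show "(\<lambda>n. ?n (s n * \<xi>)) \<longlonglongrightarrow> ?n 0" by (rule isCont_tendsto_compose[OF nc])
    qed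
    show "AE \<xi> in lborel. norm (cis (x * \<xi>) * fourier h \<xi> * of_real (?n (s n * \<xi>))) \<le> norm (fourier h \<xi>) * ?n 0" for n
      unfolding norm_mult norm_cis norm_of_real
      by (intro AE_I2) (simp add: std_normal_density_def mult_left_le divide_right_mono)
  qed (unfold cis_conv_exp, measurable)
  have R: "(\<lambda>n. of_real (sqrt (2 * pi)) * (LINT z|lborel. h (x + s n * z) * of_real (?n z)))
     \<longlonglongrightarrow> of_real (sqrt (2 * pi)) * (LINT z|lborel. h x * of_real (?n z))"
  proof (intro tendsto_mult tendsto_const integral_dominated_convergence)
    show "integrable lborel (\<lambda>z. M * ?n z)" by simp
    show "AE z in lborel. (\<lambda>n. h (x + s n * z) * of_real (?n z)) \<longlonglongrightarrow> h x * of_real (?n z)"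
    proof (intro AE_I2 tendsto_intros)
      fix z
      have "(\<lambda>n. x + s n * z) \<longlonglongrightarrow> x" using tendsto_add[OF tendsto_const tendsto_mult_left_zero[OF s0, of z], of x] by simp
      then show "(\<lambda>n. h (x + s n * z)) \<longlonglongrightarrow> h x"
        using hc by (intro isCont_tendsto_compose[of x h]) (auto simp: continuous_on_eq_continuous_at)
    qed
    show "AE z in lborel. norm (h (x + s n * z) * of_real (?n z)) \<le> M * ?n z" for n
      by (intro AE_I2) (auto simp: norm_mult intro!: mult_right_mono hM)
  qed measurable
  have "(LINT \<xi>|lborel. cis (x * \<xi>) * fourier h \<xi> * of_real (?n 0))
     = of_real (sqrt (2 * pi)) * (LINT z|lborel. h x * of_real (?n z))"
    using L R fourier_inversion_gauss[OF h _ s] by (simp add: LIMSEQ_unique)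
  then have "of_real (?n 0) * (LINT \<xi>|lborel. cis (x * \<xi>) * fourier h \<xi>) = of_real (sqrt (2 * pi)) * h x"
    using gauss_fourier[of 0] by (simp add: mult.commute)
  \<comment> \<open>Dividing \<open>sqrt (2 * pi)\<close> by \<open>std_normal_density 0\<close>,
    which is \<open>1 / sqrt (2 * pi)\<close>, produces the constant \<open>2 * pi\<close>.\<close>
  then have "(LINT \<xi>|lborel. cis (x * \<xi>) * fourier h \<xi>) = of_real (2 * pi) * h x"
    by (simp add: std_normal_density_def field_simps flip: of_real_mult)
  then show ?thesis by (simp add: inv_fourier_def)
qed

lemma fourier_inversion_test:
  assumes "test_function \<phi>"
  shows "inv_fourier (fourier \<phi>) x = \<phi> x"
proof -
  obtain M where M: "\<And>x. norm (\<phi> x) \<le> M" using test_function_bounded[OF assms] by blast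
  have [measurable]: "\<phi> \<in> borel_measurable borel" using assms by measurable
  have "integrable lborel (fourier \<phi>)"
    using rapid_weighted_L1[OF rapid_fourier[OF assms], of 0] by (simp add: weighted_L1_def integrable_norm_iff)
  then show ?thesis
    by (rule fourier_inversion[OF test_function_integrable[OF assms] test_function_continuous[OF assms] M])
qed

section \<open>The Levy operator on test functions\<close>

lemma test_function_shift: "test_function \<phi> \<Longrightarrow> test_function (\<lambda>x. \<phi> (x - y))"
  using test_function_affine[of \<phi> 1 "- y"] by simp

lemma vd_shift: "test_function \<phi> \<Longrightarrow> vd (\<lambda>x. \<phi> (x - y)) = (\<lambda>x. vd \<phi> (x - y))"
proof (rule vdI)
  fix x assume "test_function \<phi>"
  have "((\<lambda>x. x - y) has_vector_derivative 1) (at x)" by (auto intro!: derivative_eq_intros)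
  from vector_diff_chain_at[OF this test_function_vd(2)[OF \<open>test_function \<phi>\<close>]]
  show "((\<lambda>x. \<phi> (x - y)) has_vector_derivative vd \<phi> (x - y)) (at x)" by (simp add: o_def)
qed

lemma lborel_integral_shift:
  fixes f :: "real \<Rightarrow> 'a :: {banach, second_countable_topology}"
  shows "(LINT x|lborel. f (x + y)) = (LINT x|lborel. f x)"
  using lborel_integral_real_affine[of 1 f y] by (simp add: add.commute)

lemma fourier_shift: "fourier (\<lambda>x. \<phi> (x - y)) \<xi> = cis (- (y * \<xi>)) * fourier \<phi> \<xi>"
proof -
  have "fourier (\<lambda>x. \<phi> (x - y)) \<xi> = (LINT x|lborel. cis (- ((x + y) * \<xi>)) * \<phi> (x + y - y))"
    unfolding fourier_def by (rule lborel_integral_shift[symmetric])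
  also have "\<dots> = (LINT x|lborel. cis (- (y * \<xi>)) * (cis (- (x * \<xi>)) * \<phi> x))"
  proof (rule Bochner_Integration.integral_cong[OF refl])
    fix x
    have "cis (- ((x + y) * \<xi>)) = cis (- (y * \<xi>)) * cis (- (x * \<xi>))"
      by (simp add: cis_mult algebra_simps)
    then show "cis (- ((x + y) * \<xi>)) * \<phi> (x + y - y) = cis (- (y * \<xi>)) * (cis (- (x * \<xi>)) * \<phi> x)"
      by simp
  qed
  finally show ?thesis by (simp add: fourier_def)
qed

lemma fourier_integrand_integrable:
  "integrable lborel \<phi> \<Longrightarrow> integrable lborel (\<lambda>x. cis (- (x * \<xi>)) * \<phi> x)"
  by (rule integrable_cis_mult) auto

lemma fourier_add:
  "integrable lborel \<phi> \<Longrightarrow> integrable lborel \<eta> \<Longrightarrow>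
     fourier (\<lambda>x. \<phi> x + \<eta> x) \<xi> = fourier \<phi> \<xi> + fourier \<eta> \<xi>"
  unfolding fourier_def
  by (simp add: ring_distribs fourier_integrand_integrable)

lemma fourier_diff:
  "integrable lborel \<phi> \<Longrightarrow> integrable lborel \<eta> \<Longrightarrow>
     fourier (\<lambda>x. \<phi> x - \<eta> x) \<xi> = fourier \<phi> \<xi> - fourier \<eta> \<xi>"
  unfolding fourier_def
  by (simp add: ring_distribs fourier_integrand_integrable)

lemma fourier_cmult: "fourier (\<lambda>x. c * \<phi> x) \<xi> = c * fourier \<phi> \<xi>"
proof -
  have "fourier (\<lambda>x. c * \<phi> x) \<xi> = (LINT x|lborel. c * (cis (- (x * \<xi>)) * \<phi> x))"
    unfolding fourier_def by (simp add: mult.left_commute)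
  then show ?thesis by (simp add: fourier_def)
qed

lemma rapid_integrable: "rapid k \<Longrightarrow> integrable lborel k"
  using rapid_weighted_L1[of k 0] by (simp add: weighted_L1_def integrable_norm_iff)

text \<open>The truncation in the compensator; it merges the two integrals of
  \<open>levy_exponent\<close> into a single integral of \<open>levy_kernel\<close>.\<close>

definition small_jump :: "real \<Rightarrow> real" where
  "small_jump y = (if \<bar>y\<bar> < 1 then y else 0)"

definition levy_kernel :: "real \<Rightarrow> real \<Rightarrow> complex" where
  "levy_kernel y \<xi> = 1 - cis (y * \<xi>) + \<i> * of_real (small_jump y * \<xi>)"

text \<open>The contribution of a jump \<open>y\<close> to the operator with symbol
  \<open>\<psi> (- \<xi>)\<close>; this reflection explains the argument \<open>x - y\<close> and
  the sign of the compensator.\<close>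

definition levy_diff :: "(real \<Rightarrow> complex) \<Rightarrow> real \<Rightarrow> real \<Rightarrow> complex" where
  "levy_diff \<phi> y x = \<phi> x - \<phi> (x - y) - of_real (small_jump y) * vd \<phi> x"

lemma small_jump_measurable [measurable]: "small_jump \<in> borel_measurable borel"
  unfolding small_jump_def by measurable

lemma levy_kernel_measurable [measurable]:
  "(\<lambda>z. levy_kernel (fst z) (snd z)) \<in> borel_measurable (borel \<Otimes>\<^sub>M borel)"
  unfolding levy_kernel_def cis_conv_exp by measurable

lemma test_function_levy_diff: "test_function \<phi> \<Longrightarrow> test_function (levy_diff \<phi> y)"
  unfolding levy_diff_def
  by (intro test_function_diff test_function_mult test_function_shift smooth_const test_function_vd)

lemma levy_diff_measurable [measurable]:
  assumes "test_function \<phi>"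
  shows "(\<lambda>z. levy_diff \<phi> (fst z) (snd z)) \<in> borel_measurable (borel \<Otimes>\<^sub>M borel)"
proof -
  have [measurable]: "\<phi> \<in> borel_measurable borel" "vd \<phi> \<in> borel_measurable borel"
    using assms test_function_vd[OF assms] by measurable
  show ?thesis unfolding levy_diff_def by measurable
qed

lemma fourier_levy_diff:
  assumes "test_function \<phi>"
  shows "fourier (levy_diff \<phi> y) \<xi> = levy_kernel y (- \<xi>) * fourier \<phi> \<xi>"
proof -
  have v: "test_function (vd \<phi>)" "test_function (\<lambda>x. of_real (small_jump y) * vd \<phi> x)"
    using assms by (auto intro!: test_function_vd test_function_mult smooth_const)
  note i = test_function_integrable[OF assms] test_function_integrable[OF v(2)]
     test_function_integrable[OF test_function_shift[OF assms]]
  have "fourier (levy_diff \<phi> y) \<xi>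
      = fourier \<phi> \<xi> - fourier (\<lambda>x. \<phi> (x - y)) \<xi> - fourier (\<lambda>x. of_real (small_jump y) * vd \<phi> x) \<xi>"
    unfolding levy_diff_def using i by (subst fourier_diff | simp)+
  then show ?thesis
    unfolding levy_kernel_def fourier_shift fourier_cmult fourier_vd[OF assms]
    by (simp add: algebra_simps)
qed

section \<open>Jump estimates and the integro-differential operator\<close>

locale levy =
  fixes b Q :: real and nu :: "real measure" and \<beta> :: real
  assumes triplet: "levy_triplet b Q nu" and beta: "\<beta> \<ge> 0"
    and moment: "(\<integral>\<^sup>+ y. ennreal (indicator {y. 1 \<le> \<bar>y\<bar>} y * \<bar>y\<bar> powr \<beta>) \<partial>nu) < \<infinity>"
begin

lemma sets_nu [measurable_cong, simp]: "sets nu = sets borel"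
  and Q_nonneg: "Q \<ge> 0"
  and nu_min: "(\<integral>\<^sup>+ y. ennreal (min 1 (y\<^sup>2)) \<partial>nu) < \<infinity>"
  and nu_0: "emeasure nu {0} = 0"
  using triplet by (auto simp: levy_triplet_def)

lemma space_nu [simp]: "space nu = UNIV"
  using sets_eq_imp_space_eq[OF sets_nu] by simp

lemma integrable_min: "integrable nu (\<lambda>y. min 1 (y\<^sup>2))"
  using nu_min by (intro integrableI_nonneg) auto

text \<open>Integrable near 0 by the triplet condition and at infinity by the moment hypothesis; it
  dominates both \<open>levy_kernel\<close> and the weighted norm of
  \<open>levy_diff\<close>.\<close>

definition jump_weight :: "real \<Rightarrow> real" where
  "jump_weight y = (if \<bar>y\<bar> < 1 then y\<^sup>2 else \<bar>y\<bar> powr \<beta>)"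

lemma jump_weight_measurable [measurable]: "jump_weight \<in> borel_measurable borel"
  unfolding jump_weight_def by measurable

lemma jump_weight_nonneg [simp]: "jump_weight y \<ge> 0"
  by (simp add: jump_weight_def)

lemma jump_weight_ge_1: "\<bar>y\<bar> \<ge> 1 \<Longrightarrow> jump_weight y \<ge> 1"
  using beta ge_one_powr_ge_zero[of "\<bar>y\<bar>" \<beta>] by (simp add: jump_weight_def)

lemma integrable_jump_weight: "integrable nu jump_weight"
proof -
  have "integrable nu (\<lambda>y. indicator {y. 1 \<le> \<bar>y\<bar>} y * \<bar>y\<bar> powr \<beta>)"
    using moment by (intro integrableI_nonneg) auto
  then have i: "integrable nu (\<lambda>y. min 1 (y\<^sup>2) + indicator {y. 1 \<le> \<bar>y\<bar>} y * \<bar>y\<bar> powr \<beta>)"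
    using integrable_min by simp
  show ?thesis
  proof (rule Bochner_Integration.integrable_bound[OF i])
    have "jump_weight y \<le> min 1 (y\<^sup>2) + indicator {y. 1 \<le> \<bar>y\<bar>} y * \<bar>y\<bar> powr \<beta>" for y
    proof (cases "\<bar>y\<bar> < 1")
      case True
      then have "y\<^sup>2 \<le> 1" by (simp add: abs_square_le_1)
      then show ?thesis using True by (simp add: jump_weight_def min_def)
    qed (auto simp: jump_weight_def)
    moreover have "min 1 (y\<^sup>2) + indicator {y. 1 \<le> \<bar>y\<bar>} y * \<bar>y\<bar> powr \<beta> \<ge> 0" for y
      by (intro add_nonneg_nonneg mult_nonneg_nonneg) auto
    ultimately show "AE y in nu. norm (jump_weight y) \<le> norm (min 1 (y\<^sup>2) + indicator {y. 1 \<le> \<bar>y\<bar>} y * \<bar>y\<bar> powr \<beta>)"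
      by auto
  qed measurable
qed

text \<open>Fubini for \<open>nu\<close> rests on this. The function \<open>min 1 (y^2)\<close> is
  integrable and positive off 0, so its superlevel sets have finite measure and exhaust everything
  except the null set \<open>{0}\<close>.\<close>

sublocale sigma_finite_measure nu
proof
  define A where "A n = {y. 1 / real (Suc n) \<le> min 1 (y\<^sup>2)}" for n :: nat
  have [measurable]: "A n \<in> sets borel" for n unfolding A_def by measurable
  have fin: "emeasure nu (A n) < \<infinity>" for n
  proof -
    have "emeasure nu (A n) = (\<integral>\<^sup>+ y. indicator (A n) y \<partial>nu)" by simp
    also have "\<dots> \<le> (\<integral>\<^sup>+ y. ennreal (real (Suc n)) * ennreal (min 1 (y\<^sup>2)) \<partial>nu)"
    proof (rule nn_integral_mono)
      fix y
      show "indicator (A n) y \<le> ennreal (real (Suc n)) * ennreal (min 1 (y\<^sup>2))"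
      proof (cases "y \<in> A n")
        case True
        then have "1 / real (Suc n) \<le> min 1 (y\<^sup>2)" by (simp only: A_def mem_Collect_eq)
        then have "1 \<le> real (Suc n) * min 1 (y\<^sup>2)"
          by (subst (asm) pos_divide_le_eq) (simp_all only: of_nat_0_less_iff zero_less_Suc mult.commute)
        then have "ennreal 1 \<le> ennreal (real (Suc n) * min 1 (y\<^sup>2))" by (rule ennreal_leI)
        then show ?thesis using True by (simp add: ennreal_mult del: of_nat_Suc)
      qed simp
    qed
    also have "\<dots> = ennreal (real (Suc n)) * (\<integral>\<^sup>+ y. ennreal (min 1 (y\<^sup>2)) \<partial>nu)"
      by (rule nn_integral_cmult) measurable
    also have "\<dots> < \<infinity>" using nu_min by (auto simp: ennreal_mult_less_top)
    finally show ?thesis .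
  qed
  have "y \<in> (\<Union>n. A n)" if "y \<noteq> 0" for y
  proof -
    have "min 1 (y\<^sup>2) > 0" using that by simp
    then obtain n where "inverse (real (Suc n)) < min 1 (y\<^sup>2)" using reals_Archimedean by blast
    then show ?thesis
      by (intro UN_I[of n]) (auto simp: A_def inverse_eq_divide less_imp_le simp del: of_nat_Suc)
  qed
  then have "\<Union> (insert {0} (range A)) = UNIV" by auto
  then show "\<exists>A. countable A \<and> A \<subseteq> sets nu \<and> \<Union>A = space nu \<and> (\<forall>a\<in>A. emeasure nu a \<noteq> \<infinity>)"
    using fin nu_0 by (intro exI[of _ "insert {0} (range A)"]) (auto simp: less_top)
qed

sublocale P: pair_sigma_finite nu lborel ..

text \<open>Small jumps contribute \<open>\<xi>^2\<close> by Taylor expansion; large ones contribute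
  2, the trivial bound on \<open>1 - cis (y * \<xi>)\<close>.\<close>

lemma levy_kernel_bound: "norm (levy_kernel y \<xi>) \<le> jump_weight y * (2 + \<xi>\<^sup>2)"
proof (cases "\<bar>y\<bar> < 1")
  case True
  have "levy_kernel y \<xi> = - (cis (y * \<xi>) - 1 - \<i> * of_real (y * \<xi>))"
    using True by (simp add: levy_kernel_def small_jump_def)
  then have "norm (levy_kernel y \<xi>) \<le> (y * \<xi>)\<^sup>2"
    using cis_taylor2[of "y * \<xi>"] by (metis norm_minus_cancel)
  also have "\<dots> \<le> jump_weight y * (2 + \<xi>\<^sup>2)" using True by (simp add: jump_weight_def power_mult_distrib mult_left_mono)
  finally show ?thesis .
next
  case False
  have "norm (levy_kernel y \<xi>) \<le> 2"
    using False norm_triangle_ineq4[of 1 "cis (y * \<xi>)"] by (simp add: levy_kernel_def small_jump_def)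
  also have "\<dots> \<le> 1 * (2 + \<xi>\<^sup>2)" by simp
  also have "\<dots> \<le> jump_weight y * (2 + \<xi>\<^sup>2)" using False jump_weight_ge_1[of y] by (intro mult_right_mono) auto
  finally show ?thesis .
qed

lemma integrable_levy_kernel: "integrable nu (\<lambda>y. levy_kernel y \<xi>)"
proof (rule Bochner_Integration.integrable_bound)
  show "integrable nu (\<lambda>y. jump_weight y * (2 + \<xi>\<^sup>2))" using integrable_jump_weight by simp
  show "(\<lambda>y. levy_kernel y \<xi>) \<in> borel_measurable nu"
    using measurable_compose[of "\<lambda>y. (y, \<xi>)" nu, OF _ levy_kernel_measurable] by simp
  show "AE y in nu. norm (levy_kernel y \<xi>) \<le> norm (jump_weight y * (2 + \<xi>\<^sup>2))"
    using levy_kernel_bound by (intro AE_I2) (simp add: abs_mult)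
qed

lemma levy_exponent_eq:
  "levy_exponent b Q nu \<xi> = - \<i> * of_real (b * \<xi>) + of_real (Q * \<xi>\<^sup>2 / 2) + (LINT y|nu. levy_kernel y \<xi>)"
proof -
  let ?S = "{y::real. 0 < \<bar>y\<bar> \<and> \<bar>y\<bar> < 1}" and ?L = "{y::real. 1 \<le> \<bar>y\<bar>}"
  have [measurable]: "?S \<in> sets borel" "?L \<in> sets borel" by measurable
  have S: "indicator ?S y *\<^sub>R (1 - cis (y * \<xi>) + \<i> * complex_of_real (y * \<xi>)) = indicator ?S y *\<^sub>R levy_kernel y \<xi>" for y
    by (auto simp: indicator_def levy_kernel_def small_jump_def)
  have L: "indicator ?L y *\<^sub>R (1 - cis (y * \<xi>)) = indicator ?L y *\<^sub>R levy_kernel y \<xi>" for y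
    by (auto simp: indicator_def levy_kernel_def small_jump_def)
  \<comment> \<open>The origin lies in neither domain of integration, but the kernel vanishes
    there.\<close>
  have sum: "indicator ?S y *\<^sub>R levy_kernel y \<xi> + indicator ?L y *\<^sub>R levy_kernel y \<xi> = levy_kernel y \<xi>" for y
    by (cases "y = 0") (auto simp: indicator_def levy_kernel_def small_jump_def)
  have "(LINT y:?S|nu. 1 - cis (y * \<xi>) + \<i> * complex_of_real (y * \<xi>)) + (LINT y:?L|nu. 1 - cis (y * \<xi>))
     = (LINT y|nu. indicator ?S y *\<^sub>R levy_kernel y \<xi>) + (LINT y|nu. indicator ?L y *\<^sub>R levy_kernel y \<xi>)"
    unfolding set_lebesgue_integral_def S L ..
  also have "\<dots> = (LINT y|nu. indicator ?S y *\<^sub>R levy_kernel y \<xi> + indicator ?L y *\<^sub>R levy_kernel y \<xi>)"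
    by (intro Bochner_Integration.integral_add[symmetric] integrable_mult_indicator integrable_levy_kernel) auto
  finally show ?thesis unfolding sum levy_exponent_def by (simp add: add.assoc)
qed

text \<open>The integro-differential form of \<open>symbol_op\<close> for the reflected exponent.
  Weighted integrability and moments are visible in this form, but not in the inverse Fourier
  integral.\<close>

definition levy_op :: "(real \<Rightarrow> complex) \<Rightarrow> real \<Rightarrow> complex" where
  "levy_op \<phi> x = of_real b * vd \<phi> x - of_real (Q / 2) * vd (vd \<phi>) x + (LINT y|nu. levy_diff \<phi> y x)"

lemma levy_op_shift:
  assumes "test_function \<phi>" shows "levy_op (\<lambda>x. \<phi> (x - a)) x = levy_op \<phi> (x - a)"
  by (simp add: levy_op_def levy_diff_def vd_shift assms test_function_vd algebra_simps)

lemma levy_op_measurable [measurable]: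
  assumes "test_function \<phi>" shows "levy_op \<phi> \<in> borel_measurable borel"
proof -
  have v: "test_function (vd \<phi>)" "test_function (vd (vd \<phi>))"
    using assms by (auto intro!: test_function_vd)
  have [measurable]: "vd \<phi> \<in> borel_measurable borel" "vd (vd \<phi>) \<in> borel_measurable borel"
    using v by measurable
  have "(\<lambda>z. levy_diff \<phi> (snd z) (fst z)) \<in> borel_measurable (borel \<Otimes>\<^sub>M nu)"
    using measurable_compose[OF measurable_pair_swap'[of borel nu] , of "\<lambda>z. levy_diff \<phi> (fst z) (snd z)" borel]
      levy_diff_measurable[OF assms] by (simp add: case_prod_unfold cong: measurable_cong_sets)
  then have [measurable]: "(\<lambda>x. LINT y|nu. levy_diff \<phi> y x) \<in> borel_measurable borel"
    by (intro borel_measurable_lebesgue_integral) (simp add: case_prod_unfold)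
  show ?thesis unfolding levy_op_def by measurable
qed

text \<open>For small jumps the second-order Taylor remainder lives on a fixed compact set. For
  large jumps the translate of \<phi> costs a factor \<open>weight \<beta> y\<close>, which is why
  the moment of order \<beta> is the right hypothesis.\<close>

lemma levy_diff_integral_bound:
  assumes "test_function \<phi>"
  obtains C where "\<And>y. (LINT x|lborel. weight \<beta> x * norm (levy_diff \<phi> y x)) \<le> C * jump_weight y"
proof -
  obtain M where M: "M > 0" "\<And>x h. norm (\<phi> (x + h) - \<phi> x - h *\<^sub>R vd \<phi> x) \<le> M * h\<^sup>2"
    using test_function_taylor2[OF assms] by blast
  have v: "test_function (vd \<phi>)" by (rule test_function_vd[OF assms])
  obtain R1 where R1: "R1 > 0" "\<And>x. \<bar>x\<bar> \<ge> R1 \<Longrightarrow> \<phi> x = 0"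
    using test_function_bounded_support[OF assms] by blast
  obtain R2 where R2: "R2 > 0" "\<And>x. \<bar>x\<bar> \<ge> R2 \<Longrightarrow> vd \<phi> x = 0"
    using test_function_bounded_support[OF v] by blast
  \<comment> \<open>The extra 1 absorbs translation by a small jump, so every term of
    \<open>levy_diff\<close> vanishes outside \<open>{-R..R}\<close>.\<close>
  define R where "R = max R1 R2 + 1"
  have wi: "integrable lborel (\<lambda>x. weight \<beta> x * norm (\<eta> x))" if eta: "test_function \<eta>" for \<eta>
  proof -
    have [measurable]: "\<eta> \<in> borel_measurable borel" using eta by measurable
    obtain S where S: "S > 0" "\<And>x. \<bar>x\<bar> \<ge> S \<Longrightarrow> \<eta> x = 0"
      using test_function_bounded_support[OF eta] by blast
    show ?thesis
    proof (rule Bochner_Integration.integrable_bound)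
      show "integrable lborel (\<lambda>x. weight \<beta> S * norm (\<eta> x))"
        using test_function_integrable[OF eta] by simp
      have "weight \<beta> x * norm (\<eta> x) \<le> weight \<beta> S * norm (\<eta> x)" for x
        using S(2)[of x] weight_mono[OF beta, of x S] S(1)
        by (cases "\<bar>x\<bar> \<ge> S") (auto intro!: mult_right_mono)
      then show "AE x in lborel. norm (weight \<beta> x * norm (\<eta> x)) \<le> norm (weight \<beta> S * norm (\<eta> x))" by simp
    qed measurable
  qed
  define A where "A = (LINT x|lborel. weight \<beta> x * norm (\<phi> x))"
  have A: "A \<ge> 0" unfolding A_def by simp
  define C where "C = max (weight \<beta> R * M * (2 * R)) (A + 2 powr \<beta> * A)"
  have "(LINT x|lborel. weight \<beta> x * norm (levy_diff \<phi> y x)) \<le> C * jump_weight y" for y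
  proof (cases "\<bar>y\<bar> < 1")
    case True
    have R0: "R > 0" using R1 by (simp add: R_def)
    have "(LINT x|lborel. weight \<beta> x * norm (levy_diff \<phi> y x)) \<le> (LINT x|lborel. indicator {-R..R} x *\<^sub>R (weight \<beta> R * (M * y\<^sup>2)))"
    proof (rule integral_mono)
      show "integrable lborel (\<lambda>x. weight \<beta> x * norm (levy_diff \<phi> y x))"
        by (rule wi[OF test_function_levy_diff[OF assms]])
      fix x
      show "weight \<beta> x * norm (levy_diff \<phi> y x) \<le> indicator {-R..R} x *\<^sub>R (weight \<beta> R * (M * y\<^sup>2))"
      proof (cases "x \<in> {-R..R}")
        case xR: True
        have "norm (levy_diff \<phi> y x) = norm (\<phi> (x + - y) - \<phi> x - (- y) *\<^sub>R vd \<phi> x)"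
          using True by (simp add: levy_diff_def small_jump_def scaleR_conv_of_real norm_minus_commute algebra_simps)
        also have "\<dots> \<le> M * y\<^sup>2" using M(2)[of x "- y"] by simp
        finally show ?thesis using xR weight_mono[OF beta, of x R] by (auto intro!: mult_mono)
      next
        case False
        then have "\<bar>x\<bar> \<ge> R1" "\<bar>x\<bar> \<ge> R2" "\<bar>x - y\<bar> \<ge> R1" using True by (auto simp: R_def)
        then have "levy_diff \<phi> y x = 0" using R1 R2 by (simp add: levy_diff_def)
        then show ?thesis using False by simp
      qed
    qed (simp add: integrable_real_indicator emeasure_lborel_Icc_eq)
    also have "\<dots> = weight \<beta> R * M * (2 * R) * jump_weight y"
      using True R0 by (simp add: jump_weight_def)
    also have "\<dots> \<le> C * jump_weight y" unfolding C_def by (intro mult_right_mono) auto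
    finally show ?thesis .
  next
    case False
    have sh: "(LINT x|lborel. weight \<beta> x * norm (\<phi> (x - y))) = (LINT x|lborel. weight \<beta> (x + y) * norm (\<phi> x))"
      using lborel_integral_shift[of "\<lambda>x. weight \<beta> x * norm (\<phi> (x - y))" y] by simp
    have shi: "integrable lborel (\<lambda>x. weight \<beta> x * norm (\<phi> (x - y)))"
      by (rule wi[OF test_function_shift[OF assms]])
    have shi2: "integrable lborel (\<lambda>x. weight \<beta> (x + y) * norm (\<phi> x))"
      using lborel_integrable_real_affine[OF shi, of 1 y] by (simp add: add.commute)
    have "(LINT x|lborel. weight \<beta> x * norm (levy_diff \<phi> y x))
       \<le> (LINT x|lborel. weight \<beta> x * norm (\<phi> x) + weight \<beta> x * norm (\<phi> (x - y)))"
    proof (rule integral_mono)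
      show "integrable lborel (\<lambda>x. weight \<beta> x * norm (levy_diff \<phi> y x))"
        by (rule wi[OF test_function_levy_diff[OF assms]])
      show "integrable lborel (\<lambda>x. weight \<beta> x * norm (\<phi> x) + weight \<beta> x * norm (\<phi> (x - y)))"
        using wi[OF assms] shi by simp
      show "weight \<beta> x * norm (levy_diff \<phi> y x) \<le> weight \<beta> x * norm (\<phi> x) + weight \<beta> x * norm (\<phi> (x - y))" for x
        using False norm_triangle_ineq4[of "\<phi> x" "\<phi> (x - y)"]
        by (simp add: levy_diff_def small_jump_def flip: distrib_left)
    qed
    also have "\<dots> = A + (LINT x|lborel. weight \<beta> (x + y) * norm (\<phi> x))"
      using wi[OF assms] shi sh by (simp add: A_def)
    also have "(LINT x|lborel. weight \<beta> (x + y) * norm (\<phi> x)) \<le> (LINT x|lborel. weight \<beta> y * (weight \<beta> x * norm (\<phi> x)))"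
    proof (rule integral_mono[OF shi2])
      show "integrable lborel (\<lambda>x. weight \<beta> y * (weight \<beta> x * norm (\<phi> x)))" using wi[OF assms] by simp
      show "weight \<beta> (x + y) * norm (\<phi> x) \<le> weight \<beta> y * (weight \<beta> x * norm (\<phi> x))" for x
        using mult_right_mono[OF weight_add[OF beta, of x y], of "norm (\<phi> x)"] by (simp add: mult_ac)
    qed
    also have "\<dots> = weight \<beta> y * A" by (simp add: A_def)
    also have "weight \<beta> y * A \<le> (2 powr \<beta> * jump_weight y) * A"
    proof (intro mult_right_mono A)
      \<comment> \<open>For \<open>\<bar>y\<bar> \<ge> 1\<close> one has
        \<open>1 + \<bar>y\<bar> \<le> 2 * \<bar>y\<bar>\<close>, whence the constant
        \<open>2 powr \<beta>\<close>.\<close>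
      have "weight \<beta> y \<le> (2 * \<bar>y\<bar>) powr \<beta>" unfolding weight_def using False beta by (intro powr_mono2) auto
      then show "weight \<beta> y \<le> 2 powr \<beta> * jump_weight y" using False by (simp add: jump_weight_def powr_mult)
    qed
    finally have "(LINT x|lborel. weight \<beta> x * norm (levy_diff \<phi> y x)) \<le> A * 1 + 2 powr \<beta> * jump_weight y * A" by simp
    also have "\<dots> \<le> A * jump_weight y + 2 powr \<beta> * jump_weight y * A"
      using jump_weight_ge_1[of y] False A by (intro add_right_mono mult_left_mono) auto
    also have "\<dots> = (A + 2 powr \<beta> * A) * jump_weight y" by (simp add: algebra_simps)
    also have "\<dots> \<le> C * jump_weight y" unfolding C_def by (intro mult_right_mono) auto
    finally show ?thesis .
  qed
  then show ?thesis by (rule that)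
qed

lemma test_function_weight_integrable:
  assumes [measurable]: "e \<in> borel_measurable borel" and e: "\<And>x. norm (e x) \<le> E * weight \<beta> x" and t: "test_function \<eta>"
  shows "integrable lborel (\<lambda>x. e x * \<eta> x)"
proof -
  obtain S where S: "S > 0" "\<And>x. \<bar>x\<bar> \<ge> S \<Longrightarrow> \<eta> x = 0"
    using test_function_bounded_support[OF t] by blast
  have [measurable]: "\<eta> \<in> borel_measurable borel" using t by measurable
  have E: "E \<ge> 0" using order_trans[OF norm_ge_zero e[of 0]] by simp
  show ?thesis
  proof (rule Bochner_Integration.integrable_bound)
    show "integrable lborel (\<lambda>x. E * weight \<beta> S * norm (\<eta> x))" using test_function_integrable[OF t] by simp
    have "norm (e x) * norm (\<eta> x) \<le> E * weight \<beta> S * norm (\<eta> x)" for x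
    proof (cases "\<bar>x\<bar> \<ge> S")
      case False
      then have "E * weight \<beta> x \<le> E * weight \<beta> S" using E S by (intro mult_left_mono weight_mono beta) auto
      then show ?thesis using e[of x] by (intro mult_right_mono) auto
    qed (simp add: S)
    then show "AE x in lborel. norm (e x * \<eta> x) \<le> norm (E * weight \<beta> S * norm (\<eta> x))"
      using E by (simp add: norm_mult abs_mult)
  qed measurable
qed

text \<open>The support of \<open>levy_diff \<phi> y\<close> drifts with \<open>y\<close>. Instead
  of a product majorant, the inner integral over \<open>x\<close> is bounded by a multiple of
  \<open>jump_weight y\<close>.\<close>

lemma integrable_pair_levy_diff:
  assumes t: "test_function \<phi>" and [measurable]: "e \<in> borel_measurable borel"
    and e: "\<And>x. norm (e x) \<le> E * weight \<beta> x"
  shows "integrable (nu \<Otimes>\<^sub>M lborel) (\<lambda>(y, x). e x * levy_diff \<phi> y x)"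
proof (rule P.Fubini_integrable)
  have E: "E \<ge> 0" using order_trans[OF norm_ge_zero e[of 0]] by simp
  have "(\<lambda>z. levy_diff \<phi> (fst z) (snd z)) \<in> borel_measurable (nu \<Otimes>\<^sub>M lborel)"
    using levy_diff_measurable[OF t] by (simp cong: measurable_cong_sets)
  then show [measurable]: "(\<lambda>(y, x). e x * levy_diff \<phi> y x) \<in> borel_measurable (nu \<Otimes>\<^sub>M lborel)"
    unfolding case_prod_unfold by measurable
  have D: "integrable lborel (\<lambda>x. e x * levy_diff \<phi> y x)" for y
    by (rule test_function_weight_integrable[OF _ e test_function_levy_diff[OF t]]) measurable
  have D': "integrable lborel (\<lambda>x. of_real (weight \<beta> x) * levy_diff \<phi> y x)" for y
    by (rule test_function_weight_integrable[OF _ _ test_function_levy_diff[OF t], of _ 1]) auto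
  then show "AE y in nu. integrable lborel (\<lambda>x. case (y, x) of (y, x) \<Rightarrow> e x * levy_diff \<phi> y x)"
    using D by simp
  obtain C where C: "\<And>y. (LINT x|lborel. weight \<beta> x * norm (levy_diff \<phi> y x)) \<le> C * jump_weight y"
    using levy_diff_integral_bound[OF t] by blast
  have B: "(LINT x|lborel. norm (e x * levy_diff \<phi> y x)) \<le> E * C * jump_weight y" for y
  proof -
    have "(LINT x|lborel. norm (e x * levy_diff \<phi> y x)) \<le> (LINT x|lborel. E * (weight \<beta> x * norm (levy_diff \<phi> y x)))"
    proof (rule integral_mono)
      show "integrable lborel (\<lambda>x. norm (e x * levy_diff \<phi> y x))" using D by simp
      show "integrable lborel (\<lambda>x. E * (weight \<beta> x * norm (levy_diff \<phi> y x)))"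
        using integrable_norm[OF D'] by (simp add: norm_mult)
      show "norm (e x * levy_diff \<phi> y x) \<le> E * (weight \<beta> x * norm (levy_diff \<phi> y x))" for x
        using mult_right_mono[OF e, of "norm (levy_diff \<phi> y x)"] by (simp add: norm_mult mult_ac)
    qed
    also have "\<dots> \<le> E * (C * jump_weight y)" using mult_left_mono[OF C E] by simp
    finally show ?thesis by (simp add: mult_ac)
  qed
  show "integrable nu (\<lambda>y. LINT x|lborel. norm (case (y, x) of (y, x) \<Rightarrow> e x * levy_diff \<phi> y x))"
  proof (rule Bochner_Integration.integrable_bound)
    show "integrable nu (\<lambda>y. E * C * jump_weight y)" using integrable_jump_weight by simp
    show "AE y in nu. norm (LINT x|lborel. norm (case (y, x) of (y, x) \<Rightarrow> e x * levy_diff \<phi> y x)) \<le> norm (E * C * jump_weight y)"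
      using B by (intro AE_I2) (auto intro: order_trans[OF _ abs_ge_self])
  qed measurable
qed

text \<open>Kept general in \<open>e\<close>: the weight itself yields
  \<open>weighted_L1_levy_op\<close>, a character yields the Fourier transform, and monomials yield
  the moments.\<close>

lemma integrable_levy_op:
  assumes t: "test_function \<phi>" and [measurable]: "e \<in> borel_measurable borel"
    and e: "\<And>x. norm (e x) \<le> E * weight \<beta> x"
  shows "integrable lborel (\<lambda>x. e x * levy_op \<phi> x)"
    and "(LINT x|lborel. e x * levy_op \<phi> x) = of_real b * (LINT x|lborel. e x * vd \<phi> x)
      - of_real (Q / 2) * (LINT x|lborel. e x * vd (vd \<phi>) x)
      + (LINT y|nu. LINT x|lborel. e x * levy_diff \<phi> y x)"
proof -
  note P = integrable_pair_levy_diff[OF assms]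
  have i1: "integrable lborel (\<lambda>x. e x * vd \<phi> x)" "integrable lborel (\<lambda>x. e x * vd (vd \<phi>) x)"
    using t by (auto intro!: test_function_weight_integrable[OF _ e] test_function_vd)
  have i2: "integrable lborel (\<lambda>x. e x * (LINT y|nu. levy_diff \<phi> y x))"
    using P.integrable_snd[OF P] by simp
  have *: "e x * levy_op \<phi> x = of_real b * (e x * vd \<phi> x) - of_real (Q / 2) * (e x * vd (vd \<phi>) x)
     + e x * (LINT y|nu. levy_diff \<phi> y x)" for x
    by (simp add: levy_op_def algebra_simps)
  show "integrable lborel (\<lambda>x. e x * levy_op \<phi> x)"
    unfolding * using i1 i2 by (intro Bochner_Integration.integrable_add Bochner_Integration.integrable_diff integrable_mult_right)
  have "(LINT x|lborel. e x * (LINT y|nu. levy_diff \<phi> y x)) = (LINT y|nu. LINT x|lborel. e x * levy_diff \<phi> y x)"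
    using P.Fubini_integral[OF P] by simp
  then show "(LINT x|lborel. e x * levy_op \<phi> x) = of_real b * (LINT x|lborel. e x * vd \<phi> x)
      - of_real (Q / 2) * (LINT x|lborel. e x * vd (vd \<phi>) x)
      + (LINT y|nu. LINT x|lborel. e x * levy_diff \<phi> y x)"
    unfolding * using i1 i2 by simp
qed

lemma weighted_L1_levy_op:
  assumes "test_function \<phi>" shows "weighted_L1 \<beta> (levy_op \<phi>)"
proof -
  have "integrable lborel (\<lambda>x. of_real (weight \<beta> x) * levy_op \<phi> x)"
    by (rule integrable_levy_op[OF assms, of _ 1]) auto
  from integrable_norm[OF this] show ?thesis
    using levy_op_measurable[OF assms] by (simp add: weighted_L1_def norm_mult)
qed

lemma fourier_levy_op:
  assumes "test_function \<phi>"
  shows "fourier (levy_op \<phi>) \<xi> = levy_exponent b Q nu (- \<xi>) * fourier \<phi> \<xi>"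
proof -
  have v: "test_function (vd \<phi>)" by (rule test_function_vd[OF assms])
  have "fourier (levy_op \<phi>) \<xi> = of_real b * fourier (vd \<phi>) \<xi> - of_real (Q / 2) * fourier (vd (vd \<phi>)) \<xi>
     + (LINT y|nu. fourier (levy_diff \<phi> y) \<xi>)"
    unfolding fourier_def using weight_ge_1[OF beta]
    by (intro integrable_levy_op(2)[OF assms, of _ 1]) (auto simp: cis_conv_exp)
  then show ?thesis
    unfolding fourier_levy_diff[OF assms] levy_exponent_eq
    by (simp add: fourier_vd v assms algebra_simps power2_eq_square)
qed

text \<open>Inversion is applied to test functions only, namely to the derivatives of \<phi> and,
  inside the integral over \<open>nu\<close>, to each \<open>levy_diff \<phi> y\<close>.
  \<open>levy_kernel_bound\<close> and the decay of \<open>fourier \<phi>\<close> justify the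
  exchange of integrals.\<close>

lemma symbol_op_eq_levy_op:
  assumes t: "test_function \<phi>"
  shows "symbol_op (\<lambda>\<xi>. levy_exponent b Q nu (- \<xi>)) \<phi> x = levy_op \<phi> x"
proof -
  have v: "test_function (vd \<phi>)" "test_function (vd (vd \<phi>))"
    by (auto intro!: test_function_vd t)
  have ri: "integrable lborel (\<lambda>\<xi>. cis (x * \<xi>) * fourier \<eta> \<xi>)" if "test_function \<eta>" for \<eta>
    by (rule integrable_cis_mult[OF rapid_integrable[OF rapid_fourier[OF that]]]) auto
  have inv: "(LINT \<xi>|lborel. cis (x * \<xi>) * fourier \<eta> \<xi>) = of_real (2 * pi) * \<eta> x" if "test_function \<eta>" for \<eta>
    using fourier_inversion_test[OF that, of x] by (simp add: inv_fourier_def field_simps)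
  have pair: "integrable (nu \<Otimes>\<^sub>M lborel) (\<lambda>(y, \<xi>). cis (x * \<xi>) * fourier (levy_diff \<phi> y) \<xi>)"
  proof (rule integrable_pair_dominated)
    show "pair_sigma_finite nu lborel" ..
    show "integrable nu jump_weight" by (rule integrable_jump_weight)
    have [measurable]: "\<phi> \<in> borel_measurable borel" using t by measurable
    have "(\<lambda>z. levy_kernel (fst z) (snd z)) \<in> borel_measurable (nu \<Otimes>\<^sub>M lborel)"
      using levy_kernel_measurable by (simp cong: measurable_cong_sets)
    then have [measurable]: "(\<lambda>z. levy_kernel (fst z) (- snd z)) \<in> borel_measurable (nu \<Otimes>\<^sub>M lborel)"
      using measurable_compose[of "\<lambda>z. (fst z, - snd z)" "nu \<Otimes>\<^sub>M lborel" "nu \<Otimes>\<^sub>M lborel"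
        "\<lambda>z. levy_kernel (fst z) (snd z)" borel] by simp
    show "(\<lambda>(y, \<xi>). cis (x * \<xi>) * fourier (levy_diff \<phi> y) \<xi>) \<in> borel_measurable (nu \<Otimes>\<^sub>M lborel)"
      unfolding fourier_levy_diff[OF t] cis_conv_exp case_prod_unfold by measurable
    \<comment> \<open>The quadratic growth of the kernel bound in \<xi> is absorbed by the transform
      of a second derivative.\<close>
    have "fourier (\<lambda>x. - vd (vd \<phi>) x) \<xi> = of_real (\<xi>\<^sup>2) * fourier \<phi> \<xi>" for \<xi>
      using fourier_cmult[of "-1" "vd (vd \<phi>)" \<xi>]
      by (simp add: fourier_vd t v power2_eq_square algebra_simps)
    then have "norm (fourier (\<lambda>x. - vd (vd \<phi>) x) \<xi>) = \<xi>\<^sup>2 * norm (fourier \<phi> \<xi>)" for \<xi>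
      by (simp add: norm_mult norm_power)
    moreover have "integrable lborel (fourier (\<lambda>x. - vd (vd \<phi>) x))"
      using test_function_mult[OF v(2) smooth_const, of "-1"] by (intro rapid_integrable rapid_fourier) simp
    ultimately have "integrable lborel (\<lambda>\<xi>. \<xi>\<^sup>2 * norm (fourier \<phi> \<xi>))"
      using integrable_norm by fastforce
    then show "integrable lborel (\<lambda>\<xi>. (2 + \<xi>\<^sup>2) * norm (fourier \<phi> \<xi>))"
      using rapid_integrable[OF rapid_fourier[OF t]] by (simp add: ring_distribs)
    show "norm (case (y, \<xi>) of (y, \<xi>) \<Rightarrow> cis (x * \<xi>) * fourier (levy_diff \<phi> y) \<xi>)
       \<le> jump_weight y * ((2 + \<xi>\<^sup>2) * norm (fourier \<phi> \<xi>))" for y \<xi>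
      using mult_right_mono[OF levy_kernel_bound[of y "- \<xi>"], of "norm (fourier \<phi> \<xi>)"]
      by (simp add: fourier_levy_diff[OF t] norm_mult mult_ac)
  qed
  have eq: "cis (x * \<xi>) * (levy_exponent b Q nu (- \<xi>) * fourier \<phi> \<xi>)
     = of_real b * (cis (x * \<xi>) * fourier (vd \<phi>) \<xi>) - of_real (Q / 2) * (cis (x * \<xi>) * fourier (vd (vd \<phi>)) \<xi>)
       + (LINT y|nu. cis (x * \<xi>) * fourier (levy_diff \<phi> y) \<xi>)" for \<xi>
    unfolding fourier_levy_diff[OF t] levy_exponent_eq
    by (simp add: fourier_vd v t algebra_simps power2_eq_square)
  have "(LINT \<xi>|lborel. cis (x * \<xi>) * (levy_exponent b Q nu (- \<xi>) * fourier \<phi> \<xi>))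
     = of_real b * (LINT \<xi>|lborel. cis (x * \<xi>) * fourier (vd \<phi>) \<xi>)
       - of_real (Q / 2) * (LINT \<xi>|lborel. cis (x * \<xi>) * fourier (vd (vd \<phi>)) \<xi>)
       + (LINT \<xi>|lborel. LINT y|nu. cis (x * \<xi>) * fourier (levy_diff \<phi> y) \<xi>)"
    unfolding eq using ri v P.integrable_snd[OF pair] by simp
  also have "(LINT \<xi>|lborel. LINT y|nu. cis (x * \<xi>) * fourier (levy_diff \<phi> y) \<xi>)
     = (LINT y|nu. LINT \<xi>|lborel. cis (x * \<xi>) * fourier (levy_diff \<phi> y) \<xi>)"
    by (rule P.Fubini_integral[OF pair])
  also have "\<dots> = of_real (2 * pi) * (LINT y|nu. levy_diff \<phi> y x)"
    by (simp add: inv test_function_levy_diff t)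
  finally show ?thesis
    unfolding symbol_op_def inv_fourier_def inv[OF v(1)] inv[OF v(2)] levy_op_def
    by (simp add: field_simps)
qed

lemma levy_exponent_0: "levy_exponent b Q nu 0 = 0"
  by (simp add: levy_exponent_eq levy_kernel_def)

text \<open>The first two moments of \<open>levy_op \<phi>\<close> recover \<open>\<psi>'(0)\<close> and \<open>\<psi>''(0)\<close>; if both vanish,
  the process has neither a Gaussian nor a jump part.\<close>

lemma moments_vanish_imp_trivial:
  assumes t: "test_function \<phi>" and b2: "\<beta> \<ge> 2" and I0: "(LINT x|lborel. \<phi> x) \<noteq> 0"
    and M1: "(LINT x|lborel. of_real x * levy_op \<phi> x) = 0"
    and M2: "(LINT x|lborel. of_real x ^ 2 * levy_op \<phi> x) = 0"
  shows "levy_exponent b Q nu \<xi> = 0"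
proof -
  define I0 I1 I2 where "I0 = (LINT x|lborel. \<phi> x)" "I1 = (LINT x|lborel. of_real x * \<phi> x)"
     "I2 = (LINT x|lborel. of_real x ^ 2 * \<phi> x)"
  have v: "test_function (vd \<phi>)" by (rule test_function_vd[OF t])
  have x1: "norm (complex_of_real x) \<le> 1 * weight \<beta> x" for x
    using weight_power_bound[of 1 \<beta> x] b2 by simp
  have x2: "norm (complex_of_real x ^ 2) \<le> 1 * weight \<beta> x" for x
    using weight_power_bound[of 2 \<beta> x] b2 by simp
  have vx: "vd complex_of_real = (\<lambda>_. 1)"
    by (rule vdI) (auto intro!: derivative_eq_intros has_vector_derivative_of_real)
  have vx2: "vd (\<lambda>x. complex_of_real x ^ 2) = (\<lambda>x. 2 * of_real x)"
    by (rule vdI, rule has_vector_derivative_real_field) (auto intro!: derivative_eq_intros)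
  have ti: "integrable lborel \<phi>" "integrable lborel (\<lambda>x. of_real x * \<phi> x)" "integrable lborel (\<lambda>x. of_real x ^ 2 * \<phi> x)"
    by (auto intro!: test_function_integrable test_function_mult smooth_power smooth_of_real t)
  have vi: "integrable lborel (vd \<phi>)" "integrable lborel (\<lambda>x. of_real x * vd \<phi> x)" "integrable lborel (\<lambda>x. of_real x ^ 2 * vd \<phi> x)"
    by (auto intro!: test_function_integrable test_function_mult smooth_power smooth_of_real v)
  have si: "integrable lborel (\<lambda>x. of_real x * \<phi> (x - y))" "integrable lborel (\<lambda>x. of_real x ^ 2 * \<phi> (x - y))" for y
    by (auto intro!: test_function_integrable test_function_mult smooth_power smooth_of_real t test_function_shift)
  have p1: "(LINT x|lborel. of_real x * vd \<phi> x) = - I0"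
    using integration_by_parts_test[OF t smooth_of_real] by (simp add: vx I0_I1_I2_def)
  have p2: "(LINT x|lborel. of_real x * vd (vd \<phi>) x) = 0"
    using integration_by_parts_test[OF v smooth_of_real] test_function_integral_vd[OF t] by (simp add: vx)
  have p3: "(LINT x|lborel. of_real x ^ 2 * vd \<phi> x) = - 2 * I1"
    using integration_by_parts_test[OF t smooth_power[OF smooth_of_real, of 2]]
    by (simp add: vx2 I0_I1_I2_def mult.assoc)
  have p4: "(LINT x|lborel. of_real x ^ 2 * vd (vd \<phi>) x) = 2 * I0"
    using integration_by_parts_test[OF v smooth_power[OF smooth_of_real, of 2]] p1
    by (simp add: vx2 I0_I1_I2_def mult.assoc)
  have s1: "(LINT x|lborel. of_real x * \<phi> (x - y)) = I1 + of_real y * I0" for y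
  proof -
    have "(LINT x|lborel. of_real x * \<phi> (x - y)) = (LINT x|lborel. of_real x * \<phi> x + of_real y * \<phi> x)"
      using lborel_integral_shift[of "\<lambda>x. of_real x * \<phi> (x - y)" y] by (simp add: algebra_simps)
    then show ?thesis using ti by (simp add: I0_I1_I2_def)
  qed
  have s2: "(LINT x|lborel. of_real x ^ 2 * \<phi> (x - y)) = I2 + 2 * of_real y * I1 + of_real y ^ 2 * I0" for y
  proof -
    have "(LINT x|lborel. of_real x ^ 2 * \<phi> (x - y))
      = (LINT x|lborel. of_real x ^ 2 * \<phi> x + 2 * of_real y * (of_real x * \<phi> x) + of_real y ^ 2 * \<phi> x)"
      using lborel_integral_shift[of "\<lambda>x. of_real x ^ 2 * \<phi> (x - y)" y]
      by (simp add: power2_eq_square algebra_simps)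
    then show ?thesis using ti by (simp add: I0_I1_I2_def)
  qed
  have d1: "(LINT x|lborel. of_real x * levy_diff \<phi> y x) = of_real (small_jump y - y) * I0" for y
  proof -
    have "(LINT x|lborel. of_real x * levy_diff \<phi> y x)
      = (LINT x|lborel. of_real x * \<phi> x - of_real x * \<phi> (x - y) - of_real (small_jump y) * (of_real x * vd \<phi> x))"
      by (simp add: levy_diff_def algebra_simps)
    also have "\<dots> = of_real (small_jump y - y) * I0"
      using ti si vi by (simp add: s1 p1 flip: I0_I1_I2_def) (simp add: algebra_simps)
    finally show ?thesis .
  qed
  have d2: "(LINT x|lborel. of_real x ^ 2 * levy_diff \<phi> y x) = 2 * I1 * of_real (small_jump y - y) - I0 * of_real (y\<^sup>2)" for y
  proof -
    have "(LINT x|lborel. of_real x ^ 2 * levy_diff \<phi> y x)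
      = (LINT x|lborel. of_real x ^ 2 * \<phi> x - of_real x ^ 2 * \<phi> (x - y) - of_real (small_jump y) * (of_real x ^ 2 * vd \<phi> x))"
      by (simp add: levy_diff_def algebra_simps)
    also have "\<dots> = 2 * I1 * of_real (small_jump y - y) - I0 * of_real (y\<^sup>2)"
      using ti si vi by (simp add: s2 p3 flip: I0_I1_I2_def) (simp add: algebra_simps)
    finally show ?thesis .
  qed
  \<comment> \<open>Here \<open>\<beta> \<ge> 2\<close> gives \<open>nu\<close> a finite second
    moment.\<close>
  have ym: "y\<^sup>2 \<le> jump_weight y" for y
  proof (cases "\<bar>y\<bar> < 1")
    case False
    then have "\<bar>y\<bar> powr 2 \<le> \<bar>y\<bar> powr \<beta>" using b2 by (intro powr_mono) auto
    then show ?thesis using False by (simp add: jump_weight_def)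
  qed (simp add: jump_weight_def)
  have i_y2: "integrable nu (\<lambda>y. y\<^sup>2)"
    by (rule Bochner_Integration.integrable_bound[OF integrable_jump_weight]) (use ym in auto)
  have i_c: "integrable nu (\<lambda>y. small_jump y - y)"
  proof (rule Bochner_Integration.integrable_bound[OF i_y2])
    \<comment> \<open>The difference is zero for small jumps and \<open>- y\<close> for large ones,
      where \<open>\<bar>y\<bar> \<le> y^2\<close>.\<close>
    have "\<bar>small_jump y - y\<bar> \<le> y\<^sup>2" for y
      using mult_right_mono[of 1 "\<bar>y\<bar>" "\<bar>y\<bar>"] by (auto simp: small_jump_def power2_eq_square abs_mult_self_eq)
    then show "AE y in nu. norm (small_jump y - y) \<le> norm (y\<^sup>2)" by simp
  qed measurable
  \<comment> \<open>In these terms the exponent has derivative \<open>\<i> * (c - b)\<close> and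
    second derivative \<open>Q + V\<close> at 0.\<close>
  define c where "c = (LINT y|nu. small_jump y - y)"
  define V where "V = (LINT y|nu. y\<^sup>2)"
  have "0 = of_real b * (- I0) - of_real (Q / 2) * 0 + (LINT y|nu. of_real (small_jump y - y) * I0)"
    using integrable_levy_op(2)[OF t _ x1] M1 by (simp add: p1 p2 d1)
  also have "\<dots> = of_real (c - b) * I0"
    using i_c by (simp add: c_def algebra_simps del: of_real_diff flip: of_real_diff)
       (simp add: algebra_simps)
  finally have cb: "c = b" using I0 by (simp add: I0_I1_I2_def)
  have "0 = of_real b * (- 2 * I1) - of_real (Q / 2) * (2 * I0)
      + (LINT y|nu. 2 * I1 * of_real (small_jump y - y) - I0 * of_real (y\<^sup>2))"
    using integrable_levy_op(2)[OF t _ x2] M2 by (simp add: p3 p4 d2)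
  also have "(LINT y|nu. 2 * I1 * of_real (small_jump y - y) - I0 * of_real (y\<^sup>2)) = 2 * I1 * of_real c - I0 * of_real V"
  proof -
    have "integrable nu (\<lambda>y. 2 * I1 * complex_of_real (small_jump y - y))" "integrable nu (\<lambda>y. I0 * complex_of_real (y\<^sup>2))"
      using i_c i_y2 by (auto intro!: integrable_mult_right integrable_of_real simp del: of_real_diff of_real_power)
    then show ?thesis by (simp add: c_def V_def del: of_real_diff of_real_power)
  qed
  \<comment> \<open>With \<open>c = b\<close> the terms in \<open>I1\<close> cancel, leaving a sum
    of two nonnegative numbers.\<close>
  finally have "of_real (Q + V) * I0 = 0" by (simp add: cb algebra_simps)
  then have "Q + V = 0" using I0 by (simp add: I0_I1_I2_def flip: of_real_add)
  moreover have "V \<ge> 0" by (simp add: V_def)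
  ultimately have "Q = 0" "V = 0" using Q_nonneg by auto
  then have "AE y in nu. y\<^sup>2 = 0"
    using integral_nonneg_eq_0_iff_AE[OF i_y2] by (simp add: V_def)
  then have ae: "AE y in nu. y = 0" by simp
  have "c = 0"
    unfolding c_def by (rule integral_eq_zero_AE) (use ae in \<open>auto simp: small_jump_def\<close>)
  moreover have "(LINT y|nu. levy_kernel y \<xi>) = 0"
    by (rule integral_eq_zero_AE) (use ae in \<open>auto simp: small_jump_def levy_kernel_def\<close>)
  ultimately show ?thesis unfolding levy_exponent_eq using cb \<open>Q = 0\<close> by simp
qed

end

section \<open>Convolution and translation estimates\<close>

text \<open>A Peetre-type inequality: submultiplicativity of the weight charges the translation to a
  power of \<open>y\<close> and keeps the full decay in \<open>x\<close>.\<close>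

lemma rapid_shift_bound:
  assumes "rapid k"
  obtains C where "C > 0" "\<And>x y. norm (k (x - y)) \<le> C * weight (real N) y * (1 / (1 + \<bar>x\<bar>) ^ N)"
proof -
  obtain C where C: "\<And>x. norm (k x) * (1 + \<bar>x\<bar>) ^ N \<le> C" using assms unfolding rapid_def by blast
  have "norm (k (x - y)) \<le> (\<bar>C\<bar> + 1) * weight (real N) y * (1 / (1 + \<bar>x\<bar>) ^ N)" for x y
  proof -
    have "(1 + \<bar>x\<bar>) ^ N = weight (real N) ((x - y) + y)" by (simp add: weight_def powr_realpow)
    also have "\<dots> \<le> weight (real N) (x - y) * weight (real N) y" by (rule weight_add) simp
    finally have "norm (k (x - y)) * (1 + \<bar>x\<bar>) ^ N \<le> norm (k (x - y)) * (weight (real N) (x - y) * weight (real N) y)"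
      by (rule mult_left_mono) simp
    also have "\<dots> = (norm (k (x - y)) * (1 + \<bar>x - y\<bar>) ^ N) * weight (real N) y"
      by (simp add: weight_def powr_realpow)
    also have "\<dots> \<le> (\<bar>C\<bar> + 1) * weight (real N) y"
      using C[of "x - y"] by (intro mult_right_mono) auto
    finally show ?thesis by (simp add: pos_le_divide_eq)
  qed
  then show ?thesis by (intro that[of "\<bar>C\<bar> + 1"]) auto
qed

lemma corr_shift: "corr f k a = (LINT x|lborel. f x * k (x - a))"
  using lborel_integral_shift[of "\<lambda>x. f x * k (x - a)" a] by (simp add: corr_def add.commute)

lemma corr_add_left:
  "corr f k (a + b) = (LINT x|lborel. f (a + x) * k (x - b))"
  using lborel_integral_shift[of "\<lambda>x. f (a + x) * k (x - b)" b] by (simp add: corr_def add_ac)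

text \<open>Together with \<open>convolution_fourier\<close> it shows that two successive frequency
  cutoffs act as their product. Shifting before Fubini puts \<open>y\<close> into the kernel, where
  \<open>rapid_shift_bound\<close> separates the variables.\<close>

lemma corr_corr:
  assumes b: "\<beta> \<ge> 0" and f: "poly_bounded \<beta> f" and k: "rapid k" and l: "rapid l"
  shows "corr (corr f k) l a = corr f (\<lambda>x. LINT y|lborel. k (x - y) * l y) a"
proof -
  obtain C where C: "C > 0" "\<And>x. norm (f x) \<le> C * weight \<beta> x" using poly_bounded_bound f by blast
  define N where "N = nat \<lceil>\<beta> + 2\<rceil>"
  have N: "\<beta> + 2 \<le> real N" unfolding N_def by linarith
  obtain K where K: "K > 0" "\<And>x y. norm (k (x - y)) \<le> K * weight (real N) y * (1 / (1 + \<bar>x\<bar>) ^ N)"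
    using rapid_shift_bound[OF k] by blast
  have [measurable]: "f \<in> borel_measurable borel" "k \<in> borel_measurable borel" "l \<in> borel_measurable borel"
    using f k l by measurable
  have "corr (corr f k) l a = (LINT y|lborel. LINT x|lborel. f (a + x) * k (x - y) * l y)"
    unfolding corr_def[of "corr f k"] corr_add_left by simp
  also have "\<dots> = (LINT x|lborel. LINT y|lborel. f (a + x) * k (x - y) * l y)"
  proof (rule lborel_pair.Fubini_integral, rule integrable_pair_dominated)
    show "pair_sigma_finite lborel lborel" ..
    show "integrable lborel (\<lambda>x. C * weight \<beta> a * K * (weight \<beta> x / (1 + \<bar>x\<bar>) ^ N))"
      by (intro integrable_mult_right integrable_weight_decay N)
    show "integrable lborel (\<lambda>y. weight (real N) y * norm (l y))" using rapid_weighted_L1[OF l] by (simp add: weighted_L1_def)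
    show "norm (case (x, y) of (x, y) \<Rightarrow> f (a + x) * k (x - y) * l y)
        \<le> C * weight \<beta> a * K * (weight \<beta> x / (1 + \<bar>x\<bar>) ^ N) * (weight (real N) y * norm (l y))" for x y
    proof -
      have "norm (f (a + x) * k (x - y)) \<le> C * weight \<beta> a * (weight \<beta> x * norm (k (x - y)))"
        using C by (intro corr_pointwise_bound[OF b, where f = f and k = "\<lambda>x. k (x - y)"]) auto
      also have "\<dots> \<le> C * weight \<beta> a * (weight \<beta> x * (K * weight (real N) y * (1 / (1 + \<bar>x\<bar>) ^ N)))"
        using C by (intro mult_left_mono K) auto
      finally have "norm (f (a + x) * k (x - y)) * norm (l y)
          \<le> C * weight \<beta> a * (weight \<beta> x * (K * weight (real N) y * (1 / (1 + \<bar>x\<bar>) ^ N))) * norm (l y)"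
        by (rule mult_right_mono) simp
      then show ?thesis by (simp add: norm_mult mult_ac)
    qed
  qed measurable
  also have "\<dots> = corr f (\<lambda>x. LINT y|lborel. k (x - y) * l y) a"
    by (simp add: corr_def mult.assoc)
  finally show ?thesis .
qed

lemma fourier_inversion_integral:
  assumes "test_function \<phi>"
  shows "(LINT y|lborel. cis (x * y) * fourier \<phi> y) = of_real (2 * pi) * \<phi> x"
  using fourier_inversion_test[OF assms, of x] by (simp add: inv_fourier_def field_simps)

text \<open>Expanding the transform of \<theta> leaves the inversion integral of \<eta> inside; the
  factor \<open>2 * pi\<close> comes from the unnormalised \<open>fourier\<close>.\<close>

lemma convolution_fourier:
  assumes t: "test_function \<theta>" and s: "test_function \<eta>"
  shows "(LINT y|lborel. fourier \<theta> (x - y) * fourier \<eta> y) = of_real (2 * pi) * fourier (\<lambda>\<xi>. \<theta> \<xi> * \<eta> \<xi>) x"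
proof -
  have [measurable]: "\<theta> \<in> borel_measurable borel" "\<eta> \<in> borel_measurable borel" using t s by measurable
  have "(LINT y|lborel. fourier \<theta> (x - y) * fourier \<eta> y)
     = (LINT y|lborel. LINT \<xi>|lborel. cis (- (\<xi> * (x - y))) * \<theta> \<xi> * fourier \<eta> y)"
    by (simp add: fourier_def[of \<theta>])
  also have "\<dots> = (LINT \<xi>|lborel. LINT y|lborel. cis (- (\<xi> * (x - y))) * \<theta> \<xi> * fourier \<eta> y)"
  proof (rule lborel_pair.Fubini_integral, rule integrable_pair_dominated)
    show "pair_sigma_finite lborel lborel" ..
    show "integrable lborel (\<lambda>\<xi>. norm (\<theta> \<xi>))" "integrable lborel (\<lambda>y. norm (fourier \<eta> y))"
      using test_function_integrable[OF t] rapid_integrable[OF rapid_fourier[OF s]] by auto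
  qed (unfold cis_conv_exp, measurable, auto simp: norm_mult)
  also have "\<dots> = (LINT \<xi>|lborel. cis (- (\<xi> * x)) * \<theta> \<xi> * (LINT y|lborel. cis (\<xi> * y) * fourier \<eta> y))"
  proof (rule Bochner_Integration.integral_cong[OF refl])
    fix \<xi>
    have *: "cis (- (\<xi> * (x - y))) = cis (- (\<xi> * x)) * cis (\<xi> * y)" for y
      by (simp add: cis_mult algebra_simps)
    have "(LINT y|lborel. cis (- (\<xi> * (x - y))) * \<theta> \<xi> * fourier \<eta> y)
      = (LINT y|lborel. (cis (- (\<xi> * x)) * \<theta> \<xi>) * (cis (\<xi> * y) * fourier \<eta> y))"
      unfolding * by (simp add: mult_ac)
    then show "(LINT y|lborel. cis (- (\<xi> * (x - y))) * \<theta> \<xi> * fourier \<eta> y)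
      = cis (- (\<xi> * x)) * \<theta> \<xi> * (LINT y|lborel. cis (\<xi> * y) * fourier \<eta> y)" by simp
  qed
  also have "\<dots> = (LINT \<xi>|lborel. of_real (2 * pi) * (cis (- (\<xi> * x)) * (\<theta> \<xi> * \<eta> \<xi>)))"
    unfolding fourier_inversion_integral[OF s] by (simp add: mult_ac)
  finally show ?thesis by (simp add: fourier_def)
qed

lemma fourier_rescale:
  assumes e: "e > 0"
  shows "fourier (\<lambda>\<xi>. \<phi> ((\<xi> - c) / e)) u = of_real e * cis (- (u * c)) * fourier \<phi> (e * u)"
proof -
  have "fourier (\<lambda>\<xi>. \<phi> ((\<xi> - c) / e)) u
     = \<bar>e\<bar> *\<^sub>R (LINT s|lborel. cis (- ((c + e * s) * u)) * \<phi> ((c + e * s - c) / e))"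
    unfolding fourier_def by (rule lborel_integral_real_affine) (use e in simp)
  also have "\<dots> = \<bar>e\<bar> *\<^sub>R (LINT s|lborel. cis (- (u * c)) * (cis (- (s * (e * u))) * \<phi> s))"
  proof -
    have "cis (- ((c + e * s) * u)) = cis (- (u * c)) * cis (- (s * (e * u)))" for s
      by (simp add: cis_mult algebra_simps)
    then show ?thesis using e by (simp add: mult.assoc)
  qed
  finally show ?thesis using e by (simp add: fourier_def scaleR_conv_of_real)
qed

lemma fourier_continuous:
  assumes "test_function \<phi>" shows "isCont (fourier \<phi>) x"
  using fourier_has_derivative[OF assms] has_vector_derivative_continuous by blast

text \<open>Translations act continuously in the weighted norm. A null sequence of shifts is
  bounded, so \<open>rapid_shift_bound\<close> gives one majorant for dominated convergence.\<close>

lemma translation_continuity: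
  assumes b: "\<beta> \<ge> 0" and t: "test_function \<phi>" and h: "h \<longlonglongrightarrow> 0"
  defines "k \<equiv> fourier \<phi>"
  shows "(\<lambda>n. LINT s|lborel. weight \<beta> s * norm (k s - k (s - h n))) \<longlonglongrightarrow> 0"
proof -
  have r: "rapid k" unfolding k_def by (rule rapid_fourier[OF t])
  have [measurable]: "k \<in> borel_measurable borel" using r by measurable
  define N where "N = nat \<lceil>\<beta> + 2\<rceil>"
  have N: "\<beta> + 2 \<le> real N" unfolding N_def by linarith
  obtain K where K: "K > 0" "\<And>x y. norm (k (x - y)) \<le> K * weight (real N) y * (1 / (1 + \<bar>x\<bar>) ^ N)"
    using rapid_shift_bound[OF r] by blast
  obtain B where B: "\<And>n. \<bar>h n\<bar> \<le> B"
    using convergent_imp_Bseq[of h] h unfolding convergent_def Bseq_def by auto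
  define K' where "K' = K * weight (real N) 0 + K * weight (real N) B"
  have "(\<lambda>n. LINT s|lborel. weight \<beta> s * norm (k s - k (s - h n))) \<longlonglongrightarrow> (LINT s|lborel. weight \<beta> s * norm (k s - k (s - 0)))"
  proof (rule integral_dominated_convergence)
    show "integrable lborel (\<lambda>s. K' * (weight \<beta> s / (1 + \<bar>s\<bar>) ^ N))"
      by (intro integrable_mult_right integrable_weight_decay N)
    show "AE s in lborel. (\<lambda>n. weight \<beta> s * norm (k s - k (s - h n))) \<longlonglongrightarrow> weight \<beta> s * norm (k s - k (s - 0))"
      unfolding k_def
      by (intro AE_I2 tendsto_intros isCont_tendsto_compose[OF fourier_continuous[OF t]] h)
    show "AE s in lborel. norm (weight \<beta> s * norm (k s - k (s - h n))) \<le> K' * (weight \<beta> s / (1 + \<bar>s\<bar>) ^ N)" for n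
    proof (rule AE_I2)
      fix s
      have "weight (real N) (h n) \<le> weight (real N) B" using B[of n] by (intro weight_mono) auto
      then have "K * weight (real N) (h n) * (1 / (1 + \<bar>s\<bar>) ^ N) \<le> K * weight (real N) B * (1 / (1 + \<bar>s\<bar>) ^ N)"
        using K by (intro mult_right_mono mult_left_mono) auto
      then have "norm (k s - k (s - h n)) \<le> K' * (1 / (1 + \<bar>s\<bar>) ^ N)"
        using norm_triangle_ineq4[of "k s" "k (s - h n)"] K(2)[of s 0] K(2)[of s "h n"]
        unfolding K'_def distrib_right by simp
      then have "weight \<beta> s * norm (k s - k (s - h n)) \<le> weight \<beta> s * (K' * (1 / (1 + \<bar>s\<bar>) ^ N))"
        by (rule mult_left_mono) simp
      then show "norm (weight \<beta> s * norm (k s - k (s - h n))) \<le> K' * (weight \<beta> s / (1 + \<bar>s\<bar>) ^ N)"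
        by (simp add: mult_ac)
    qed
  qed measurable
  then show ?thesis by simp
qed

text \<open>The growth in \<open>h\<close> is that of the weight. This provides the majorant with
  which \<open>local_vanish\<close> passes to the limit under an integral against
  \<open>levy_op \<phi>\<close>.\<close>

lemma translation_bound:
  assumes b: "\<beta> \<ge> 0" and r: "weighted_L1 \<beta> k"
  shows "(LINT s|lborel. weight \<beta> s * norm (k s - k (s - h))) \<le> 2 * weight \<beta> h * (LINT s|lborel. weight \<beta> s * norm (k s))"
    and "integrable lborel (\<lambda>s. weight \<beta> s * norm (k s - k (s - h)))"
proof -
  have [measurable]: "k \<in> borel_measurable borel" using r by measurable
  have i: "integrable lborel (\<lambda>s. weight \<beta> s * norm (k s))" using r by (simp add: weighted_L1_def)
  have i': "integrable lborel (\<lambda>s. weight \<beta> (s - h) * norm (k (s - h)))"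
    using lborel_integrable_real_affine[OF i, of 1 "- h"] by simp
  have sh: "(LINT s|lborel. weight \<beta> (s - h) * norm (k (s - h))) = (LINT s|lborel. weight \<beta> s * norm (k s))"
    using lborel_integral_shift[of "\<lambda>s. weight \<beta> (s - h) * norm (k (s - h))" h] by simp
  have ib: "integrable lborel (\<lambda>s. weight \<beta> h * (weight \<beta> s * norm (k s)) + weight \<beta> h * (weight \<beta> (s - h) * norm (k (s - h))))"
    using i i' by simp
  have bd: "weight \<beta> s * norm (k s - k (s - h)) \<le> weight \<beta> h * (weight \<beta> s * norm (k s)) + weight \<beta> h * (weight \<beta> (s - h) * norm (k (s - h)))" for s
  proof -
    have "weight \<beta> s * norm (k s - k (s - h)) \<le> weight \<beta> s * norm (k s) + weight \<beta> s * norm (k (s - h))"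
      using norm_triangle_ineq4[of "k s" "k (s - h)"] by (simp flip: distrib_left)
    also have "\<dots> \<le> weight \<beta> h * (weight \<beta> s * norm (k s)) + (weight \<beta> (s - h) * weight \<beta> h) * norm (k (s - h))"
      using mult_right_mono[OF weight_ge_1[OF b, of h], of "weight \<beta> s * norm (k s)"] weight_add[OF b, of "s - h" h]
      by (intro add_mono mult_right_mono) simp_all
    finally show ?thesis by (simp add: mult_ac)
  qed
  show i2: "integrable lborel (\<lambda>s. weight \<beta> s * norm (k s - k (s - h)))"
    by (rule Bochner_Integration.integrable_bound[OF ib]) (use bd in \<open>auto intro!: AE_I2 order_trans[OF _ abs_ge_self]\<close>)
  have "(LINT s|lborel. weight \<beta> s * norm (k s - k (s - h)))
     \<le> (LINT s|lborel. weight \<beta> h * (weight \<beta> s * norm (k s)) + weight \<beta> h * (weight \<beta> (s - h) * norm (k (s - h))))"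
    by (rule integral_mono[OF i2 ib bd])
  also have "\<dots> = 2 * weight \<beta> h * (LINT s|lborel. weight \<beta> s * norm (k s))"
    using i i' by (simp add: sh)
  finally show "(LINT s|lborel. weight \<beta> s * norm (k s - k (s - h))) \<le> 2 * weight \<beta> h * (LINT s|lborel. weight \<beta> s * norm (k s))" .
qed

text \<open>The substitution in \<open>corr_add_left\<close> puts the shift into the kernel, so
  \<open>f\<close> needs no regularity. For shifts of size at most 1 the Taylor remainder of the
  kernel keeps its decay in \<open>x\<close>.\<close>

lemma corr_fourier_has_derivative:
  assumes b: "\<beta> \<ge> 0" and f: "poly_bounded \<beta> f" and t: "test_function \<theta>"
  shows "(corr f (fourier \<theta>) has_vector_derivative corr f (fourier (\<lambda>\<xi>. \<i> * of_real \<xi> * \<theta> \<xi>)) a) (at a)"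
proof -
  define k where "k = fourier \<theta>"
  define k' where "k' = fourier (\<lambda>\<xi>. - \<i> * of_real \<xi> * \<theta> \<xi>)"
  define k'' where "k'' = fourier (\<lambda>\<xi>. - \<i> * of_real \<xi> * (- \<i> * of_real \<xi> * \<theta> \<xi>))"
  have t': "test_function (\<lambda>\<xi>. - \<i> * of_real \<xi> * \<theta> \<xi>)"
    and t'': "test_function (\<lambda>\<xi>. - \<i> * of_real \<xi> * (- \<i> * of_real \<xi> * \<theta> \<xi>))"
    by (intro test_function_mult_id t)+
  have d: "(k has_vector_derivative k' s) (at s)" "(k' has_vector_derivative k'' s) (at s)" for s
    unfolding k_def k'_def k''_def by (intro fourier_has_derivative t t')+
  have r: "rapid k" "rapid k'" "rapid k''"
    unfolding k_def k'_def k''_def by (intro rapid_fourier t t' t'')+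
  \<comment> \<open>The shift enters the kernel as \<open>x - h\<close>, so the derivative of the
    correlation carries the kernel \<open>- k'\<close>.\<close>
  have neg: "fourier (\<lambda>\<xi>. \<i> * of_real \<xi> * \<theta> \<xi>) = (\<lambda>x. - k' x)"
    using fourier_cmult[of "-1" "\<lambda>\<xi>. - \<i> * of_real \<xi> * \<theta> \<xi>"] by (auto simp: k'_def)
  define N where "N = nat \<lceil>\<beta> + 2\<rceil>"
  have N: "\<beta> + 2 \<le> real N" unfolding N_def by linarith
  obtain K where K: "K > 0" "\<And>x y. norm (k'' (x - y)) \<le> K * weight (real N) y * (1 / (1 + \<bar>x\<bar>) ^ N)"
    using rapid_shift_bound[OF r(3)] by blast
  obtain C where C: "C > 0" "\<And>x. norm (f x) \<le> C * weight \<beta> x" using poly_bounded_bound f by blast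
  have Lk: "weighted_L1 \<beta> k" "weighted_L1 \<beta> k'" by (intro rapid_weighted_L1 r)+
  define A where "A = (LINT x|lborel. C * weight \<beta> a * (K * weight (real N) 1) * (weight \<beta> x / (1 + \<bar>x\<bar>) ^ N))"
  show ?thesis
    unfolding neg k_def[symmetric]
  proof (rule has_vector_derivative_quadratic[where M = A])
    fix h :: real assume h: "\<bar>h\<bar> \<le> 1"
    have i1: "integrable lborel (\<lambda>x. f (a + x) * k (x - h))"
      using lborel_integrable_real_affine[OF corr_integrable[OF b f Lk(1), of "a + h"], of 1 "- h"] by simp
    have i: "integrable lborel (\<lambda>x. f (a + x) * k x)" "integrable lborel (\<lambda>x. f (a + x) * k' x)"
      by (intro corr_integrable[OF b f] Lk)+
    have eq: "corr f k (a + h) - corr f k a - h *\<^sub>R corr f (\<lambda>x. - k' x) a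
       = (LINT x|lborel. f (a + x) * k (x - h) - f (a + x) * k x - h *\<^sub>R (- (f (a + x) * k' x)))"
      using i i1 by (simp add: corr_add_left) (simp add: corr_def)
    have "norm (corr f k (a + h) - corr f k a - h *\<^sub>R corr f (\<lambda>x. - k' x) a) \<le> (LINT x|lborel. h\<^sup>2 * (C * weight \<beta> a * (K * weight (real N) 1) * (weight \<beta> x / (1 + \<bar>x\<bar>) ^ N)))"
      unfolding eq
    proof (rule Bochner_Integration.integral_norm_bound_integral)
      show "integrable lborel (\<lambda>x. f (a + x) * k (x - h) - f (a + x) * k x - h *\<^sub>R (- (f (a + x) * k' x)))"
        by (intro Bochner_Integration.integrable_diff integrable_scaleR_right Bochner_Integration.integrable_minus i i1)
      show "integrable lborel (\<lambda>x. h\<^sup>2 * (C * weight \<beta> a * (K * weight (real N) 1) * (weight \<beta> x / (1 + \<bar>x\<bar>) ^ N)))"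
        using integrable_weight_decay[OF N] by (simp del: times_divide_eq_right)
      fix x
      have "norm (k (x + - h) - k x - (- h) *\<^sub>R k' x) \<le> (K * weight (real N) 1 * (1 / (1 + \<bar>x\<bar>) ^ N)) * (- h)\<^sup>2"
      proof (rule taylor2_bound[OF d])
        fix s assume s: "\<bar>s - x\<bar> \<le> \<bar>- h\<bar>"
        have "norm (k'' (x - (x - s))) \<le> K * weight (real N) (x - s) * (1 / (1 + \<bar>x\<bar>) ^ N)" by (rule K)
        also have "\<dots> \<le> K * weight (real N) 1 * (1 / (1 + \<bar>x\<bar>) ^ N)"
          using s h K by (intro mult_right_mono mult_left_mono weight_mono) auto
        finally show "norm (k'' s) \<le> K * weight (real N) 1 * (1 / (1 + \<bar>x\<bar>) ^ N)" by simp
      qed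
      then have *: "norm (k (x - h) - k x + h *\<^sub>R k' x) \<le> h\<^sup>2 * (K * weight (real N) 1 * (1 / (1 + \<bar>x\<bar>) ^ N))"
        by (simp add: mult.commute)
      have "f (a + x) * k (x - h) - f (a + x) * k x - h *\<^sub>R (- (f (a + x) * k' x))
        = f (a + x) * (k (x - h) - k x + h *\<^sub>R k' x)"
        by (simp add: algebra_simps)
      then have "norm (f (a + x) * k (x - h) - f (a + x) * k x - h *\<^sub>R (- (f (a + x) * k' x)))
        = norm (f (a + x) * (\<lambda>x. k (x - h) - k x + h *\<^sub>R k' x) x)" by simp
      also have "\<dots> \<le> C * weight \<beta> a * (weight \<beta> x * norm ((\<lambda>x. k (x - h) - k x + h *\<^sub>R k' x) x))"
        using C by (intro corr_pointwise_bound b) auto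
      also have "\<dots> \<le> C * weight \<beta> a * (weight \<beta> x * (h\<^sup>2 * (K * weight (real N) 1 * (1 / (1 + \<bar>x\<bar>) ^ N))))"
        using C * by (intro mult_left_mono) auto
      finally show "norm (f (a + x) * k (x - h) - f (a + x) * k x - h *\<^sub>R (- (f (a + x) * k' x)))
        \<le> h\<^sup>2 * (C * weight \<beta> a * (K * weight (real N) 1) * (weight \<beta> x / (1 + \<bar>x\<bar>) ^ N))"
        by (simp add: mult_ac)
    qed
    also have "\<dots> = h\<^sup>2 * A" unfolding A_def by (rule integral_mult_right_zero)
    also have "\<dots> = A * h\<^sup>2" by (rule mult.commute)
    finally show "norm (corr f k (a + h) - corr f k a - h *\<^sub>R corr f (\<lambda>x. - k' x) a) \<le> A * h\<^sup>2" .
  qed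
qed

lemma corr_fourier_add:
  assumes b: "\<beta> \<ge> 0" and f: "poly_bounded \<beta> f" and t: "test_function \<theta>" "test_function \<eta>"
  shows "corr f (fourier (\<lambda>\<xi>. \<theta> \<xi> + \<eta> \<xi>)) a = corr f (fourier \<theta>) a + corr f (fourier \<eta>) a"
proof -
  have "fourier (\<lambda>\<xi>. \<theta> \<xi> + \<eta> \<xi>) = (\<lambda>x. fourier \<theta> x + fourier \<eta> x)"
    using t by (auto simp: fourier_add test_function_integrable)
  then show ?thesis
    using corr_integrable[OF b f rapid_weighted_L1[OF rapid_fourier[OF t(1)]], of a]
      corr_integrable[OF b f rapid_weighted_L1[OF rapid_fourier[OF t(2)]], of a]
    by (simp add: corr_def ring_distribs)
qed

section \<open>From vanishing integrals to vanishing almost everywhere\<close>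

lemma borel_greaterThan_sets: "sets (borel :: real measure) = sigma_sets UNIV (range greaterThan)"
  by (subst borel_Ioi) simp

text \<open>Half-lines form an intersection-stable generator of the Borel sets, and the sets over
  which \<open>v\<close> integrates to 0 form a Dynkin system; the vanishing total integral handles
  complements.\<close>

lemma AE_zero_of_integrals_greaterThan:
  fixes v :: "real \<Rightarrow> complex"
  assumes v: "integrable lborel v" and 0: "(LINT x|lborel. v x) = 0"
    and p: "\<And>p. (LINT x:{p<..}|lborel. v x) = 0"
  shows "AE x in lborel. v x = 0"
proof (rule sigma_finite_measure.density_zero[OF lborel.sigma_finite_measure_axioms v])
  fix A :: "real set" assume "A \<in> sets lborel"
  then have A: "A \<in> sigma_sets UNIV (range greaterThan)" by (simp add: borel_greaterThan_sets)
  have st: "Int_stable (range (greaterThan :: real \<Rightarrow> real set))"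
  proof -
    have "{a<..} \<inter> {b<..} = {max a b<..}" for a b :: real by auto
    then show ?thesis by (auto simp: Int_stable_def)
  qed
  have vs: "set_integrable lborel S v" if "S \<in> sets borel" for S
    using that v by (auto simp: set_integrable_def intro!: integrable_mult_indicator)
  have bs: "S \<in> sets borel" if "S \<in> sigma_sets UNIV (range (greaterThan :: real \<Rightarrow> real set))" for S
    using that by (simp add: borel_greaterThan_sets)
  show "(LINT x:A|lborel. v x) = 0"
  proof (induction rule: sigma_sets_induct_disjoint[OF st _ A, consumes 0, case_names sub basic empty compl union])
    case (basic A)
    then show ?case using p by auto
  next
    case (compl A)
    have "(LINT x:A|lborel. v x) + (LINT x:(UNIV - A)|lborel. v x) = (LINT x:(A \<union> (UNIV - A))|lborel. v x)"
      using bs[OF compl(1)] by (intro set_integral_Un[symmetric] vs) auto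
    then show ?case using compl 0 by (simp add: set_lebesgue_integral_def)
  next
    case (union A)
    have Ab: "A i \<in> sets borel" for i using union(2) by (intro bs) auto
    then have UA: "(\<Union>i. A i) \<in> sets borel" by auto
    have "(LINT x:(\<Union>i. A i)|lborel. v x) = (\<Sum>i. (LINT x:(A i)|lborel. v x))"
      by (rule lebesgue_integral_countable_add)
         (use union Ab vs[OF UA] in \<open>auto simp: disjoint_family_on_def\<close>)
    then show ?case using union by simp
  qed (auto simp: set_lebesgue_integral_def)
qed

text \<open>Localising to \<open>{- real n..real n}\<close> makes \<open>u\<close> integrable, so
  the half-line criterion applies for each \<open>n\<close>.\<close>

lemma AE_zero_of_interval_integrals:
  fixes u :: "real \<Rightarrow> complex"
  assumes u: "\<And>p q. set_integrable lborel {p..q} u" and 0: "\<And>p q. p \<le> q \<Longrightarrow> (LINT x:{p..q}|lborel. u x) = 0"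
  shows "AE x in lborel. u x = 0"
proof -
  have "AE x in lborel. indicator {- real n..real n} x *\<^sub>R u x = 0" for n
  proof (rule AE_zero_of_integrals_greaterThan)
    show "integrable lborel (\<lambda>x. indicator {- real n..real n} x *\<^sub>R u x)"
      using u by (simp add: set_integrable_def)
    show "(LINT x|lborel. indicator {- real n..real n} x *\<^sub>R u x) = 0"
      using 0[of "- real n" "real n"] by (simp add: set_lebesgue_integral_def)
    fix p :: real
    have "(LINT x:{p<..}|lborel. indicator {- real n..real n} x *\<^sub>R u x)
       = (LINT x:{max p (- real n)..real n}|lborel. u x)"
      unfolding set_lebesgue_integral_def
    proof (rule integral_cong_AE)
      \<comment> \<open>The closed interval may contain \<open>p\<close> itself, a null set.\<close>
      show "AE x in lborel. indicator {p<..} x *\<^sub>R indicator {- real n..real n} x *\<^sub>R u x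
         = indicator {max p (- real n)..real n} x *\<^sub>R u x"
        using AE_lborel_singleton[of p] by eventually_elim (auto simp: indicator_def)
      show "(\<lambda>x. indicator {max p (- real n)..real n} x *\<^sub>R u x) \<in> borel_measurable lborel"
        "(\<lambda>x. indicator {p<..} x *\<^sub>R indicator {- real n..real n} x *\<^sub>R u x) \<in> borel_measurable lborel"
        using u[unfolded set_integrable_def, THEN borel_measurable_integrable]
        by (auto intro!: borel_measurable_scaleR borel_measurable_indicator simp del: scaleR_scaleR)
    qed
    also have "\<dots> = 0"
      using 0[of "max p (- real n)" "real n"]
      by (cases "max p (- real n) \<le> real n") (auto simp: set_lebesgue_integral_def)
    finally show "(LINT x:{p<..}|lborel. indicator {- real n..real n} x *\<^sub>R u x) = 0" .
  qed
  then have "AE x in lborel. \<forall>n. indicator {- real n..real n} x *\<^sub>R u x = 0"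
    unfolding AE_all_countable by blast
  then show ?thesis
  proof eventually_elim
    case (elim x)
    obtain n where "\<bar>x\<bar> \<le> real n" using real_arch_simple by blast
    then show ?case using elim[rule_format, of n] by (auto simp: indicator_def abs_le_iff split: if_splits)
  qed
qed

section \<open>Frequencies away from the origin\<close>

text \<open>Here \<open>f\<close> is Borel with a bound at every point, and the equation is phrased
  with \<open>levy_op\<close>. The final theorem reduces to this setting by changing the solution on
  a null set.\<close>

locale levy_solution = levy +
  fixes f :: "real \<Rightarrow> complex"
  assumes poly_bounded_f: "poly_bounded \<beta> f"
    and solution: "test_function \<phi> \<Longrightarrow> (LINT x|lborel. f x * levy_op \<phi> x) = 0"
    and zeros: "levy_exponent b Q nu \<xi> = 0 \<longleftrightarrow> \<xi> = 0"
begin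

lemma corr_levy_op: "test_function \<phi> \<Longrightarrow> corr f (levy_op \<phi>) = (\<lambda>_. 0)"
  unfolding corr_shift using solution[OF test_function_shift] by (auto simp: levy_op_shift)

text \<open>Operations commuting with translations commute with each other, so every
  frequency-localised version of \<open>f\<close> solves the same equation.\<close>

lemma corr_fourier_levy_op:
  assumes "test_function \<theta>" "test_function \<phi>"
  shows "corr (corr f (fourier \<theta>)) (levy_op \<phi>) a = 0"
proof -
  have "corr (corr f (fourier \<theta>)) (levy_op \<phi>) = corr (corr f (levy_op \<phi>)) (fourier \<theta>)"
    by (intro corr_commute[OF beta poly_bounded_f] rapid_weighted_L1 rapid_fourier weighted_L1_levy_op assms)
  then show ?thesis by (simp add: corr_levy_op assms corr_def)
qed

lemma corr_fourier_poly_bounded: "test_function \<theta> \<Longrightarrow> poly_bounded \<beta> (corr f (fourier \<theta>))"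
  by (intro poly_bounded_corr beta poly_bounded_f rapid_weighted_L1 rapid_fourier)

text \<open>A reproducing formula: a cutoff \<eta> equal to 1 wherever \<theta> is nonzero acts on
  the frequencies selected by \<theta> as multiplication by \<open>2 * pi\<close>.\<close>

lemma corr_corr_fourier:
  assumes "test_function \<theta>" "test_function \<eta>" "\<And>\<xi>. \<theta> \<xi> * \<eta> \<xi> = \<theta> \<xi>"
  shows "corr (corr f (fourier \<theta>)) (fourier \<eta>) a = of_real (2 * pi) * corr f (fourier \<theta>) a"
proof -
  have "corr (corr f (fourier \<theta>)) (fourier \<eta>) a = (LINT x|lborel. of_real (2 * pi) * (f (a + x) * fourier \<theta> x))"
    unfolding corr_corr[OF beta poly_bounded_f rapid_fourier[OF assms(1)] rapid_fourier[OF assms(2)]]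
      convolution_fourier[OF assms(1,2)] assms(3)
    by (simp add: corr_def mult_ac)
  also have "\<dots> = of_real (2 * pi) * corr f (fourier \<theta>) a"
    unfolding corr_def by (rule integral_mult_right_zero)
  finally show ?thesis .
qed

text \<open>Modulating the bump moves the question to frequency 0, where the transform is the
  integral of a nonnegative function that is positive on an interval.\<close>

lemma exists_fourier_nonzero: "\<exists>\<phi>. test_function \<phi> \<and> fourier \<phi> \<eta> \<noteq> 0"
proof (intro exI conjI)
  show "test_function (\<lambda>x. cis (\<eta> * x) * of_real (bump x))"
    by (intro test_function_mult test_function_bump smooth_cis)
  have eq: "cis (- (x * \<eta>)) * (cis (\<eta> * x) * of_real (bump x)) = complex_of_real (bump x)" for x
    unfolding mult.assoc[symmetric] cis_mult by (simp add: mult.commute)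
  have "fourier (\<lambda>x. cis (\<eta> * x) * of_real (bump x)) \<eta> = of_real (LINT x|lborel. bump x)"
    unfolding fourier_def eq by simp
  moreover have "(LINT x|lborel. bump x) \<noteq> 0"
  proof
    have i: "integrable lborel bump"
      using integrable_Re[OF test_function_integrable[OF test_function_bump]] by simp
    assume "(LINT x|lborel. bump x) = 0"
    then have "AE x in lborel. bump x = 0"
      using integral_nonneg_eq_0_iff_AE[OF i] bump_nonneg by simp
    then have "AE x in lborel. x \<notin> {0<..<1::real}"
      by eventually_elim (use bump_pos in force)
    then have "{0<..<1::real} \<in> null_sets lborel"
      by (subst AE_iff_null_sets) auto
    then show False by (simp add: null_sets_def)
  qed
  ultimately show "fourier (\<lambda>x. cis (\<eta> * x) * of_real (bump x)) \<eta> \<noteq> 0" by simp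
qed

text \<open>Wiener's local argument. On frequencies near \<open>\<xi>0\<close> the equation nearly reads \<open>\<gamma> F = 0\<close> with
  \<open>\<gamma> \<noteq> 0\<close>. Measuring \<open>F\<close> against the rescaled weight \<open>weight \<beta> (\<epsilon> a)\<close>, which is equivalent to
  \<open>weight \<beta> a\<close>, makes the error a strict contraction for small \<open>\<epsilon>\<close>.\<close>

lemma local_vanish:
  assumes x0: "\<xi>0 \<noteq> 0"
  obtains \<epsilon> where "\<epsilon> > 0"
    "\<And>\<theta> a. test_function \<theta> \<Longrightarrow> (\<And>\<xi>. \<bar>\<xi> - \<xi>0\<bar> > \<epsilon> \<Longrightarrow> \<theta> \<xi> = 0) \<Longrightarrow> corr f (fourier \<theta>) a = 0"
proof -
  obtain \<phi> where t: "test_function \<phi>" and p0: "fourier \<phi> (- \<xi>0) \<noteq> 0"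
    using exists_fourier_nonzero by blast
  define g where "g = levy_op \<phi>"
  have g: "weighted_L1 \<beta> g" unfolding g_def by (rule weighted_L1_levy_op[OF t])
  have [measurable]: "g \<in> borel_measurable borel" using g by measurable
  define \<gamma> where "\<gamma> = (LINT y|lborel. cis (y * \<xi>0) * g y)"
  \<comment> \<open>\<open>fourier_levy_op\<close> turns this into
    \<open>levy_exponent b Q nu \<xi>0 * fourier \<phi> (- \<xi>0)\<close>.\<close>
  have "\<gamma> = fourier g (- \<xi>0)" by (simp add: \<gamma>_def fourier_def)
  then have \<gamma>: "\<gamma> \<noteq> 0" using p0 x0 zeros by (simp add: g_def fourier_levy_op t)
  define k where "k = fourier cutoff"
  have rk: "rapid k" unfolding k_def by (rule rapid_fourier[OF test_function_cutoff])
  have [measurable]: "k \<in> borel_measurable borel" using rk by measurable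
  \<comment> \<open>The modulus of continuity of translations of \<open>k\<close> in the weighted
    norm.\<close>
  define j where "j h = (LINT s|lborel. weight \<beta> s * norm (k s - k (s - h)))" for h
  have j_meas [measurable]: "j \<in> borel_measurable borel" unfolding j_def by measurable
  define A where "A = (LINT s|lborel. weight \<beta> s * norm (k s))"
  have A: "A \<ge> 0" unfolding A_def by simp
  have j0: "j h \<ge> 0" for h unfolding j_def by simp
  have j_bound: "j h \<le> 2 * weight \<beta> h * A" for h
    unfolding j_def A_def by (rule translation_bound[OF beta rapid_weighted_L1[OF rk]])
  have ij: "integrable lborel (\<lambda>s. weight \<beta> s * norm (k s - k (s - h)))" for h
    by (rule translation_bound[OF beta rapid_weighted_L1[OF rk]])
  have wg: "integrable lborel (\<lambda>y. norm (g y) * (2 * weight \<beta> y * A))"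
    using g unfolding weighted_L1_def by (simp add: mult_ac)
  have gj_bound: "norm (norm (g y) * j (e * y)) \<le> norm (g y) * (2 * weight \<beta> y * A)" if "0 < e" "e \<le> 1" for e y
  proof -
    have "\<bar>e * y\<bar> \<le> \<bar>y\<bar>" using that by (simp add: abs_mult mult_left_le_one_le)
    then have "weight \<beta> (e * y) \<le> weight \<beta> y" by (intro weight_mono beta)
    then have "j (e * y) \<le> 2 * weight \<beta> y * A" using j_bound[of "e * y"] A
      by (meson mult_left_mono mult_right_mono order_trans zero_le_numeral)
    then show ?thesis using j0 by (simp add: mult_left_mono)
  qed
  have gj: "integrable lborel (\<lambda>y. norm (g y) * j (e * y))" if "0 < e" "e \<le> 1" for e
    by (rule Bochner_Integration.integrable_bound[OF wg])
       (use gj_bound[OF that] in \<open>auto intro!: AE_I2 order_trans[OF _ abs_ge_self]\<close>)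
  define e where "e n = 1 / (1 + real n)" for n
  have e: "0 < e n" "e n \<le> 1" for n by (auto simp: e_def)
  have e_lim: "e \<longlonglongrightarrow> 0" unfolding e_def by real_asymp
  have "(\<lambda>n. LINT y|lborel. norm (g y) * j (e n * y)) \<longlonglongrightarrow> (LINT y|lborel. norm (g y) * 0)"
  proof (rule integral_dominated_convergence[OF _ _ wg])
    show "AE y in lborel. (\<lambda>n. norm (g y) * j (e n * y)) \<longlonglongrightarrow> norm (g y) * 0"
    proof (intro AE_I2 tendsto_intros)
      fix y
      have "(\<lambda>n. e n * y) \<longlonglongrightarrow> 0" using tendsto_mult_left_zero[OF e_lim] by simp
      then show "(\<lambda>n. j (e n * y)) \<longlonglongrightarrow> 0"
        unfolding j_def k_def by (rule translation_continuity[OF beta test_function_cutoff])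
    qed
    show "AE y in lborel. norm (norm (g y) * j (e n * y)) \<le> norm (g y) * (2 * weight \<beta> y * A)" for n
      using gj_bound[OF e] by simp
  qed measurable
  \<comment> \<open>Half of \<open>2 * pi * norm \<gamma>\<close>, the coefficient of
    \<open>norm (F a)\<close> in the main estimate; hence the contraction factor 1/2.\<close>
  moreover have "pi * norm \<gamma> > 0" using \<gamma> by simp
  ultimately have "\<forall>\<^sub>F n in sequentially. (LINT y|lborel. norm (g y) * j (e n * y)) < pi * norm \<gamma>"
    by (intro order_tendstoD(2)) auto
  then obtain n where J: "(LINT y|lborel. norm (g y) * j (e n * y)) < pi * norm \<gamma>"
    by (auto simp: eventually_sequentially)
  \<comment> \<open>Fixed before \<theta> is introduced, so one window serves every \<theta>
    supported in it.\<close>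
  define \<epsilon> where "\<epsilon> = e n"
  have \<epsilon>: "0 < \<epsilon>" "\<epsilon> \<le> 1" unfolding \<epsilon>_def by (rule e)+
  show thesis
  proof (rule that[OF \<epsilon>(1)])
    fix \<theta> a assume th: "test_function \<theta>" and supp: "\<And>\<xi>. \<bar>\<xi> - \<xi>0\<bar> > \<epsilon> \<Longrightarrow> \<theta> \<xi> = 0"
    define \<eta> where "\<eta> \<xi> = cutoff ((\<xi> - \<xi>0) / \<epsilon>)" for \<xi>
    have eta: "test_function \<eta>"
      using test_function_affine[OF test_function_cutoff, of "1 / \<epsilon>" "- \<xi>0 / \<epsilon>"] \<epsilon>
      by (simp add: \<eta>_def[abs_def] diff_divide_distrib)
    define F where "F = corr f (fourier \<theta>)"
    have PF: "poly_bounded \<beta> F" unfolding F_def by (rule corr_fourier_poly_bounded[OF th])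
    define K where "K = fourier \<eta>"
    have K_eq: "K u = of_real \<epsilon> * cis (- (u * \<xi>0)) * k (\<epsilon> * u)" for u
      unfolding K_def \<eta>_def k_def by (rule fourier_rescale[OF \<epsilon>(1)])
    have LK: "weighted_L1 \<beta> K" unfolding K_def by (rule rapid_weighted_L1[OF rapid_fourier[OF eta]])
    have "\<theta> \<xi> * \<eta> \<xi> = \<theta> \<xi>" for \<xi>
    proof (cases "\<bar>\<xi> - \<xi>0\<bar> > \<epsilon>")
      case False
      then have "\<bar>(\<xi> - \<xi>0) / \<epsilon>\<bar> \<le> 1" using \<epsilon> by (simp add: abs_divide)
      then show ?thesis by (simp add: \<eta>_def cutoff_1)
    qed (simp add: supp)
    then have FK: "corr F K a = of_real (2 * pi) * F a" for a
      unfolding F_def K_def by (intro corr_corr_fourier th eta)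
    have Fg: "corr F g a = 0" for a unfolding F_def g_def by (rule corr_fourier_levy_op[OF th t])
    have contraction: "norm (F a) \<le> (B / 2) * weight \<beta> (\<epsilon> * a)"
      if B: "B \<ge> 0" "\<And>a. norm (F a) \<le> B * weight \<beta> (\<epsilon> * a)" for B a
    proof -
      have iF: "integrable lborel (\<lambda>y. F (a + y) * g y)" by (rule corr_integrable[OF beta PF g])
      have ig: "integrable lborel (\<lambda>y. cis (y * \<xi>0) * g y)"
      proof (rule integrable_cis_mult)
        have "norm (g y) \<le> norm (weight \<beta> y * norm (g y))" for y
          using mult_right_mono[OF weight_ge_1[OF beta, of y], of "norm (g y)"] by (simp add: abs_mult)
        then have bd: "AE y in lborel. norm (g y) \<le> norm (weight \<beta> y * norm (g y))" by (rule AE_I2)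
        have "integrable lborel (\<lambda>y. weight \<beta> y * norm (g y))" using g by (simp add: weighted_L1_def)
        then show "integrable lborel g"
          by (rule Bochner_Integration.integrable_bound[OF _ _ bd]) simp
      qed simp
      \<comment> \<open>Subtracting the equation \<open>corr F g a = 0\<close> compares
        \<open>F (a + y)\<close> with the pure wave \<open>cis (y * \<xi>0) * F a\<close>.\<close>
      have "of_real (2 * pi) * (\<gamma> * F a) = of_real (2 * pi) * F a * \<gamma>" by (simp only: mult_ac)
      also have "\<dots> = (LINT y|lborel. of_real (2 * pi) * F a * (cis (y * \<xi>0) * g y))"
        unfolding \<gamma>_def by (rule integral_mult_right_zero[symmetric])
      also have "\<dots> = (LINT y|lborel. of_real (2 * pi) * F a * (cis (y * \<xi>0) * g y))
          - of_real (2 * pi) * corr F g a" by (simp add: Fg)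
      also have "\<dots> = (LINT y|lborel. of_real (2 * pi) * F a * (cis (y * \<xi>0) * g y)
          - of_real (2 * pi) * (F (a + y) * g y))"
        unfolding corr_def using ig iF by simp
      finally have eq: "of_real (2 * pi) * (\<gamma> * F a) = (LINT y|lborel. of_real (2 * pi) * F a * (cis (y * \<xi>0) * g y)
          - of_real (2 * pi) * (F (a + y) * g y))" .
      have pt: "norm (of_real (2 * pi) * F a * (cis (y * \<xi>0) * g y) - of_real (2 * pi) * (F (a + y) * g y))
          \<le> B * weight \<beta> (\<epsilon> * a) * (norm (g y) * j (\<epsilon> * y))" for y
      proof -
        have iK: "integrable lborel (\<lambda>u. F (a + u) * K u)" by (rule corr_integrable[OF beta PF LK])
        have iK': "integrable lborel (\<lambda>u. F (a + u) * K (u - y))"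
          using lborel_integrable_real_affine[OF corr_integrable[OF beta PF LK, of "a + y"], of 1 "- y"] by simp
        \<comment> \<open>Both values of \<open>F\<close> are reproduced through \<open>K\<close>.
          The phases in \<open>K\<close> match the wave factor, and what is left is the change of
          \<open>k\<close> under translation by \<open>\<epsilon> * y\<close>.\<close>
        have "of_real (2 * pi) * F a * cis (y * \<xi>0) - of_real (2 * pi) * F (a + y)
           = cis (y * \<xi>0) * corr F K a - corr F K (a + y)" by (simp add: FK)
        also have "\<dots> = (LINT u|lborel. cis (y * \<xi>0) * (F (a + u) * K u) - F (a + u) * K (u - y))"
          unfolding corr_add_left using iK iK' by (simp add: corr_def)
        finally have eq2: "of_real (2 * pi) * F a * cis (y * \<xi>0) - of_real (2 * pi) * F (a + y)
           = (LINT u|lborel. cis (y * \<xi>0) * (F (a + u) * K u) - F (a + u) * K (u - y))" .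
        have js: "integrable lborel (\<lambda>u. weight \<beta> (\<epsilon> * u) * norm (k (\<epsilon> * u) - k (\<epsilon> * u - \<epsilon> * y)))"
          using lborel_integrable_real_affine[OF ij[of "\<epsilon> * y"], of \<epsilon> 0] \<epsilon> by simp
        have jv: "(LINT u|lborel. B * weight \<beta> (\<epsilon> * a) * (\<epsilon> * (weight \<beta> (\<epsilon> * u) * norm (k (\<epsilon> * u) - k (\<epsilon> * u - \<epsilon> * y)))))
            = B * weight \<beta> (\<epsilon> * a) * j (\<epsilon> * y)"
          unfolding j_def
          using lborel_integral_real_affine[of \<epsilon> "\<lambda>s. weight \<beta> s * norm (k s - k (s - \<epsilon> * y))" 0] \<epsilon> by simp
        have "norm (of_real (2 * pi) * F a * cis (y * \<xi>0) - of_real (2 * pi) * F (a + y))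
          \<le> (LINT u|lborel. B * weight \<beta> (\<epsilon> * a) * (\<epsilon> * (weight \<beta> (\<epsilon> * u) * norm (k (\<epsilon> * u) - k (\<epsilon> * u - \<epsilon> * y)))))"
          unfolding eq2
        proof (rule Bochner_Integration.integral_norm_bound_integral)
          show "integrable lborel (\<lambda>u. cis (y * \<xi>0) * (F (a + u) * K u) - F (a + u) * K (u - y))"
            using iK iK' by simp
          show "integrable lborel (\<lambda>u. B * weight \<beta> (\<epsilon> * a) * (\<epsilon> * (weight \<beta> (\<epsilon> * u) * norm (k (\<epsilon> * u) - k (\<epsilon> * u - \<epsilon> * y)))))"
            using js by simp
          fix u
          have c: "cis (- ((u - y) * \<xi>0)) = cis (y * \<xi>0) * cis (- (u * \<xi>0))"
            by (simp add: cis_mult algebra_simps)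
          have "cis (y * \<xi>0) * (F (a + u) * K u) - F (a + u) * K (u - y)
             = F (a + u) * (of_real \<epsilon> * (cis (y * \<xi>0) * cis (- (u * \<xi>0)) * (k (\<epsilon> * u) - k (\<epsilon> * u - \<epsilon> * y))))"
            unfolding K_eq c by (simp add: algebra_simps)
          then have "norm (cis (y * \<xi>0) * (F (a + u) * K u) - F (a + u) * K (u - y))
             = norm (F (a + u)) * (\<epsilon> * norm (k (\<epsilon> * u) - k (\<epsilon> * u - \<epsilon> * y)))"
            using \<epsilon> by (simp add: norm_mult)
          also have "\<dots> \<le> (B * (weight \<beta> (\<epsilon> * a) * weight \<beta> (\<epsilon> * u))) * (\<epsilon> * norm (k (\<epsilon> * u) - k (\<epsilon> * u - \<epsilon> * y)))"
          proof (rule mult_right_mono)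
            have "norm (F (a + u)) \<le> B * weight \<beta> (\<epsilon> * a + \<epsilon> * u)" using B(2)[of "a + u"] by (simp add: distrib_left)
            also have "\<dots> \<le> B * (weight \<beta> (\<epsilon> * a) * weight \<beta> (\<epsilon> * u))" by (intro mult_left_mono weight_add beta B)
            finally show "norm (F (a + u)) \<le> B * (weight \<beta> (\<epsilon> * a) * weight \<beta> (\<epsilon> * u))" .
          qed (use \<epsilon> in simp)
          finally show "norm (cis (y * \<xi>0) * (F (a + u) * K u) - F (a + u) * K (u - y))
             \<le> B * weight \<beta> (\<epsilon> * a) * (\<epsilon> * (weight \<beta> (\<epsilon> * u) * norm (k (\<epsilon> * u) - k (\<epsilon> * u - \<epsilon> * y))))"
            by (simp add: mult_ac)
        qed
        then have H: "norm (of_real (2 * pi) * F a * cis (y * \<xi>0) - of_real (2 * pi) * F (a + y)) \<le> B * weight \<beta> (\<epsilon> * a) * j (\<epsilon> * y)"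
          unfolding jv .
        have "of_real (2 * pi) * F a * (cis (y * \<xi>0) * g y) - of_real (2 * pi) * (F (a + y) * g y)
          = (of_real (2 * pi) * F a * cis (y * \<xi>0) - of_real (2 * pi) * F (a + y)) * g y"
          by (simp add: algebra_simps)
        then show ?thesis
          using mult_right_mono[OF H, of "norm (g y)"] by (simp add: norm_mult mult_ac)
      qed
      have "norm (of_real (2 * pi) * (\<gamma> * F a)) \<le> (LINT y|lborel. B * weight \<beta> (\<epsilon> * a) * (norm (g y) * j (\<epsilon> * y)))"
        unfolding eq
      proof (rule Bochner_Integration.integral_norm_bound_integral)
        show "integrable lborel (\<lambda>y. of_real (2 * pi) * F a * (cis (y * \<xi>0) * g y) - of_real (2 * pi) * (F (a + y) * g y))"
          by (intro Bochner_Integration.integrable_diff integrable_mult_right ig iF)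
        show "integrable lborel (\<lambda>y. B * weight \<beta> (\<epsilon> * a) * (norm (g y) * j (\<epsilon> * y)))"
          using gj[OF \<epsilon>] by simp
      qed (rule pt)
      also have "\<dots> = B * weight \<beta> (\<epsilon> * a) * (LINT y|lborel. norm (g y) * j (\<epsilon> * y))"
        by (rule integral_mult_right_zero)
      also have "\<dots> \<le> B * weight \<beta> (\<epsilon> * a) * (pi * norm \<gamma>)"
        using J B by (intro mult_left_mono) (auto simp: \<epsilon>_def)
      finally have "(pi * norm \<gamma>) * (2 * norm (F a)) \<le> (pi * norm \<gamma>) * (B * weight \<beta> (\<epsilon> * a))"
        by (simp add: norm_mult mult_ac)
      then have "2 * norm (F a) \<le> B * weight \<beta> (\<epsilon> * a)" using \<gamma> by (subst (asm) mult_le_cancel_left_pos) auto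
      then show ?thesis by simp
    qed
    obtain C where C: "C > 0" "\<And>x. norm (F x) \<le> C * weight \<beta> x" using poly_bounded_bound[OF PF] by blast
    \<comment> \<open>The price of passing from \<open>weight \<beta> a\<close> to the rescaled
      weight; it is paid once, and the iteration then halves it repeatedly.\<close>
    define B where "B = C * (1 / \<epsilon>) powr \<beta>"
    have B: "B \<ge> 0" using C by (simp add: B_def)
    have start: "norm (F a) \<le> B * weight \<beta> (\<epsilon> * a)" for a
    proof -
      have "weight \<beta> a = weight \<beta> ((1 / \<epsilon>) * (\<epsilon> * a))" using \<epsilon> by simp
      also have "\<dots> \<le> (1 / \<epsilon>) powr \<beta> * weight \<beta> (\<epsilon> * a)" using \<epsilon> by (intro weight_scale beta) simp
      finally have "C * weight \<beta> a \<le> C * ((1 / \<epsilon>) powr \<beta> * weight \<beta> (\<epsilon> * a))" using C by (intro mult_left_mono) auto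
      then show ?thesis using C(2)[of a] by (simp add: B_def mult.assoc)
    qed
    have iter: "\<forall>a. norm (F a) \<le> (B / 2 ^ n) * weight \<beta> (\<epsilon> * a)" for n
    proof (induction n)
      case 0
      then show ?case using start by simp
    next
      case (Suc n)
      show ?case using contraction[of "B / 2 ^ n"] Suc B by (simp add: field_simps)
    qed
    have "(\<lambda>n. (B / 2 ^ n) * weight \<beta> (\<epsilon> * a)) \<longlonglongrightarrow> 0" by real_asymp
    then have "norm (F a) \<le> 0" by (rule LIMSEQ_le_const) (use iter in blast)
    then show "corr f (fourier \<theta>) a = 0" by (simp add: F_def)
  qed
qed

text \<open>Compactness in the form of \<open>Bolzano\<close>. The margin \<delta> makes adjacent
  intervals overlap, leaving room for a smooth partition of unity where they are glued.\<close>

lemma interval_vanish: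
  assumes lr: "l \<le> r" and 0: "0 \<notin> {l..r}"
  shows "\<exists>\<delta>>0. \<forall>\<theta>. test_function \<theta> \<longrightarrow> (\<forall>\<xi>. \<xi> \<notin> {l - \<delta>..r + \<delta>} \<longrightarrow> \<theta> \<xi> = 0) \<longrightarrow> (\<forall>a. corr f (fourier \<theta>) a = 0)"
  using lr
proof (induction rule: Bolzano)
  case (trans u v w)
  then obtain \<delta>1 \<delta>2 where d1: "\<delta>1 > 0" "\<And>\<theta> a. test_function \<theta> \<Longrightarrow> (\<forall>\<xi>. \<xi> \<notin> {u - \<delta>1..v + \<delta>1} \<longrightarrow> \<theta> \<xi> = 0) \<Longrightarrow> corr f (fourier \<theta>) a = 0"
    and d2: "\<delta>2 > 0" "\<And>\<theta> a. test_function \<theta> \<Longrightarrow> (\<forall>\<xi>. \<xi> \<notin> {v - \<delta>2..w + \<delta>2} \<longrightarrow> \<theta> \<xi> = 0) \<Longrightarrow> corr f (fourier \<theta>) a = 0"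
    by metis
  define \<delta> where "\<delta> = min \<delta>1 \<delta>2"
  have d: "\<delta> > 0" "\<delta> \<le> \<delta>1" "\<delta> \<le> \<delta>2" using d1 d2 by (auto simp: \<delta>_def)
  show ?case
  proof (intro exI[of _ \<delta>] conjI allI impI d)
    fix \<theta> a assume th: "test_function \<theta>" and supp: "\<forall>\<xi>. \<xi> \<notin> {u - \<delta>..w + \<delta>} \<longrightarrow> \<theta> \<xi> = 0"
    \<comment> \<open>The transition lies in \<open>{v..v + \<delta>}\<close>, inside the overlap of
      the two enlarged intervals.\<close>
    define s where "s \<xi> = complex_of_real (step ((\<xi> - v) / \<delta>))" for \<xi>
    have s: "smooth s"
      using smooth_affine[OF smooth_step, of "1 / \<delta>" "- v / \<delta>"] by (simp add: s_def[abs_def] diff_divide_distrib)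
    have s0: "s \<xi> = 0" if "\<xi> \<le> v" for \<xi> using that d by (simp add: s_def step_0 divide_nonpos_pos)
    have s1: "s \<xi> = 1" if "\<xi> \<ge> v + \<delta>" for \<xi> using that d by (simp add: s_def step_1 le_divide_eq)
    have t1: "test_function (\<lambda>\<xi>. s \<xi> * \<theta> \<xi>)" by (intro test_function_mult th s)
    have t2: "test_function (\<lambda>\<xi>. (1 - s \<xi>) * \<theta> \<xi>)" by (intro test_function_mult th smooth_diff smooth_const s)
    have "corr f (fourier (\<lambda>\<xi>. s \<xi> * \<theta> \<xi>)) a = 0"
    proof (rule d2(2)[OF t1], intro allI impI)
      fix \<xi> assume "\<xi> \<notin> {v - \<delta>2..w + \<delta>2}"
      then have "\<xi> \<le> v \<or> \<xi> \<notin> {u - \<delta>..w + \<delta>}" using d d2 by auto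
      then show "s \<xi> * \<theta> \<xi> = 0" using s0 supp by auto
    qed
    moreover have "corr f (fourier (\<lambda>\<xi>. (1 - s \<xi>) * \<theta> \<xi>)) a = 0"
    proof (rule d1(2)[OF t2], intro allI impI)
      fix \<xi> assume "\<xi> \<notin> {u - \<delta>1..v + \<delta>1}"
      then have "\<xi> \<ge> v + \<delta> \<or> \<xi> \<notin> {u - \<delta>..w + \<delta>}" using d trans by auto
      then show "(1 - s \<xi>) * \<theta> \<xi> = 0" using s1 supp by auto
    qed
    moreover have "(\<lambda>\<xi>. s \<xi> * \<theta> \<xi> + (1 - s \<xi>) * \<theta> \<xi>) = \<theta>" by (auto simp: algebra_simps)
    ultimately show "corr f (fourier \<theta>) a = 0"
      using corr_fourier_add[OF beta poly_bounded_f t1 t2, of a] by simp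
  qed
next
  case (local x)
  then have "x \<noteq> 0" using 0 by auto
  then obtain \<epsilon> where e: "\<epsilon> > 0" "\<And>\<theta> a. test_function \<theta> \<Longrightarrow> (\<And>\<xi>. \<bar>\<xi> - x\<bar> > \<epsilon> \<Longrightarrow> \<theta> \<xi> = 0) \<Longrightarrow> corr f (fourier \<theta>) a = 0"
    using local_vanish by metis
  show ?case
  \<comment> \<open>The same value serves as interval width and as margin; together they keep the
    support within \<epsilon> of \<open>x\<close>.\<close>
  proof (intro exI[of _ "\<epsilon> / 2"] conjI allI impI)
    fix u v \<theta> a assume uv: "u \<le> x \<and> x \<le> v \<and> v - u < \<epsilon> / 2" and th: "test_function \<theta>"
      and supp: "\<forall>\<xi>. \<xi> \<notin> {u - \<epsilon> / 2..v + \<epsilon> / 2} \<longrightarrow> \<theta> \<xi> = 0"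
    show "corr f (fourier \<theta>) a = 0"
    proof (rule e(2)[OF th])
      fix \<xi> assume "\<bar>\<xi> - x\<bar> > \<epsilon>"
      then have "\<xi> \<notin> {u - \<epsilon> / 2..v + \<epsilon> / 2}" using uv by auto
      then show "\<theta> \<xi> = 0" using supp by blast
    qed
  qed (use e in auto)
qed

text \<open>The support of \<theta> splits at the gap around 0 into two compact parts, each covered
  by \<open>interval_vanish\<close>.\<close>

lemma vanish_away:
  assumes th: "test_function \<theta>" and e: "\<epsilon> > 0" and supp: "\<And>\<xi>. \<bar>\<xi>\<bar> < \<epsilon> \<Longrightarrow> \<theta> \<xi> = 0"
  shows "corr f (fourier \<theta>) a = 0"
proof -
  obtain R where R: "R > 0" "\<And>x. \<bar>x\<bar> \<ge> R \<Longrightarrow> \<theta> x = 0" using test_function_bounded_support[OF th] by blast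
  define S where "S = max R \<epsilon>"
  \<comment> \<open>The transition takes place within the gap where \<theta> vanishes.\<close>
  define s where "s \<xi> = complex_of_real (step (\<xi> / \<epsilon>))" for \<xi>
  have s: "smooth s" using smooth_affine[OF smooth_step, of "1 / \<epsilon>" 0] by (simp add: s_def[abs_def])
  have s0: "s \<xi> = 0" if "\<xi> \<le> 0" for \<xi> using that e by (simp add: s_def step_0 divide_nonpos_pos)
  have s1: "s \<xi> = 1" if "\<xi> \<ge> \<epsilon>" for \<xi> using that e by (simp add: s_def step_1)
  have t1: "test_function (\<lambda>\<xi>. s \<xi> * \<theta> \<xi>)" by (intro test_function_mult th s)
  have t2: "test_function (\<lambda>\<xi>. (1 - s \<xi>) * \<theta> \<xi>)" by (intro test_function_mult th smooth_diff smooth_const s)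
  have "0 \<notin> {\<epsilon>..S}" "0 \<notin> {- S..- \<epsilon>}" "\<epsilon> \<le> S" "- S \<le> - \<epsilon>" using e by (auto simp: S_def)
  then obtain \<delta>1 \<delta>2 where d1: "\<delta>1 > 0" "\<And>\<theta> a. test_function \<theta> \<Longrightarrow> (\<forall>\<xi>. \<xi> \<notin> {\<epsilon> - \<delta>1..S + \<delta>1} \<longrightarrow> \<theta> \<xi> = 0) \<Longrightarrow> corr f (fourier \<theta>) a = 0"
    and d2: "\<delta>2 > 0" "\<And>\<theta> a. test_function \<theta> \<Longrightarrow> (\<forall>\<xi>. \<xi> \<notin> {- S - \<delta>2..- \<epsilon> + \<delta>2} \<longrightarrow> \<theta> \<xi> = 0) \<Longrightarrow> corr f (fourier \<theta>) a = 0"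
    using interval_vanish[of \<epsilon> S] interval_vanish[of "- S" "- \<epsilon>"] by metis
  have "corr f (fourier (\<lambda>\<xi>. s \<xi> * \<theta> \<xi>)) a = 0"
  proof (rule d1(2)[OF t1], intro allI impI)
    fix \<xi> assume "\<xi> \<notin> {\<epsilon> - \<delta>1..S + \<delta>1}"
    then have "\<xi> \<le> 0 \<or> \<bar>\<xi>\<bar> < \<epsilon> \<or> \<bar>\<xi>\<bar> \<ge> R" using d1 by (auto simp: S_def)
    then show "s \<xi> * \<theta> \<xi> = 0" using s0 supp R by auto
  qed
  moreover have "corr f (fourier (\<lambda>\<xi>. (1 - s \<xi>) * \<theta> \<xi>)) a = 0"
  proof (rule d2(2)[OF t2], intro allI impI)
    fix \<xi> assume "\<xi> \<notin> {- S - \<delta>2..- \<epsilon> + \<delta>2}"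
    then have "\<xi> \<ge> \<epsilon> \<or> \<bar>\<xi>\<bar> < \<epsilon> \<or> \<bar>\<xi>\<bar> \<ge> R" using d2 by (auto simp: S_def)
    then show "(1 - s \<xi>) * \<theta> \<xi> = 0" using s1 supp R by auto
  qed
  moreover have "(\<lambda>\<xi>. s \<xi> * \<theta> \<xi> + (1 - s \<xi>) * \<theta> \<xi>) = \<theta>" by (auto simp: algebra_simps)
  ultimately show ?thesis
    using corr_fourier_add[OF beta poly_bounded_f t1 t2, of a] by simp
qed

text \<open>Only the germ of a cutoff at 0 matters, so it may be traded for a rescaled one. This is
  the form in which the spectrum being \<open>{0}\<close> is used afterwards.\<close>

lemma vanish_local:
  assumes t: "test_function \<theta>" "test_function \<eta>" and e: "\<epsilon> > 0" and eq: "\<And>\<xi>. \<bar>\<xi>\<bar> < \<epsilon> \<Longrightarrow> \<theta> \<xi> = \<eta> \<xi>"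
  shows "corr f (fourier \<theta>) a = corr f (fourier \<eta>) a"
proof -
  have d: "test_function (\<lambda>\<xi>. \<theta> \<xi> - \<eta> \<xi>)" by (intro test_function_diff t)
  have "corr f (fourier (\<lambda>\<xi>. \<theta> \<xi> - \<eta> \<xi>)) a = 0"
    by (rule vanish_away[OF d e]) (simp add: eq)
  then show ?thesis using corr_fourier_add[OF beta poly_bounded_f d t(2), of a] by simp
qed

end

section \<open>The origin\<close>

lemma vector_derivative_eq_imp_eq:
  fixes G H :: "real \<Rightarrow> complex"
  assumes "\<And>x. (G has_vector_derivative p x) (at x)" "\<And>x. (H has_vector_derivative p x) (at x)"
  shows "G x = H x + (G 0 - H 0)"
proof -
  have "((\<lambda>x. G x - H x) has_vector_derivative 0) (at x)" for x
    using has_vector_derivative_diff[OF assms] by simp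
  then obtain c where "\<And>x. G x - H x = c"
    using has_vector_derivative_zero_constant[of UNIV "\<lambda>x. G x - H x"] by auto
  then show ?thesis by (metis add.commute diff_add_cancel)
qed

lemma has_vector_derivative_quadratic_poly:
  fixes c d :: complex
  shows "((\<lambda>x. c / 2 * of_real x ^ 2 + d * of_real x) has_vector_derivative c * of_real x + d) (at x)"
proof -
  have "((\<lambda>z. c / 2 * z ^ 2 + d * z) has_field_derivative c * of_real x + d) (at (of_real x :: complex))"
    by (auto intro!: derivative_eq_intros)
  from has_vector_derivative_real_field[OF this] show ?thesis .
qed

lemma has_vector_derivative_linear_poly:
  "((\<lambda>x. d * complex_of_real x) has_vector_derivative d) (at x)"
  using has_vector_derivative_quadratic_poly[of 0 d x] by simp

lemma poly_bounded_set_integrable: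
  assumes "\<beta> \<ge> 0" "poly_bounded \<beta> f" shows "set_integrable lborel {p..q} f"
proof -
  obtain C where C: "C > 0" "\<And>x. norm (f x) \<le> C * weight \<beta> x" using poly_bounded_bound assms by blast
  have [measurable]: "f \<in> borel_measurable borel" using assms by measurable
  define R where "R = max \<bar>p\<bar> \<bar>q\<bar>"
  show ?thesis
    unfolding set_integrable_def
  proof (rule Bochner_Integration.integrable_bound)
    show "integrable lborel (\<lambda>x. (C * weight \<beta> R) * indicator {p..q} x)"
      by (intro integrable_mult_right integrable_real_indicator) (auto simp: emeasure_lborel_Icc_eq)
    show "AE x in lborel. norm (indicator {p..q} x *\<^sub>R f x) \<le> norm ((C * weight \<beta> R) * indicator {p..q} x)"
    proof (rule AE_I2)
      fix x
      show "norm (indicator {p..q} x *\<^sub>R f x) \<le> norm ((C * weight \<beta> R) * indicator {p..q} x)"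
      proof (cases "x \<in> {p..q}")
        case True
        then have "weight \<beta> x \<le> weight \<beta> R" by (intro weight_mono assms) (auto simp: R_def)
        then have "C * weight \<beta> x \<le> C * weight \<beta> R" using C by (intro mult_left_mono) auto
        from order_trans[OF C(2) this] show ?thesis using True C(1) by simp
      qed simp
    qed
  qed measurable
qed

lemma indicator_shift_tendsto:
  fixes p q x :: real
  assumes "h \<longlonglongrightarrow> 0" "x \<noteq> p" "x \<noteq> q"
  shows "(\<lambda>n. indicator {p..q} (x - h n) :: real) \<longlonglongrightarrow> indicator {p..q} x"
proof -
  have "isCont (indicator {p..q} :: real \<Rightarrow> real) x"
    using assms(2,3) by (auto simp: isCont_indicator frontier_def)
  moreover have "(\<lambda>n. x - h n) \<longlonglongrightarrow> x" using tendsto_diff[OF tendsto_const assms(1), of x] by simp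
  ultimately show ?thesis by (rule isCont_tendsto_compose)
qed

text \<open>Since \<open>f\<close> may be discontinuous, the shift is moved onto the indicator,
  which converges away from the two endpoints.\<close>

lemma interval_average_tendsto:
  assumes b: "\<beta> \<ge> 0" and f: "poly_bounded \<beta> f" and h: "h \<longlonglongrightarrow> 0"
  shows "(\<lambda>n. LINT a:{p..q}|lborel. f (a + h n)) \<longlonglongrightarrow> (LINT a:{p..q}|lborel. f a)"
proof -
  have [measurable]: "f \<in> borel_measurable borel" using f by measurable
  obtain B where B: "\<And>n. \<bar>h n\<bar> \<le> B"
    using convergent_imp_Bseq[of h] h unfolding convergent_def Bseq_def by auto
  have sh: "(LINT a:{p..q}|lborel. f (a + t)) = (LINT x|lborel. indicator {p..q} (x - t) *\<^sub>R f x)" for t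
    unfolding set_lebesgue_integral_def
    using lborel_integral_shift[of "\<lambda>x. indicator {p..q} (x - t) *\<^sub>R f x" t] by simp
  have "(\<lambda>n. LINT x|lborel. indicator {p..q} (x - h n) *\<^sub>R f x) \<longlonglongrightarrow> (LINT x|lborel. indicator {p..q} x *\<^sub>R f x)"
  proof (rule integral_dominated_convergence)
    show "integrable lborel (\<lambda>x. norm (indicator {p - B..q + B} x *\<^sub>R f x))"
      by (rule integrable_norm[OF poly_bounded_set_integrable[OF b f, unfolded set_integrable_def]])
    show "AE x in lborel. (\<lambda>n. indicator {p..q} (x - h n) *\<^sub>R f x) \<longlonglongrightarrow> indicator {p..q} x *\<^sub>R f x"
      using AE_lborel_singleton[of p] AE_lborel_singleton[of q]
      by eventually_elim (intro tendsto_intros indicator_shift_tendsto h)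
    show "AE x in lborel. norm (indicator {p..q} (x - h n) *\<^sub>R f x) \<le> norm (indicator {p - B..q + B} x *\<^sub>R f x)" for n
      using B[of n] by (intro AE_I2) (auto simp: indicator_def)
  qed measurable
  then show ?thesis unfolding sh by (simp add: set_lebesgue_integral_def)
qed

section \<open>Polynomial structure and recovery of the solution\<close>

context levy_solution
begin

text \<open>The powers of \<open>\<i> * \<xi>\<close> make \<open>mollified k\<close> the
  \<open>k\<close>-th derivative of \<open>mollified 0\<close>.\<close>

definition freq_monomial :: "nat \<Rightarrow> real \<Rightarrow> complex" where
  "freq_monomial k \<xi> = (\<i> * of_real \<xi>) ^ k * cutoff \<xi>"

definition mollified :: "nat \<Rightarrow> real \<Rightarrow> complex" where
  "mollified k = corr f (fourier (freq_monomial k))"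

lemma test_function_freq_monomial: "test_function (freq_monomial k)"
  unfolding freq_monomial_def
  by (intro test_function_mult test_function_cutoff smooth_power smooth_mult smooth_const smooth_of_real)

lemma mollified_deriv: "(mollified k has_vector_derivative mollified (Suc k) a) (at a)"
proof -
  have "(\<lambda>\<xi>. \<i> * of_real \<xi> * freq_monomial k \<xi>) = freq_monomial (Suc k)" by (auto simp: freq_monomial_def)
  then show ?thesis
    using corr_fourier_has_derivative[OF beta poly_bounded_f test_function_freq_monomial, of k a] by (simp add: mollified_def)
qed

lemma poly_bounded_mollified: "poly_bounded \<beta> (mollified k)"
  unfolding mollified_def by (rule corr_fourier_poly_bounded[OF test_function_freq_monomial])

text \<open>A Liouville argument by scaling: shrinking the cutoff to scale \<open>e\<close> leaves
  \<open>mollified N\<close> unchanged, while the weighted norm of the kernel is of order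
  \<open>e powr (N - \<beta>)\<close>, which tends to 0.\<close>

lemma mollified_high:
  assumes N: "\<beta> < real N" shows "mollified N a = 0"
proof -
  define k where "k = fourier (freq_monomial N)"
  have rk: "rapid k" unfolding k_def by (rule rapid_fourier[OF test_function_freq_monomial])
  have wk: "integrable lborel (\<lambda>s. weight \<beta> s * norm (k s))" using rapid_weighted_L1[OF rk] by (simp add: weighted_L1_def)
  define A where "A = (LINT s|lborel. weight \<beta> s * norm (k s))"
  obtain C where C: "C > 0" "\<And>x. norm (f x) \<le> C * weight \<beta> x" using poly_bounded_bound poly_bounded_f by blast
  have est: "norm (mollified N a) \<le> C * weight \<beta> a * A * (1 + real n) powr (\<beta> - real N)" for n
  proof -
    define e where "e = 1 / (1 + real n)"
    have e: "0 < e" "e \<le> 1" by (auto simp: e_def)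
    \<comment> \<open>This is \<open>(\<i> * \<xi>)^N * cutoff (\<xi> / e)\<close>: the factor
      \<open>e ^ N\<close> undoes the rescaling of the monomial.\<close>
    define \<eta> where "\<eta> \<xi> = of_real (e ^ N) * freq_monomial N ((\<xi> - 0) / e)" for \<xi>
    have eta: "test_function \<eta>"
      unfolding \<eta>_def
      using test_function_affine[OF test_function_freq_monomial, of "1 / e" N 0] e
      by (intro test_function_mult smooth_const) simp
    have K: "fourier \<eta> u = of_real (e ^ N * e) * k (e * u)" for u
      unfolding \<eta>_def fourier_cmult fourier_rescale[OF e(1)] k_def by simp
    have "mollified N a = corr f (fourier \<eta>) a"
      unfolding mollified_def
    proof (rule vanish_local[OF test_function_freq_monomial eta e(1)])
      fix \<xi> assume "\<bar>\<xi>\<bar> < e"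
      then have "cutoff \<xi> = 1" "cutoff (\<xi> / e) = 1" using e by (auto intro!: cutoff_1 simp: abs_divide)
      then show "freq_monomial N \<xi> = \<eta> \<xi>" using e by (simp add: freq_monomial_def \<eta>_def power_mult_distrib power_divide)
    qed
    also have "norm \<dots> \<le> C * weight \<beta> a * (LINT x|lborel. weight \<beta> x * norm (fourier \<eta> x))"
      using C poly_bounded_f rapid_weighted_L1[OF rapid_fourier[OF eta]] by (intro corr_bound beta) auto
    also have "(LINT x|lborel. weight \<beta> x * norm (fourier \<eta> x))
       = \<bar>1 / e\<bar> *\<^sub>R (LINT s|lborel. weight \<beta> (0 + (1 / e) * s) * norm (fourier \<eta> (0 + (1 / e) * s)))"
      by (rule lborel_integral_real_affine) (use e in simp)
    also have "\<dots> = e ^ N * (LINT s|lborel. weight \<beta> ((1 / e) * s) * norm (k s))"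
    proof -
      have "(LINT s|lborel. weight \<beta> (0 + (1 / e) * s) * norm (fourier \<eta> (0 + (1 / e) * s)))
         = (LINT s|lborel. (e ^ N * e) * (weight \<beta> ((1 / e) * s) * norm (k s)))"
        using e by (simp add: K norm_mult norm_power mult_ac)
      also have "\<dots> = (e ^ N * e) * (LINT s|lborel. weight \<beta> ((1 / e) * s) * norm (k s))"
        by (rule integral_mult_right_zero)
      finally show ?thesis using e by simp
    qed
    also have "\<dots> \<le> e ^ N * (LINT s|lborel. (1 / e) powr \<beta> * (weight \<beta> s * norm (k s)))"
    proof (intro mult_left_mono integral_mono)
      have bd: "weight \<beta> ((1 / e) * s) * norm (k s) \<le> (1 / e) powr \<beta> * (weight \<beta> s * norm (k s))" for s
        using mult_right_mono[OF weight_scale[OF beta, of "1 / e" s], of "norm (k s)"] e by (simp add: mult_ac)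
      then show "weight \<beta> ((1 / e) * s) * norm (k s) \<le> (1 / e) powr \<beta> * (weight \<beta> s * norm (k s))" for s .
      show i: "integrable lborel (\<lambda>s. (1 / e) powr \<beta> * (weight \<beta> s * norm (k s)))" using wk by simp
      have [measurable]: "k \<in> borel_measurable borel" using rk by measurable
      show "integrable lborel (\<lambda>s. weight \<beta> ((1 / e) * s) * norm (k s))"
        by (rule Bochner_Integration.integrable_bound[OF i])
           (use bd in \<open>auto intro!: AE_I2 simp: abs_mult\<close>)
    qed (use e in simp)
    also have "\<dots> = e ^ N * ((1 / e) powr \<beta> * A)" by (simp add: A_def)
    also have "\<dots> = A * (1 + real n) powr (\<beta> - real N)"
      by (simp add: e_def powr_diff powr_realpow power_divide)
    finally show ?thesis using C by (simp add: mult_left_mono mult.assoc)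
  qed
  have "filterlim (\<lambda>n. 1 + real n) at_top sequentially" by real_asymp
  then have "(\<lambda>n. (1 + real n) powr (\<beta> - real N)) \<longlonglongrightarrow> 0"
    using N by (intro tendsto_neg_powr) auto
  from tendsto_mult_right_zero[OF this, of "C * weight \<beta> a * A"]
  have "norm (mollified N a) \<le> 0" by (rule LIMSEQ_le_const) (use est in blast)
  then show ?thesis by simp
qed

text \<open>By hypothesis \<open>mollified k\<close> is a polynomial of degree at most 2 with
  quadratic coefficient \<open>c / 2\<close>. For \<open>\<beta> < 2\<close> its growth bound gives
  \<open>c = 0\<close>; otherwise \<open>levy_op \<phi>\<close> has moments up to order 2, and the
  equation can be evaluated on the polynomial directly.\<close>

lemma mollified_descend:
  assumes z: "\<And>a. mollified (Suc (Suc (Suc k))) a = 0"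
  shows "mollified (Suc (Suc k)) a = 0"
proof -
  define c where "c = mollified (Suc (Suc k)) 0"
  define d where "d = mollified (Suc k) 0"
  define e where "e = mollified k 0"
  have D2: "(mollified (Suc (Suc k)) has_vector_derivative 0) (at x)" for x
    using mollified_deriv[of "Suc (Suc k)" x] by (simp add: z)
  have F2: "mollified (Suc (Suc k)) x = c" for x
    using vector_derivative_eq_imp_eq[OF D2, of "\<lambda>_. 0" x] by (simp add: c_def)
  have D1: "(mollified (Suc k) has_vector_derivative c) (at x)" for x
    using mollified_deriv[of "Suc k" x] by (simp add: F2)
  have F1: "mollified (Suc k) x = c * of_real x + d" for x
    using vector_derivative_eq_imp_eq[OF D1 has_vector_derivative_linear_poly, of x] by (simp add: d_def)
  have D0: "(mollified k has_vector_derivative c * of_real x + d) (at x)" for x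
    using mollified_deriv[of k x] by (simp add: F1)
  have F0: "mollified k x = c / 2 * of_real x ^ 2 + d * of_real x + e" for x
    using vector_derivative_eq_imp_eq[OF D0 has_vector_derivative_quadratic_poly, of x] by (simp add: e_def)
  have "c = 0"
  proof (cases "\<beta> < 2")
    case True
    obtain C where C: "C > 0" "\<And>x. norm (mollified k x) \<le> C * weight \<beta> x" using poly_bounded_bound poly_bounded_mollified by blast
    have le: "norm c / 2 \<le> C * ((1 + real n) powr \<beta> / real n ^ 2) + norm d * (1 / real n) + norm e * (1 / real n ^ 2)"
      if n: "n \<ge> 1" for n
    proof -
      have "norm (c / 2 * of_real (real n) ^ 2) = norm (mollified k (real n) - d * of_real (real n) - e)" by (simp add: F0)
      also have "\<dots> \<le> norm (mollified k (real n)) + norm (d * of_real (real n)) + norm e"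
        by (meson add_right_mono norm_triangle_ineq4 order_trans)
      also have "\<dots> \<le> C * (1 + real n) powr \<beta> + norm d * real n + norm e"
        using C(2)[of "real n"] by (simp add: weight_def norm_mult)
      finally have "norm c / 2 * real n ^ 2 \<le> C * (1 + real n) powr \<beta> + norm d * real n + norm e"
        by (simp add: norm_mult norm_power)
      then have "norm c / 2 \<le> (C * (1 + real n) powr \<beta> + norm d * real n + norm e) / real n ^ 2"
        using n by (simp add: pos_le_divide_eq)
      also have "\<dots> = C * ((1 + real n) powr \<beta> / real n ^ 2) + norm d * (1 / real n) + norm e * (1 / real n ^ 2)"
        using n by (simp add: add_divide_distrib power2_eq_square)
      finally show ?thesis .
    qed
    have "(\<lambda>n. (1 + real n) powr \<beta> / real n ^ 2) \<longlonglongrightarrow> 0" using True by real_asymp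
    moreover have "(\<lambda>n. 1 / real n) \<longlonglongrightarrow> 0" "(\<lambda>n. 1 / real n ^ 2) \<longlonglongrightarrow> 0" by real_asymp+
    ultimately have "(\<lambda>n. C * ((1 + real n) powr \<beta> / real n ^ 2) + norm d * (1 / real n) + norm e * (1 / real n ^ 2))
       \<longlonglongrightarrow> C * 0 + norm d * 0 + norm e * 0"
      by (intro tendsto_intros)
    then have "norm c / 2 \<le> C * 0 + norm d * 0 + norm e * 0"
      by (rule LIMSEQ_le_const) (use le in blast)
    then show ?thesis by simp
  next
    case False
    then have b2: "\<beta> \<ge> 2" by simp
    obtain \<phi> where t: "test_function \<phi>" and "fourier \<phi> 0 \<noteq> 0" using exists_fourier_nonzero by blast
    then have I0: "(LINT x|lborel. \<phi> x) \<noteq> 0" by (simp add: fourier_def)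
    define g where "g = levy_op \<phi>"
    have i: "integrable lborel (\<lambda>x. of_real x ^ n * g x)" if "real n \<le> \<beta>" for n
      unfolding g_def using that by (intro integrable_levy_op(1)[OF t _ weight_power_bound]) auto
    have i0: "integrable lborel g" using i[of 0] beta by simp
    have i1: "integrable lborel (\<lambda>x. of_real x * g x)" using i[of 1] b2 by simp
    have i2: "integrable lborel (\<lambda>x. of_real x ^ 2 * g x)" using i[of 2] b2 by simp
    define M1 M2 where "M1 = (LINT x|lborel. of_real x * g x)" "M2 = (LINT x|lborel. of_real x ^ 2 * g x)"
    \<comment> \<open>The exponent vanishes at 0, so the constant term of the polynomial drops
      out.\<close>
    have M0: "(LINT x|lborel. g x) = 0"
      using fourier_levy_op[OF t, of 0] levy_exponent_0 by (simp add: fourier_def g_def)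
    \<comment> \<open>Expanding the quadratic at \<open>x + y\<close> in powers of \<open>y\<close>
      turns the equation into a relation between moments that is affine in \<open>x\<close>.\<close>
    have eq: "(c * of_real x + d) * M1 + c / 2 * M2 = 0" for x
    proof -
      have "0 = corr (mollified k) g x" unfolding mollified_def g_def by (rule corr_fourier_levy_op[OF test_function_freq_monomial t, symmetric])
      also have "\<dots> = (LINT y|lborel. (c / 2 * of_real x ^ 2 + d * of_real x + e) * g y
          + (c * of_real x + d) * (of_real y * g y) + c / 2 * (of_real y ^ 2 * g y))"
        unfolding corr_def F0 by (simp add: power2_eq_square field_simps)
      also have "\<dots> = (c * of_real x + d) * M1 + c / 2 * M2"
        using i0 i1 i2 by (simp add: M0 M1_M2_def)
      finally show ?thesis by simp
    qed
    \<comment> \<open>An affine function vanishing at 0 and 1 has slope 0.\<close>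
    have "c * M1 = 0" using eq[of 0] eq[of 1] by (simp add: algebra_simps)
    show "c = 0"
    proof (rule ccontr)
      assume "c \<noteq> 0"
      then have "M1 = 0" "M2 = 0" using \<open>c * M1 = 0\<close> eq[of 0] by auto
      \<comment> \<open>The exponent would vanish identically; the frequency 1 is an arbitrary
        nonzero witness.\<close>
      then have "levy_exponent b Q nu 1 = 0"
        using moments_vanish_imp_trivial[OF t b2 I0] by (simp add: M1_M2_def g_def)
      then show False using zeros by simp
    qed
  qed
  then show ?thesis by (simp add: F2)
qed

lemma mollified_2: "mollified 2 a = 0"
proof -
  \<comment> \<open>Larger than the growth exponent, and at least 3 so that descending one
    derivative at a time ends at 2.\<close>
  define N where "N = nat \<lceil>\<beta>\<rceil> + 3"
  have N: "\<beta> < real N" using real_nat_ceiling_ge[of \<beta>] by (simp add: N_def)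
  have "\<forall>a. mollified (N - j) a = 0" if "j \<le> N - 2" for j
    using that
  proof (induction j)
    case 0
    then show ?case using mollified_high[OF N] by simp
  next
    case (Suc j)
    then have "N - j = Suc (Suc (Suc (N - j - 3)))" "N - Suc j = Suc (Suc (N - j - 3))" by linarith+
    then show ?case using Suc mollified_descend[of "N - j - 3"] by auto
  qed
  from this[of "N - 2"] show ?thesis by (simp add: N_def)
qed

lemma mollified_0_affine: "mollified 0 x = mollified 1 0 * of_real x + mollified 0 0"
proof -
  define c where "c = mollified 1 0"
  have D1: "(mollified 1 has_vector_derivative 0) (at x)" for x
    using mollified_deriv[of 1 x] mollified_2 by (simp add: numeral_2_eq_2)
  have F1: "mollified 1 x = c" for x
    using vector_derivative_eq_imp_eq[OF D1, of "\<lambda>_. 0" x] by (simp add: c_def)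
  have D0: "(mollified 0 has_vector_derivative c) (at x)" for x
    using mollified_deriv[of 0 x] F1 by simp
  from vector_derivative_eq_imp_eq[OF D0 has_vector_derivative_linear_poly, of x] show ?thesis
    by (simp add: c_def)
qed

text \<open>The transforms of \<open>f\<close> against rescaled cutoffs agree because all these cutoffs are 1 near the origin.\<close>

lemma mollification_eq:
  assumes l: "0 < l" "l \<le> 1"
  shows "(LINT s|lborel. f (a + l * s) * fourier cutoff s) = mollified 0 a"
proof -
  \<comment> \<open>This is \<open>cutoff (l * \<xi>)\<close> in the shape of
    \<open>fourier_rescale\<close>; as \<open>l \<le> 1\<close>, it equals 1 on
    \<open>{-1..1}\<close>.\<close>
  define \<eta> where "\<eta> \<xi> = cutoff ((\<xi> - 0) / (1 / l))" for \<xi>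
  have eta: "test_function \<eta>"
    unfolding \<eta>_def using test_function_affine[OF test_function_cutoff, of l 0] l by (simp add: mult.commute)
  have K: "fourier \<eta> u = of_real (1 / l) * fourier cutoff (u / l)" for u
    unfolding \<eta>_def using l by (subst fourier_rescale) auto
  have "mollified 0 a = corr f (fourier \<eta>) a"
    unfolding mollified_def
  proof (rule vanish_local[OF test_function_freq_monomial eta, of 1])
    fix \<xi> :: real assume "\<bar>\<xi>\<bar> < 1"
    moreover from this have "\<bar>\<xi> * l\<bar> \<le> 1" using l by (simp add: abs_mult mult_le_one)
    ultimately show "freq_monomial 0 \<xi> = \<eta> \<xi>" by (simp add: freq_monomial_def \<eta>_def cutoff_1)
  qed simp
  also have "\<dots> = \<bar>l\<bar> *\<^sub>R (LINT s|lborel. f (a + (0 + l * s)) * fourier \<eta> (0 + l * s))"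
    unfolding corr_def by (rule lborel_integral_real_affine) (use l in simp)
  also have "\<dots> = (LINT s|lborel. f (a + l * s) * fourier cutoff s)"
    unfolding integral_scaleR_right[symmetric]
    by (intro Bochner_Integration.integral_cong refl) (use l in \<open>simp add: K scaleR_conv_of_real\<close>)
  finally show ?thesis by simp
qed

text \<open>\<open>mollification_eq\<close> makes the left side independent of the scale
  \<open>l\<close>. As \<open>l\<close> tends to 0 the rescaled kernel concentrates at the origin
  with total mass \<open>2 * pi\<close>, and integrating over an interval first makes the limit
  available for measurable \<open>f\<close>.\<close>

lemma interval_integral_eq:
  "(LINT a:{p..q}|lborel. mollified 0 a) = of_real (2 * pi) * (LINT a:{p..q}|lborel. f a)"
proof -
  define k where "k = fourier cutoff"
  have rk: "rapid k" unfolding k_def by (rule rapid_fourier[OF test_function_cutoff])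
  have [measurable]: "k \<in> borel_measurable borel" "f \<in> borel_measurable borel" using rk poly_bounded_f by measurable
  obtain C where C: "C > 0" "\<And>x. norm (f x) \<le> C * weight \<beta> x" using poly_bounded_bound poly_bounded_f by blast
  \<comment> \<open>A majorant in \<open>a\<close> uniform in the scale; the remaining factor
    \<open>weight \<beta> s\<close> is absorbed by the rapidly decaying kernel.\<close>
  define W where "W a = indicator {p..q} a * (C * weight \<beta> a)" for a
  have W: "integrable lborel W"
  proof -
    have "poly_bounded \<beta> (\<lambda>a. of_real (C * weight \<beta> a))" unfolding poly_bounded_def using C(1) by (auto simp: norm_mult intro!: exI[of _ C])
    from integrable_Re[OF poly_bounded_set_integrable[OF beta this, of p q, unfolded set_integrable_def]]
    show ?thesis by (simp add: W_def[abs_def])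
  qed
  have wk: "integrable lborel (\<lambda>s. weight \<beta> s * norm (k s))" using rapid_weighted_L1[OF rk] by (simp add: weighted_L1_def)
  have bd: "norm (indicator {p..q} a *\<^sub>R (f (a + l * s))) \<le> W a * weight \<beta> s" if l: "0 < l" "l \<le> 1" for a l s
  proof -
    have "norm (f (a + l * s)) \<le> C * weight \<beta> (a + l * s)" by (rule C)
    also have "\<dots> \<le> C * (weight \<beta> a * weight \<beta> (l * s))" using C by (intro mult_left_mono weight_add beta) auto
    also have "\<dots> \<le> C * (weight \<beta> a * weight \<beta> s)"
      using C l by (intro mult_left_mono weight_mono beta) (auto simp: abs_mult mult_left_le_one_le)
    finally show ?thesis by (auto simp: W_def indicator_def mult.assoc)
  qed
  have gi: "integrable lborel (\<lambda>a. indicator {p..q} a *\<^sub>R f (a + l * s))" if "0 < l" "l \<le> 1" for l s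
  proof (rule Bochner_Integration.integrable_bound)
    show "integrable lborel (\<lambda>a. W a * weight \<beta> s)" using W by simp
    show "AE a in lborel. norm (indicator {p..q} a *\<^sub>R f (a + l * s)) \<le> norm (W a * weight \<beta> s)"
      using bd[OF that] by (intro AE_I2) (auto intro: order_trans[OF _ abs_ge_self])
  qed measurable
  have step: "(LINT a:{p..q}|lborel. mollified 0 a) = (LINT s|lborel. (LINT a:{p..q}|lborel. f (a + l * s)) * k s)"
    if l: "0 < l" "l \<le> 1" for l
  proof -
    have "(LINT a:{p..q}|lborel. mollified 0 a) = (LINT a|lborel. LINT s|lborel. indicator {p..q} a *\<^sub>R f (a + l * s) * k s)"
      unfolding set_lebesgue_integral_def k_def mollification_eq[OF l, symmetric] by simp
    also have "\<dots> = (LINT s|lborel. LINT a|lborel. indicator {p..q} a *\<^sub>R f (a + l * s) * k s)"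
    proof (rule lborel_pair.Fubini_integral[symmetric], rule integrable_pair_dominated)
      show "pair_sigma_finite lborel lborel" ..
      show "norm (case (a, s) of (a, s) \<Rightarrow> indicator {p..q} a *\<^sub>R f (a + l * s) * k s) \<le> W a * (weight \<beta> s * norm (k s))" for a s
        using mult_right_mono[OF bd[OF l, of a s], of "norm (k s)"] by (simp add: norm_mult mult_ac)
    qed (use W wk in measurable)
    also have "\<dots> = (LINT s|lborel. (LINT a:{p..q}|lborel. f (a + l * s)) * k s)"
      by (simp only: set_lebesgue_integral_def integral_mult_left_zero)
    finally show ?thesis .
  qed
  define l where "l n = 1 / (1 + real n)" for n
  have l: "0 < l n" "l n \<le> 1" for n by (auto simp: l_def)
  have l_lim: "l \<longlonglongrightarrow> 0" unfolding l_def by real_asymp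
  have "(\<lambda>n. LINT s|lborel. (LINT a:{p..q}|lborel. f (a + l n * s)) * k s)
     \<longlonglongrightarrow> (LINT s|lborel. (LINT a:{p..q}|lborel. f a) * k s)"
  proof (rule integral_dominated_convergence)
    show "integrable lborel (\<lambda>s. (LINT a|lborel. W a) * (weight \<beta> s * norm (k s)))" using wk by simp
    show "AE s in lborel. (\<lambda>n. (LINT a:{p..q}|lborel. f (a + l n * s)) * k s) \<longlonglongrightarrow> (LINT a:{p..q}|lborel. f a) * k s"
    proof (intro AE_I2 tendsto_mult tendsto_const interval_average_tendsto[OF beta poly_bounded_f])
      show "(\<lambda>n. l n * s) \<longlonglongrightarrow> 0" for s using tendsto_mult_left_zero[OF l_lim] by simp
    qed
    show "AE s in lborel. norm ((LINT a:{p..q}|lborel. f (a + l n * s)) * k s) \<le> (LINT a|lborel. W a) * (weight \<beta> s * norm (k s))" for n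
    proof (rule AE_I2)
      fix s
      have "norm (LINT a:{p..q}|lborel. f (a + l n * s)) \<le> (LINT a|lborel. W a * weight \<beta> s)"
        unfolding set_lebesgue_integral_def
        by (rule Bochner_Integration.integral_norm_bound_integral[OF gi[OF l] _ bd[OF l]]) (use W in simp)
      then have "norm (LINT a:{p..q}|lborel. f (a + l n * s)) \<le> (LINT a|lborel. W a) * weight \<beta> s" by simp
      from mult_right_mono[OF this, of "norm (k s)"]
      show "norm ((LINT a:{p..q}|lborel. f (a + l n * s)) * k s) \<le> (LINT a|lborel. W a) * (weight \<beta> s * norm (k s))"
        by (simp add: norm_mult mult.assoc)
    qed
  qed (unfold set_lebesgue_integral_def, measurable)
  then have "(LINT a:{p..q}|lborel. mollified 0 a) = (LINT s|lborel. (LINT a:{p..q}|lborel. f a) * k s)"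
    unfolding step[OF l, symmetric] by (rule LIMSEQ_unique[OF tendsto_const])
  also have "\<dots> = (LINT a:{p..q}|lborel. f a) * (LINT s|lborel. k s)"
    by (rule integral_mult_right_zero)
  also have "(LINT s|lborel. k s) = of_real (2 * pi)"
    using fourier_inversion_integral[OF test_function_cutoff, of 0] by (simp add: k_def cutoff_1)
  finally show ?thesis by (simp add: mult.commute)
qed

lemma solution_affine: "AE x in lborel. f x = (mollified 1 0 * of_real x + mollified 0 0) / of_real (2 * pi)"
proof -
  have "AE x in lborel. f x - mollified 0 x / of_real (2 * pi) = 0"
  proof (rule AE_zero_of_interval_integrals)
    fix p q
    have i: "set_integrable lborel {p..q} f" "set_integrable lborel {p..q} (\<lambda>x. mollified 0 x / of_real (2 * pi))"
      using poly_bounded_set_integrable[OF beta poly_bounded_f] poly_bounded_set_integrable[OF beta poly_bounded_mollified] by auto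
    then show "set_integrable lborel {p..q} (\<lambda>x. f x - mollified 0 x / of_real (2 * pi))"
      by (rule set_integral_diff)
    show "(LINT x:{p..q}|lborel. f x - mollified 0 x / of_real (2 * pi)) = 0"
      unfolding set_integral_diff(2)[OF i] set_integral_divide_zero interval_integral_eq by simp
  qed
  then show ?thesis
  proof eventually_elim
    case (elim x)
    then show ?case using mollified_0_affine[of x] by simp
  qed
qed

end

section \<open>Reduction to a Borel representative bounded at every point\<close>

theorem theorem4p3:
  fixes b Q \<beta> :: real and nu :: "real measure" and f :: "real \<Rightarrow> complex"
  assumes "levy_triplet b Q nu"
    and "\<beta> \<ge> 0"
    and "(\<integral>\<^sup>+ y. ennreal (indicator {y. 1 \<le> \<bar>y\<bar>} y * \<bar>y\<bar> powr \<beta>) \<partial>nu) < \<infinity>"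
    and "{\<xi>. levy_exponent b Q nu \<xi> = 0} = {0}"
    and "f \<in> Linf_weighted \<beta>"
    and "weak_solution (levy_exponent b Q nu) f"
  shows "\<exists>c1 c0 :: complex. AE x in lebesgue. f x = c1 * complex_of_real x + c0"
proof -
  interpret levy b Q nu \<beta> by unfold_locales (fact assms)+
  have f: "f \<in> borel_measurable lebesgue" using assms(5) by (simp add: Linf_weighted_def)
  obtain C where C: "AE x in lebesgue. (1 + x\<^sup>2) powr (- \<beta> / 2) * norm (f x) \<le> C"
    using assms(5) by (auto simp: Linf_weighted_def)
  obtain fr where fr: "fr \<in> borel_measurable lborel" "AE x in lborel. Re (f x) = fr x"
    using completion_ex_borel_measurable_real[of "\<lambda>x. Re (f x)" lborel] f by auto
  obtain fi where fi: "fi \<in> borel_measurable lborel" "AE x in lborel. Im (f x) = fi x"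
    using completion_ex_borel_measurable_real[of "\<lambda>x. Im (f x)" lborel] f by auto
  note [measurable] = fr(1) fi(1)
  \<comment> \<open>Truncation enforces the growth bound at every point, as
    \<open>poly_bounded\<close> demands; by the essential bound on \<open>f\<close>, this alters
    values only on a null set.\<close>
  define h where "h x = (let z = of_real (fr x) + \<i> * of_real (fi x) in
     if norm z \<le> \<bar>C\<bar> * weight \<beta> x then z else 0)" for x
  have [measurable]: "h \<in> borel_measurable borel" unfolding h_def Let_def by measurable
  have hC: "norm (h x) \<le> \<bar>C\<bar> * weight \<beta> x" for x by (auto simp: h_def Let_def)
  have "AE x in lebesgue. norm (f x) \<le> \<bar>C\<bar> * weight \<beta> x"
    using C
  proof eventually_elim
    case (elim x)
    have p: "1 + x\<^sup>2 > 0" by (simp add: add_pos_nonneg)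
    have "norm (f x) = (1 + x\<^sup>2) powr (\<beta> / 2) * ((1 + x\<^sup>2) powr (- \<beta> / 2) * norm (f x))"
      using p by (simp add: mult.assoc[symmetric] powr_add[symmetric])
    also have "\<dots> \<le> (1 + x\<^sup>2) powr (\<beta> / 2) * \<bar>C\<bar>" using elim by (intro mult_left_mono) auto
    also have "\<dots> \<le> weight \<beta> x * \<bar>C\<bar>"
    proof (intro mult_right_mono)
      \<comment> \<open>Passes from the weight in \<open>Linf_weighted\<close> to the
        submultiplicative one.\<close>
      have "1 + x\<^sup>2 \<le> (1 + \<bar>x\<bar>)\<^sup>2" by (simp add: power2_eq_square ring_distribs)
      then have "(1 + x\<^sup>2) powr (\<beta> / 2) \<le> ((1 + \<bar>x\<bar>)\<^sup>2) powr (\<beta> / 2)"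
        using p assms(2) by (intro powr_mono2) auto
      also have "\<dots> = ((1 + \<bar>x\<bar>) powr 2) powr (\<beta> / 2)" by simp
      also have "\<dots> = weight \<beta> x" by (simp only: powr_powr weight_def) simp
      finally show "(1 + x\<^sup>2) powr (\<beta> / 2) \<le> weight \<beta> x" .
    qed simp
    finally show ?case by (simp add: mult.commute)
  qed
  moreover have "AE x in lebesgue. Re (f x) = fr x" "AE x in lebesgue. Im (f x) = fi x"
    using fr(2) fi(2) by (auto intro: AE_completion)
  ultimately have fh: "AE x in lebesgue. f x = h x"
  proof eventually_elim
    case (elim x)
    then have "of_real (fr x) + \<i> * of_real (fi x) = f x" by (simp add: complex_eq_iff)
    then show ?case using elim by (simp add: h_def)
  qed
  interpret levy_solution b Q nu \<beta> h
  proof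
    show "poly_bounded \<beta> h" using hC by (auto simp: poly_bounded_def)
    show "levy_exponent b Q nu \<xi> = 0 \<longleftrightarrow> \<xi> = 0" for \<xi> using assms(4) by auto
    fix \<phi> assume t: "test_function \<phi>"
    have [measurable]: "levy_op \<phi> \<in> borel_measurable borel" by (rule levy_op_measurable[OF t])
    have "symbol_op (\<lambda>\<xi>. levy_exponent b Q nu (- \<xi>)) \<phi> = levy_op \<phi>"
      using symbol_op_eq_levy_op[OF t] by auto
    then have "0 = (LINT x|lebesgue. f x * levy_op \<phi> x)"
      using assms(6) t by (auto simp: weak_solution_def Let_def)
    also have "\<dots> = (LINT x|lebesgue. h x * levy_op \<phi> x)"
    proof (rule integral_cong_AE)
      show "AE x in lebesgue. f x * levy_op \<phi> x = h x * levy_op \<phi> x" using fh by eventually_elim simp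
      have "levy_op \<phi> \<in> borel_measurable lebesgue" "h \<in> borel_measurable lebesgue"
        by (auto intro: measurable_completion)
      then show "(\<lambda>x. f x * levy_op \<phi> x) \<in> borel_measurable lebesgue"
        "(\<lambda>x. h x * levy_op \<phi> x) \<in> borel_measurable lebesgue" using f by auto
    qed
    also have "\<dots> = (LINT x|lborel. h x * levy_op \<phi> x)" by (rule integral_completion) measurable
    finally show "(LINT x|lborel. h x * levy_op \<phi> x) = 0" by simp
  qed
  have "AE x in lebesgue. h x = (mollified 1 0 * of_real x + mollified 0 0) / of_real (2 * pi)"
    by (rule AE_completion[OF solution_affine])
  with fh have "AE x in lebesgue. f x = mollified 1 0 / of_real (2 * pi) * of_real x + mollified 0 0 / of_real (2 * pi)"
    by eventually_elim (simp add: add_divide_distrib)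
  then show ?thesis by blast
qed

end
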